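(* Let $f$ be a Rademacher random multiplicative function. Then $$\Big(\frac{1}{(\log 1/s)^{1/2}}\Big(\log \sum_{n\geq 1} \frac{f(n)}{n^{1/2+s^t}}+\frac{\log \zeta(1+2s^t)}{2} \Big)\Big)_{t\geq 0}\ \Longrightarrow\ (B(t))_{t\geq 0},\qquad s\to 0+,$$ on $C[0,\infty)$, where $(B(t))_{t\geq 0}$ is a standard Brownian motion and $\zeta(r):=\sum_{n\geq 1}n^{-r}$ for $r>1$.
   Context: A Rademacher random multiplicative function $f$ is defined as follows: $(f(p))_{p\text{ prime}}$ are independent random variables with $\mathbb{P}\{f(p)=1\}=\mathbb{P}\{f(p)=-1\}=1/2$; $f(1):=1$; $f(n):=\prod_{p\mid n}f(p)$ (product over the prime divisors of $n$) if $n$ is square-free; and $f(n):=0$ if $n$ is not square-free. For $s>0$ the series $F(s):=\sum_{n\ge1}f(n)n^{-1/2-s}$ converges a.s. and has the Euler product representation $F(s)=\prod_p\big(1+f(p)p^{-1/2-s}\big)$ (product over primes), which is strictly positive, so that $\log F(s)$ is real-valued. In the claim $s\in(0,1)$. $C[0,\infty)$ is the space of real-valued continuous functions on $[0,\infty)$ with the topology of locally uniform convergence, and $\Longrightarrow$ denotes weak convergence in this function space. *)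

theory Defs
  imports "HOL-Probability.Probability" "HOL-Computational_Algebra.Computational_Algebra"
begin

section \<open>The space of continuous functions on the closed half-line\<close>

typedef cpath = "{g :: real \<Rightarrow> real. g \<in> extensional {0..} \<and> continuous_on {0..} g}"
  morphisms path_at Abs_cpath
proof
  show "restrict (\<lambda>_. 0) {0..} \<in> {g :: real \<Rightarrow> real. g \<in> extensional {0..} \<and> continuous_on {0..} g}"
    by (auto intro: continuous_on_eq[of _ "\<lambda>_. 0"])
qed

text \<open>The topology of locally uniform convergence; see \<open>tendsto_cpath_iff\<close> below.\<close>

instantiation cpath :: topological_space
begin

definition open_cpath :: "cpath set \<Rightarrow> bool" where
  "open_cpath U \<longleftrightarrow>
     (\<forall>x\<in>U. \<exists>T. \<exists>e>0. \<forall>y. (\<forall>t\<in>{0..T}. \<bar>path_at y t - path_at x t\<bar> < e) \<longrightarrow> y \<in> U)"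

instance
proof
  show "open (UNIV :: cpath set)"
    unfolding open_cpath_def by (auto intro: exI[of _ 1])
next
  fix U V :: "cpath set"
  assume U: "open U" and V: "open V"
  show "open (U \<inter> V)"
    unfolding open_cpath_def
  proof
    fix x assume x: "x \<in> U \<inter> V"
    obtain T e where 1: "e > 0"
      "\<And>y. (\<forall>t\<in>{0..T}. \<bar>path_at y t - path_at x t\<bar> < e) \<Longrightarrow> y \<in> U"
      using U x unfolding open_cpath_def by blast
    obtain T' e' where 2: "e' > 0"
      "\<And>y. (\<forall>t\<in>{0..T'}. \<bar>path_at y t - path_at x t\<bar> < e') \<Longrightarrow> y \<in> V"
      using V x unfolding open_cpath_def by blast
    have "y \<in> U \<inter> V" if "\<forall>t\<in>{0..max T T'}. \<bar>path_at y t - path_at x t\<bar> < min e e'" for y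
      using that by (auto intro!: 1(2) 2(2))
    then show "\<exists>T. \<exists>e>0. \<forall>y. (\<forall>t\<in>{0..T}. \<bar>path_at y t - path_at x t\<bar> < e) \<longrightarrow> y \<in> U \<inter> V"
      using 1(1) 2(1) by (intro exI[of _ "max T T'"] exI[of _ "min e e'"]) auto
  qed
next
  fix K :: "cpath set set"
  assume "\<forall>U\<in>K. open U"
  then show "open (\<Union>K)"
    unfolding open_cpath_def by (meson Union_iff)
qed

end

lemma continuous_on_path_at: "S \<subseteq> {0..} \<Longrightarrow> continuous_on S (path_at x)"
  using path_at[of x] continuous_on_subset by blast

lemma open_cpath_uball:
  assumes "e > 0"
  shows "open {y. \<exists>d<e. \<forall>t\<in>{0..T}. \<bar>path_at y t - path_at x t\<bar> \<le> d}"
  unfolding open_cpath_def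
proof
  fix y assume "y \<in> {y. \<exists>d<e. \<forall>t\<in>{0..T}. \<bar>path_at y t - path_at x t\<bar> \<le> d}"
  then obtain d where d: "d < e" "\<forall>t\<in>{0..T}. \<bar>path_at y t - path_at x t\<bar> \<le> d" by blast
  have "\<exists>d<e. \<forall>t\<in>{0..T}. \<bar>path_at z t - path_at x t\<bar> \<le> d"
    if z: "\<forall>t\<in>{0..T}. \<bar>path_at z t - path_at y t\<bar> < (e - d) / 2" for z
  proof (intro exI[of _ "(e + d) / 2"] conjI ballI)
    show "(e + d) / 2 < e" using d(1) by simp
    fix t assume t: "t \<in> {0..T}"
    show "\<bar>path_at z t - path_at x t\<bar> \<le> (e + d) / 2"
      using bspec[OF d(2) t] bspec[OF z t]
        abs_triangle_ineq[of "path_at z t - path_at y t" "path_at y t - path_at x t"]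
      by (simp add: field_simps)
  qed
  then show "\<exists>T'. \<exists>e'>0. \<forall>z. (\<forall>t\<in>{0..T'}. \<bar>path_at z t - path_at y t\<bar> < e') \<longrightarrow>
      z \<in> {y. \<exists>d<e. \<forall>t\<in>{0..T}. \<bar>path_at y t - path_at x t\<bar> \<le> d}"
    using d(1) by (intro exI[of _ T] exI[of _ "(e - d) / 2"]) auto
qed

lemma tendsto_cpath_iff:
  "(X \<longlongrightarrow> x) F \<longleftrightarrow> (\<forall>T. uniform_limit {0..T} (\<lambda>i. path_at (X i)) (path_at x) F)"
proof
  assume lim: "(X \<longlongrightarrow> x) F"
  show "\<forall>T. uniform_limit {0..T} (\<lambda>i. path_at (X i)) (path_at x) F"
  proof (intro allI uniform_limitI)
    fix T e :: real assume e: "e > 0"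
    have "\<forall>\<^sub>F i in F. X i \<in> {y. \<exists>d<e. \<forall>t\<in>{0..T}. \<bar>path_at y t - path_at x t\<bar> \<le> d}"
      by (rule topological_tendstoD[OF lim open_cpath_uball[OF e]])
        (use e in \<open>auto intro!: exI[of _ 0]\<close>)
    then show "\<forall>\<^sub>F i in F. \<forall>t\<in>{0..T}. dist (path_at (X i) t) (path_at x t) < e"
      by eventually_elim (force simp: dist_real_def)
  qed
next
  assume lim: "\<forall>T. uniform_limit {0..T} (\<lambda>i. path_at (X i)) (path_at x) F"
  show "(X \<longlongrightarrow> x) F"
  proof (rule topological_tendstoI)
    fix U assume "open U" "x \<in> U"
    then obtain T e where U: "e > 0"
      "\<And>y. (\<forall>t\<in>{0..T}. \<bar>path_at y t - path_at x t\<bar> < e) \<Longrightarrow> y \<in> U"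
      unfolding open_cpath_def by blast
    have "\<forall>\<^sub>F i in F. \<forall>t\<in>{0..T}. dist (path_at (X i) t) (path_at x t) < e"
      by (rule uniform_limitD[OF spec[OF lim] U(1)])
    then show "\<forall>\<^sub>F i in F. X i \<in> U"
      by eventually_elim (auto simp: dist_real_def intro: U(2))
  qed
qed

text \<open>Discontinuous functions are sent to the zero path, so that a process whose paths are only almost
  surely continuous still yields a map into \<^typ>\<open>cpath\<close>.\<close>

definition cpath_of :: "(real \<Rightarrow> real) \<Rightarrow> cpath" where
  "cpath_of g = Abs_cpath (restrict (if continuous_on {0..} g then g else (\<lambda>_. 0)) {0..})"

lemma path_at_cpath_of:
  assumes "continuous_on {0..} g" "t \<ge> 0"
  shows "path_at (cpath_of g) t = g t"
proof -
  have "continuous_on {0..} (restrict g {0..})"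
    by (rule continuous_on_eq[OF assms(1)]) simp
  then show ?thesis
    using assms by (simp add: cpath_of_def Abs_cpath_inverse)
qed


section \<open>Weak convergence and Brownian motion\<close>

definition converges_weakly ::
    "'a measure \<Rightarrow> ('i \<Rightarrow> 'a \<Rightarrow> 'c :: topological_space) \<Rightarrow> 'b measure \<Rightarrow> ('b \<Rightarrow> 'c) \<Rightarrow> 'i filter \<Rightarrow> bool"
  where
  "converges_weakly M X N Y F \<longleftrightarrow>
     prob_space M \<and> prob_space N \<and>
     (\<forall>\<^sub>F i in F. X i \<in> borel_measurable M) \<and> Y \<in> borel_measurable N \<and>
     (\<forall>\<Phi> :: 'c \<Rightarrow> real. continuous_on UNIV \<Phi> \<and> bounded (range \<Phi>) \<longrightarrow>
        ((\<lambda>i. \<integral>\<omega>. \<Phi> (X i \<omega>) \<partial>M) \<longlongrightarrow> (\<integral>\<omega>. \<Phi> (Y \<omega>) \<partial>N)) F)"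

definition standard_brownian_motion :: "'b measure \<Rightarrow> ('b \<Rightarrow> cpath) \<Rightarrow> bool" where
  "standard_brownian_motion N B \<longleftrightarrow>
     prob_space N \<and> B \<in> borel_measurable N \<and>
     (AE \<omega> in N. path_at (B \<omega>) 0 = 0) \<and>
     (\<forall>s t. 0 \<le> s \<and> s < t \<longrightarrow>
        distributed N lborel (\<lambda>\<omega>. path_at (B \<omega>) t - path_at (B \<omega>) s)
          (normal_density 0 (sqrt (t - s)))) \<and>
     (\<forall>(n :: nat) (\<tau> :: nat \<Rightarrow> real). 0 \<le> \<tau> 0 \<and> (\<forall>i<n. \<tau> i < \<tau> (Suc i)) \<longrightarrow>
        prob_space.indep_vars N (\<lambda>_. borel)
          (\<lambda>i \<omega>. path_at (B \<omega>) (\<tau> (Suc i)) - path_at (B \<omega>) (\<tau> i)) {..<n})"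


section \<open>Rademacher random multiplicative functions\<close>

definition rademacher_multiplicative :: "'a measure \<Rightarrow> (nat \<Rightarrow> 'a \<Rightarrow> real) \<Rightarrow> bool" where
  "rademacher_multiplicative M f \<longleftrightarrow>
     prob_space M \<and>
     prob_space.indep_vars M (\<lambda>_. borel) f {p. prime p} \<and>
     (\<forall>p. prime p \<longrightarrow>
        measure M {\<omega> \<in> space M. f p \<omega> = 1} = 1 / 2 \<and>
        measure M {\<omega> \<in> space M. f p \<omega> = - 1} = 1 / 2) \<and>
     (\<forall>\<omega>\<in>space M. f 1 \<omega> = 1) \<and>
     (\<forall>n\<ge>1. \<forall>\<omega>\<in>space M.
        f n \<omega> = (if squarefree n then \<Prod>p\<in>prime_factors n. f p \<omega> else 0))"

definition zeta_real :: "real \<Rightarrow> real" where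
  "zeta_real r = (\<Sum>n. real (Suc n) powr (- r))"

definition dirichlet_sum :: "(nat \<Rightarrow> 'a \<Rightarrow> real) \<Rightarrow> 'a \<Rightarrow> real \<Rightarrow> real" where
  "dirichlet_sum f \<omega> r = (\<Sum>n. f (Suc n) \<omega> / real (Suc n) powr r)"

text \<open>The series in \<open>dirichlet_sum\<close> is only conditionally convergent, and only almost surely, for
  exponents near 1/2. On the exceptional null set the value of \<open>log_process\<close> has no meaning; it should
  therefore be regarded as a random element with respect to the completion of the underlying measure.\<close>

definition log_process :: "(nat \<Rightarrow> 'a \<Rightarrow> real) \<Rightarrow> real \<Rightarrow> 'a \<Rightarrow> cpath" where
  "log_process f s \<omega> = cpath_of (\<lambda>t.
     1 / sqrt (ln (1 / s)) *
       (ln (dirichlet_sum f \<omega> (1 / 2 + s powr t)) + ln (zeta_real (1 + 2 * s powr t)) / 2))"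

end

theory Submission
  imports Defs
begin

text \<open>
  Put \<open>Y(u) = \<Sum>\<^sub>p f(p) p\<^sup>-\<^sup>1\<^sup>/\<^sup>2\<^sup>-\<^sup>u\<close>, the sum running over the primes. Expanding the logarithm of the Euler product
  to second order, and comparing \<open>\<Sum>\<^sub>p p\<^sup>-\<^sup>1\<^sup>-\<^sup>2\<^sup>u\<close> with \<open>log \<zeta>(1 + 2u)\<close>, shows that
  \<open>log F(u) + log \<zeta>(1 + 2u) / 2\<close> differs from \<open>Y(u)\<close> by at most an absolute constant
  (\<open>log_remainder\<close>), which the normalisation \<open>(log 1/s)\<^sup>-\<^sup>1\<^sup>/\<^sup>2\<close> removes. So only the process
  \<open>t \<mapsto> Y(s\<^sup>t) / (log 1/s)\<^sup>1\<^sup>/\<^sup>2\<close> matters, which is linear in independent signs.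

  The number theory enters through \<open>\<Sum>\<^sub>p p\<^sup>-\<^sup>1\<^sup>-\<^sup>u = log (1/u) + O(1)\<close> for \<open>0 < u \<le> 2\<close> (\<open>prime_zeta_asymptotics\<close>). It gives the
  variance \<open>log (v/u) + O(1)\<close> for \<open>Y(u) - Y(v)\<close>, where \<open>0 < u \<le> v \<le> 1\<close>, and the same
  sum shows that all but \<open>O(1)\<close> of this variance comes from the primes with \<open>1/v < log p \<le> 1/u\<close> (\<open>block_sum_asymptotics\<close>). For \<open>u = s\<^sup>t\<close> and
  \<open>v = s\<^sup>r\<close> the variance is \<open>(t - r) log (1/s) + O(1)\<close>, and consecutive time intervals use disjoint blocks
  of primes. After normalisation the increments are therefore asymptotically independent, and each is asymptotically
  normal by the central limit theorem for signs with small weights (\<open>prime_sum_clt\<close>). This is the convergence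
  of the finite-dimensional distributions (\<open>prime_path_fdd\<close>).

  Tightness comes from the fourth moment: \<open>Y(u) - Y(v)\<close> has variance at most \<open>C log (v/u)\<close>, without an additive
  constant (\<open>prime_weight_total_le\<close>), and a weighted sum of signs has a fourth moment at most three times its
  squared variance. The normalised increment over \<open>[r, t]\<close> thus has fourth moment at most \<open>C' (t - r)\<^sup>2\<close> uniformly
  in \<open>s\<close>. Instead of passing through relative compactness of laws, \<open>kolmogorov_weak_convergence\<close> uses this bound
  directly: by chaining, a path is uniformly close in mean to its dyadic polygon, and a Lipschitz functional of a polygon
  is a continuous function of the path at the grid points. Lipschitz functionals suffice because every bounded continuous
  functional is the increasing limit of its Lipschitz envelopes.

  It remains to see that the logarithm is meaningful. The values of \<open>f\<close> at distinct integers are orthogonal, so a dyadic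
  maximal inequality yields \<open>\<bar>\<Sum>\<^sub>n\<^sub>\<le>\<^sub>N f(n)\<bar> = O(N\<^sup>1\<^sup>/\<^sup>2\<^sup>+\<^sup>\<delta>)\<close> almost surely, hence convergence and
  continuity of the Dirichlet series. The difference between its partial sums and the finite Euler products tends to
  zero in mean square, so their limits agree almost surely, first at rational exponents and then everywhere by continuity
  (\<open>AE_euler_product\<close>).
\<close>

section \<open>A metric for locally uniform convergence\<close>

text \<open>The cut-off \<open>1 / (1 + t)\<close> makes a distance below \<open>\<epsilon>\<close> a statement about the times \<open>t < 1 / \<epsilon> - 1\<close> only,
  so that this single supremum metrises locally uniform convergence.\<close>

definition cdist :: "cpath \<Rightarrow> cpath \<Rightarrow> real" where
  "cdist x y = (SUP t\<in>{0..}. min \<bar>path_at x t - path_at y t\<bar> (1 / (1 + t)))"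

lemma cdist_bdd: "bdd_above ((\<lambda>t. min \<bar>path_at x t - path_at y t\<bar> (1 / (1 + t))) ` {0..})"
  by (rule bdd_aboveI2[where M = 1]) (auto simp: min_le_iff_disj)

lemma cdist_upper: "t \<ge> 0 \<Longrightarrow> min \<bar>path_at x t - path_at y t\<bar> (1 / (1 + t)) \<le> cdist x y"
  unfolding cdist_def by (rule cSUP_upper[OF _ cdist_bdd]) auto

lemma cdist_le: "(\<And>t. t \<ge> 0 \<Longrightarrow> min \<bar>path_at x t - path_at y t\<bar> (1 / (1 + t)) \<le> c) \<Longrightarrow> cdist x y \<le> c"
  unfolding cdist_def by (rule cSUP_least) auto

lemma cdist_nonneg: "0 \<le> cdist x y"
  using cdist_upper[of 0 x y] by (auto simp: min_def split: if_splits)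

lemma cdist_self [simp]: "cdist x x = 0"
  by (rule antisym[OF cdist_le cdist_nonneg]) auto

lemma cdist_commute: "cdist x y = cdist y x"
  unfolding cdist_def by (simp add: abs_minus_commute)

lemma cdist_triangle: "cdist x z \<le> cdist x y + cdist y z"
proof (rule cdist_le)
  fix t :: real assume t: "t \<ge> 0"
  have *: "min c w \<le> min a w + min b w" if "c \<le> a + b" "0 \<le> a" "0 \<le> b" "0 \<le> w" for a b c w :: real
    using that by (auto simp: min_def)
  have "min \<bar>path_at x t - path_at z t\<bar> (1 / (1 + t)) \<le>
      min \<bar>path_at x t - path_at y t\<bar> (1 / (1 + t)) + min \<bar>path_at y t - path_at z t\<bar> (1 / (1 + t))"
    using t by (intro *) auto
  also have "\<dots> \<le> cdist x y + cdist y z"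
    by (intro add_mono cdist_upper t)
  finally show "min \<bar>path_at x t - path_at z t\<bar> (1 / (1 + t)) \<le> cdist x y + cdist y z" .
qed

lemma cdist_le_local:
  assumes "K \<ge> 0" "e \<ge> 0" "\<And>t. 0 \<le> t \<Longrightarrow> t < K \<Longrightarrow> \<bar>path_at x t - path_at y t\<bar> \<le> e"
  shows "cdist x y \<le> e + 1 / (1 + K)"
proof (rule cdist_le)
  fix t :: real assume t: "t \<ge> 0"
  show "min \<bar>path_at x t - path_at y t\<bar> (1 / (1 + t)) \<le> e + 1 / (1 + K)"
  proof (cases "t < K")
    case True
    then show ?thesis using assms(3)[OF t] assms(1) by (simp add: min_le_iff_disj add_increasing2)
  next
    case False
    then have "1 / (1 + t) \<le> 1 / (1 + K)" using assms(1) by (intro divide_left_mono) auto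
    then show ?thesis using assms(2) by (simp add: min_le_iff_disj add_increasing)
  qed
qed

lemma cdist_le_uniform:
  assumes "\<And>t. 0 \<le> t \<Longrightarrow> \<bar>path_at x t - path_at y t\<bar> \<le> e"
  shows "cdist x y \<le> e"
  by (rule cdist_le) (use assms in \<open>auto simp: min_le_iff_disj\<close>)

lemma tendsto_cdist_zero:
  assumes "(X \<longlongrightarrow> x) F"
  shows "((\<lambda>i. cdist (X i) x) \<longlongrightarrow> 0) F"
proof (rule tendstoI)
  fix e :: real assume e: "e > 0"
  have lim: "\<forall>\<^sub>F i in F. \<forall>t\<in>{0..2/e}. dist (path_at (X i) t) (path_at x t) < e / 2"
    by (rule uniform_limitD) (use assms e in \<open>auto simp: tendsto_cpath_iff\<close>)
  have e2: "1 / (1 + 2 / e) < e / 2"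
  proof -
    have "1 / (1 + 2 / e) = e / (e + 2)" using e by (simp add: field_simps)
    also have "\<dots> < e / 2" using e by (intro divide_strict_left_mono) auto
    finally show ?thesis .
  qed
  show "\<forall>\<^sub>F i in F. dist (cdist (X i) x) 0 < e"
    using lim
  proof eventually_elim
    case (elim i)
    have "cdist (X i) x \<le> e / 2 + 1 / (1 + 2 / e)"
      using e elim by (intro cdist_le_local) (auto simp: dist_real_def less_imp_le)
    then show ?case using cdist_nonneg[of "X i" x] e2 by (simp add: dist_real_def)
  qed
qed

lemma open_cpath_cdist:
  assumes "open U" "x \<in> U"
  obtains e where "e > 0" "\<And>y. cdist x y < e \<Longrightarrow> y \<in> U"
proof -
  obtain T e where U: "e > 0"
    "\<And>y. (\<forall>t\<in>{0..T}. \<bar>path_at y t - path_at x t\<bar> < e) \<Longrightarrow> y \<in> U"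
    using assms unfolding open_cpath_def by blast
  define e' where "e' = min e (1 / (1 + \<bar>T\<bar>))"
  have "y \<in> U" if y: "cdist x y < e'" for y
  proof (rule U(2), intro ballI)
    fix t assume t: "t \<in> {0..T}"
    then have "1 / (1 + \<bar>T\<bar>) \<le> 1 / (1 + t)" by (intro divide_left_mono) auto
    then have "min \<bar>path_at x t - path_at y t\<bar> (1 / (1 + t)) < min e (1 / (1 + t))"
      using cdist_upper[of t x y] t y unfolding e'_def by auto
    then show "\<bar>path_at y t - path_at x t\<bar> < e" by (auto simp: min_def abs_minus_commute split: if_splits)
  qed
  moreover have "e' > 0" using U(1) unfolding e'_def by auto
  ultimately show ?thesis using that by blast
qed

section \<open>Lipschitz functionals determine weak convergence\<close>

text \<open>Lipschitz continuity is tied to \<^const>\<open>cdist\<close> because \<^typ>\<open>cpath\<close> carries only a topology.\<close>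

definition cdist_lipschitz :: "real \<Rightarrow> (cpath \<Rightarrow> real) \<Rightarrow> bool" where
  "cdist_lipschitz m \<Phi> \<longleftrightarrow> m \<ge> 0 \<and> (\<forall>x y. \<bar>\<Phi> x - \<Phi> y\<bar> \<le> m * cdist x y)"

lemma cdist_lipschitz_continuous:
  assumes "cdist_lipschitz m \<Phi>"
  shows "continuous_on UNIV \<Phi>"
  unfolding continuous_on_def
proof
  fix x :: cpath
  have "((\<lambda>y. m * cdist y x) \<longlongrightarrow> m * 0) (at x)"
    by (intro tendsto_mult tendsto_const tendsto_cdist_zero tendsto_ident_at)
  then have "((\<lambda>y. \<Phi> y - \<Phi> x) \<longlongrightarrow> 0) (at x)"
    by (intro Lim_null_comparison[of "\<lambda>y. \<Phi> y - \<Phi> x" "\<lambda>y. m * cdist y x"])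
      (use assms in \<open>auto simp: cdist_lipschitz_def\<close>)
  then show "(\<Phi> \<longlongrightarrow> \<Phi> x) (at x)" by (simp add: LIM_zero_iff)
qed

text \<open>The largest \<open>m\<close>-Lipschitz function below \<open>\<Phi>\<close> (the infimal convolution of \<open>\<Phi>\<close> with \<open>m\<close> times the metric).\<close>

definition lipschitz_envelope :: "real \<Rightarrow> (cpath \<Rightarrow> real) \<Rightarrow> cpath \<Rightarrow> real" where
  "lipschitz_envelope m \<Phi> x = (INF y. \<Phi> y + m * cdist x y)"

context
  fixes \<Phi> :: "cpath \<Rightarrow> real" and C m :: real
  assumes bound: "\<And>x. \<bar>\<Phi> x\<bar> \<le> C" and m: "m \<ge> 0"
begin

lemma envelope_bdd: "bdd_below (range (\<lambda>y. \<Phi> y + m * cdist x y))"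
proof (rule bdd_belowI2)
  show "- C \<le> \<Phi> y + m * cdist x y" for y
    using bound[of y] mult_nonneg_nonneg[OF m cdist_nonneg[of x y]] by linarith
qed

lemma envelope_lower: "lipschitz_envelope m \<Phi> x \<le> \<Phi> y + m * cdist x y"
  unfolding lipschitz_envelope_def by (rule cINF_lower[OF envelope_bdd]) auto

lemma envelope_greatest: "(\<And>y. c \<le> \<Phi> y + m * cdist x y) \<Longrightarrow> c \<le> lipschitz_envelope m \<Phi> x"
  unfolding lipschitz_envelope_def by (rule cINF_greatest) auto

lemma envelope_le: "lipschitz_envelope m \<Phi> x \<le> \<Phi> x"
  using envelope_lower[of x x] by simp

lemma envelope_bound: "\<bar>lipschitz_envelope m \<Phi> x\<bar> \<le> C"
proof -
  have "- C \<le> lipschitz_envelope m \<Phi> x"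
  proof (rule envelope_greatest)
    show "- C \<le> \<Phi> y + m * cdist x y" for y
      using bound[of y] mult_nonneg_nonneg[OF m cdist_nonneg[of x y]] by linarith
  qed
  then show ?thesis using envelope_le[of x] bound[of x] by linarith
qed

lemma envelope_lipschitz: "cdist_lipschitz m (lipschitz_envelope m \<Phi>)"
proof -
  have *: "lipschitz_envelope m \<Phi> x - m * cdist x y \<le> lipschitz_envelope m \<Phi> y" for x y
  proof (rule envelope_greatest)
    fix z
    have "lipschitz_envelope m \<Phi> x \<le> \<Phi> z + m * cdist x z" by (rule envelope_lower)
    also have "\<dots> \<le> \<Phi> z + m * (cdist x y + cdist y z)"
      using m by (intro add_left_mono mult_left_mono cdist_triangle)
    finally show "lipschitz_envelope m \<Phi> x - m * cdist x y \<le> \<Phi> z + m * cdist y z"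
      by (simp add: algebra_simps)
  qed
  have "\<bar>lipschitz_envelope m \<Phi> x - lipschitz_envelope m \<Phi> y\<bar> \<le> m * cdist x y" for x y
    using *[of x y] *[of y x] by (simp add: cdist_commute[of y x])
  then show ?thesis using m by (simp add: cdist_lipschitz_def)
qed

end

text \<open>Points \<open>y\<close> far from \<open>x\<close> cannot lower the infimum once the penalty \<open>m d\<close> exceeds the oscillation of \<open>\<Phi>\<close>, so only
  the values near \<open>x\<close> count.\<close>

lemma envelope_ge:
  assumes bound: "\<And>x. \<bar>\<Phi> x\<bar> \<le> C" and m: "m \<ge> 0"
    and d: "d > 0" "\<And>y. cdist x y < d \<Longrightarrow> c \<le> \<Phi> y" and big: "c + C \<le> m * d"
  shows "c \<le> lipschitz_envelope m \<Phi> x"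
proof (rule envelope_greatest[OF bound m])
  fix y
  show "c \<le> \<Phi> y + m * cdist x y"
  proof (cases "cdist x y < d")
    case True
    then show ?thesis using d(2)[of y] mult_nonneg_nonneg[OF m cdist_nonneg[of x y]] by linarith
  next
    case False
    then have "m * d \<le> m * cdist x y" using m by (intro mult_left_mono) auto
    then show ?thesis using bound[of y] big by linarith
  qed
qed

lemma envelope_tendsto:
  assumes bound: "\<And>x. \<bar>\<Phi> x\<bar> \<le> C" and cont: "continuous_on UNIV \<Phi>"
  shows "(\<lambda>m. lipschitz_envelope (real m) \<Phi> x) \<longlonglongrightarrow> \<Phi> x"
proof (rule LIMSEQ_I)
  fix e :: real assume e: "e > 0"
  have "open (\<Phi> -` {\<Phi> x - e / 2 <..})"
    using cont by (simp add: continuous_on_open_vimage)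
  moreover have "x \<in> \<Phi> -` {\<Phi> x - e / 2 <..}" using e by auto
  ultimately obtain d where d: "d > 0" "\<And>y. cdist x y < d \<Longrightarrow> y \<in> \<Phi> -` {\<Phi> x - e / 2 <..}"
    by (rule open_cpath_cdist) blast
  obtain k :: nat where k: "real k > 2 * C / d" using reals_Archimedean2 by blast
  have "norm (lipschitz_envelope (real n) \<Phi> x - \<Phi> x) < e" if n: "n \<ge> k" for n
  proof -
    have "2 * C / d \<le> real n" using k n by linarith
    then have "2 * C \<le> real n * d" using d(1) by (simp add: pos_divide_le_eq)
    then have "\<Phi> x - e / 2 \<le> lipschitz_envelope (real n) \<Phi> x"
      using bound[of x] e d by (intro envelope_ge[OF bound _ d(1)]) (auto intro: less_imp_le)
    moreover have "lipschitz_envelope (real n) \<Phi> x \<le> \<Phi> x" by (rule envelope_le[OF bound]) auto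
    ultimately show ?thesis using e by simp
  qed
  then show "\<exists>no. \<forall>n\<ge>no. norm (lipschitz_envelope (real n) \<Phi> x - \<Phi> x) < e" by blast
qed

lemma continuous_imp_borel: "continuous_on UNIV \<Phi> \<Longrightarrow> X \<in> borel_measurable M \<Longrightarrow> (\<lambda>w. \<Phi> (X w)) \<in> borel_measurable M"
  by (rule measurable_compose[OF _ borel_measurable_continuous_onI])

lemma (in prob_space) integrable_bounded_real:
  fixes g :: "'a \<Rightarrow> real"
  assumes "g \<in> borel_measurable M" "\<And>w. w \<in> space M \<Longrightarrow> \<bar>g w\<bar> \<le> C"
  shows "integrable M g"
  by (rule integrable_const_bound[where B = C]) (use assms in auto)

text \<open>The mean distance controls expectations of Lipschitz functionals. All approximations of paths below are used in this form.\<close>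

lemma (in prob_space) expectation_lipschitz_difference:
  fixes X Y :: "'a \<Rightarrow> cpath"
  assumes \<Psi>: "cdist_lipschitz m \<Psi>" "\<And>x. \<bar>\<Psi> x\<bar> \<le> D"
    and meas: "(\<lambda>w. \<Psi> (X w)) \<in> borel_measurable M" "(\<lambda>w. \<Psi> (Y w)) \<in> borel_measurable M"
    and c: "c \<ge> 0" "(\<integral>\<^sup>+w. ennreal (cdist (X w) (Y w)) \<partial>M) \<le> ennreal c"
  shows "\<bar>(\<integral>w. \<Psi> (X w) \<partial>M) - (\<integral>w. \<Psi> (Y w) \<partial>M)\<bar> \<le> m * c"
proof -
  have m: "m \<ge> 0" and lip: "\<bar>\<Psi> x - \<Psi> y\<bar> \<le> m * cdist x y" for x y
    using \<Psi>(1) by (auto simp: cdist_lipschitz_def)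
  have i1: "integrable M (\<lambda>w. \<Psi> (X w))" by (rule integrable_bounded_real[OF meas(1)]) (rule \<Psi>(2))
  have i2: "integrable M (\<lambda>w. \<Psi> (Y w))" by (rule integrable_bounded_real[OF meas(2)]) (rule \<Psi>(2))
  let ?h = "\<lambda>w. \<bar>\<Psi> (X w) - \<Psi> (Y w)\<bar>"
  have "(\<integral>\<^sup>+w. ennreal (?h w) \<partial>M) \<le> ennreal (m * c)"
  proof (cases "m = 0")
    case True
    then have "?h w = 0" for w using lip[of "X w" "Y w"] by simp
    then show ?thesis by simp
  next
    case False
    then have m0: "m > 0" using m by simp
    have [measurable]: "?h \<in> borel_measurable M" using meas by measurable
    \<comment> \<open>the factor \<open>m\<close> is taken out of the integral of \<open>?h\<close>, which is known to be measurable, unlike the distance\<close>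
    have "(\<integral>\<^sup>+w. ennreal (?h w) \<partial>M) = (\<integral>\<^sup>+w. ennreal m * ennreal (?h w / m) \<partial>M)"
      using m0 by (intro nn_integral_cong) (simp add: ennreal_mult'[symmetric])
    also have "\<dots> = ennreal m * (\<integral>\<^sup>+w. ennreal (?h w / m) \<partial>M)" by (rule nn_integral_cmult) measurable
    also have "\<dots> \<le> ennreal m * (\<integral>\<^sup>+w. ennreal (cdist (X w) (Y w)) \<partial>M)"
      using lip m0 by (intro mult_left_mono nn_integral_mono ennreal_leI) (auto simp: pos_divide_le_eq mult.commute)
    also have "\<dots> \<le> ennreal m * ennreal c" by (intro mult_left_mono c(2)) simp
    finally show ?thesis using m by (simp add: ennreal_mult')
  qed
  moreover have "ennreal \<bar>\<integral>w. \<Psi> (X w) - \<Psi> (Y w) \<partial>M\<bar> \<le> (\<integral>\<^sup>+w. ennreal (?h w) \<partial>M)"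
    using integral_norm_bound_ennreal[OF Bochner_Integration.integrable_diff[OF i1 i2]] by simp
  ultimately have "ennreal \<bar>\<integral>w. \<Psi> (X w) - \<Psi> (Y w) \<partial>M\<bar> \<le> ennreal (m * c)" by (rule order_trans[rotated])
  then show ?thesis using m c(1) by (simp add: Bochner_Integration.integral_diff[OF i1 i2])
qed

text \<open>The envelopes of \<open>\<Phi>\<close> increase to \<open>\<Phi>\<close>, so they give the lower half \<open>liminf E \<Phi>(X\<^sub>i) \<ge> E \<Phi>(Y)\<close>; applied to
  \<open>- \<Phi>\<close> this gives the upper half.\<close>

lemma weak_convergence_lipschitz:
  fixes \<Phi> :: "cpath \<Rightarrow> real" and X :: "'i \<Rightarrow> 'a \<Rightarrow> cpath" and Y :: "'b \<Rightarrow> cpath"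
  assumes M: "prob_space M" and N: "prob_space N"
    and X: "\<And>i. X i \<in> borel_measurable M" and Y: "Y \<in> borel_measurable N"
    and lip: "\<And>\<Psi> m C. cdist_lipschitz m \<Psi> \<Longrightarrow> (\<And>x. \<bar>\<Psi> x\<bar> \<le> C) \<Longrightarrow>
      ((\<lambda>i. \<integral>w. \<Psi> (X i w) \<partial>M) \<longlongrightarrow> (\<integral>w. \<Psi> (Y w) \<partial>N)) F"
    and cont: "continuous_on UNIV \<Phi>" and bdd: "bounded (range \<Phi>)"
  shows "((\<lambda>i. \<integral>w. \<Phi> (X i w) \<partial>M) \<longlongrightarrow> (\<integral>w. \<Phi> (Y w) \<partial>N)) F"
proof -
  interpret M: prob_space M by fact
  interpret N: prob_space N by fact
  have lower: "\<forall>\<^sub>F i in F. (\<integral>w. \<Psi> (Y w) \<partial>N) - e < (\<integral>w. \<Psi> (X i w) \<partial>M)"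
    if \<Psi>: "continuous_on UNIV \<Psi>" "\<And>x. \<bar>\<Psi> x\<bar> \<le> C" and e: "e > 0" for \<Psi> C and e :: real
  proof -
    let ?E = "\<lambda>m. lipschitz_envelope (real m) \<Psi>"
    have L: "cdist_lipschitz (real m) (?E m)" for m by (rule envelope_lipschitz[OF \<Psi>(2)]) auto
    have B: "\<bar>?E m x\<bar> \<le> C" for m x by (rule envelope_bound[OF \<Psi>(2)]) auto
    note c = cdist_lipschitz_continuous[OF L]
    have "(\<lambda>m. \<integral>w. ?E m (Y w) \<partial>N) \<longlonglongrightarrow> (\<integral>w. \<Psi> (Y w) \<partial>N)"
    proof (rule integral_dominated_convergence[where w = "\<lambda>_. C"])
      show "(\<lambda>w. \<Psi> (Y w)) \<in> borel_measurable N" by (rule continuous_imp_borel[OF \<Psi>(1) Y])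
      show "(\<lambda>w. ?E m (Y w)) \<in> borel_measurable N" for m by (rule continuous_imp_borel[OF c Y])
    qed (use B envelope_tendsto[OF \<Psi>(2,1)] in auto)
    from order_tendstoD(1)[OF this, of "(\<integral>w. \<Psi> (Y w) \<partial>N) - e"] e
    obtain m where m: "(\<integral>w. \<Psi> (Y w) \<partial>N) - e < (\<integral>w. ?E m (Y w) \<partial>N)"
      by (auto simp: eventually_sequentially)
    have le: "(\<integral>w. ?E m (X i w) \<partial>M) \<le> (\<integral>w. \<Psi> (X i w) \<partial>M)" for i
      by (rule integral_mono)
        (auto intro!: M.integrable_bounded_real[where C = C] continuous_imp_borel[OF c X]
           continuous_imp_borel[OF \<Psi>(1) X] B \<Psi>(2) envelope_le[OF \<Psi>(2)])
    show ?thesis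
      using order_tendstoD(1)[OF lip[OF L[of m] B] m] le by (auto elim!: eventually_mono intro: less_le_trans)
  qed
  obtain C where C: "\<And>x. \<bar>\<Phi> x\<bar> \<le> C" using bdd unfolding bounded_iff by auto
  have c': "continuous_on UNIV (\<lambda>x. - \<Phi> x)" by (intro continuous_intros cont)
  have C': "\<And>x. \<bar>- \<Phi> x\<bar> \<le> C" using C by simp
  show ?thesis
  proof (rule tendstoI)
    fix e :: real assume e: "e > 0"
    show "\<forall>\<^sub>F i in F. dist (\<integral>w. \<Phi> (X i w) \<partial>M) (\<integral>w. \<Phi> (Y w) \<partial>N) < e"
      using lower[OF cont C e] lower[OF c' C' e]
      by eventually_elim (auto simp: dist_real_def)
  qed
qed

section \<open>Polygonal interpolation and measurability\<close>

definition hat :: "real \<Rightarrow> real" where "hat x = max 0 (1 - \<bar>x\<bar>)"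

lemma hat_bounds: "0 \<le> hat x" "hat x \<le> 1"
  by (auto simp: hat_def)

lemma hat_eq_0: "\<bar>x\<bar> \<ge> 1 \<Longrightarrow> hat x = 0"
  by (auto simp: hat_def)

text \<open>The path through the points \<open>(j / 2\<^sup>n, a j)\<close>, linear in between. Only the two hat functions around \<open>t\<close> are nonzero, so the
  summation may stop at the index after the floor of \<open>t 2\<^sup>n\<close>.\<close>

definition polygon :: "nat \<Rightarrow> (nat \<Rightarrow> real) \<Rightarrow> cpath" where
  "polygon n a = cpath_of (\<lambda>t. \<Sum>j < nat \<lfloor>t * 2 ^ n\<rfloor> + 2. a j * hat (t * 2 ^ n - real j))"

definition grid :: "nat \<Rightarrow> cpath \<Rightarrow> nat \<Rightarrow> real" where
  "grid n x j = path_at x (real j / 2 ^ n)"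

text \<open>A fixed number of summands serves a whole bounded time interval; continuity in \<open>t\<close> and in the values \<open>a j\<close> follows from this.\<close>

lemma hat_sum_extend:
  assumes "\<tau> \<ge> 0" "\<tau> + 1 \<le> real m"
  shows "(\<Sum>j < nat \<lfloor>\<tau>\<rfloor> + 2. a j * hat (\<tau> - real j)) = (\<Sum>j<m. a j * hat (\<tau> - real j))"
proof -
  have *: "(\<Sum>j<k. a j * hat (\<tau> - real j)) = (\<Sum>j<m + nat \<lfloor>\<tau>\<rfloor> + 2. a j * hat (\<tau> - real j))"
    if "\<tau> + 1 \<le> real k" "k \<le> m + nat \<lfloor>\<tau>\<rfloor> + 2" for k
  proof (rule sum.mono_neutral_left)
    show "\<forall>i\<in>{..<m + nat \<lfloor>\<tau>\<rfloor> + 2} - {..<k}. a i * hat (\<tau> - real i) = 0"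
    proof
      fix i assume "i \<in> {..<m + nat \<lfloor>\<tau>\<rfloor> + 2} - {..<k}"
      then have "real k \<le> real i" by auto
      then show "a i * hat (\<tau> - real i) = 0" using that by (subst hat_eq_0) auto
    qed
  qed (use that in auto)
  have "\<tau> + 1 \<le> real (nat \<lfloor>\<tau>\<rfloor> + 2)" using assms by linarith
  then show ?thesis using *[of m] *[of "nat \<lfloor>\<tau>\<rfloor> + 2"] assms by simp
qed

lemma polygon_continuous:
  "continuous_on {0..} (\<lambda>t. \<Sum>j < nat \<lfloor>t * 2 ^ n\<rfloor> + 2. a j * hat (t * 2 ^ n - real j))"
  (is "continuous_on _ ?f")
  unfolding continuous_on_eq_continuous_within
proof
  fix t :: real assume t: "t \<in> {0..}"
  define m where "m = nat \<lceil>(t + 1) * 2 ^ n\<rceil> + 1"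
  have m: "(t + 1) * 2 ^ n + 1 \<le> real m" unfolding m_def by linarith
  have "continuous_on {0..} (\<lambda>t. \<Sum>j<m. a j * hat (t * 2 ^ n - real j))"
    unfolding hat_def by (intro continuous_intros)
  then have c: "continuous (at t within {0..}) (\<lambda>t. \<Sum>j<m. a j * hat (t * 2 ^ n - real j))"
    using t by (simp add: continuous_on_eq_continuous_within)
  have ev: "\<forall>\<^sub>F s in at t within {0..}. (\<Sum>j<m. a j * hat (s * 2 ^ n - real j)) = ?f s"
  proof -
    have "\<forall>\<^sub>F s in at t within {0..}. s < t + 1" 
      by (rule order_tendstoD(2)[OF tendsto_ident_at]) auto
    moreover have "\<forall>\<^sub>F s in at t within {0..}. s \<in> {0..}"
      by (simp add: eventually_at_filter)
    ultimately show ?thesis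
    proof eventually_elim
      case (elim s)
      then have "s * 2 ^ n \<le> (t + 1) * 2 ^ n" by (intro mult_right_mono) auto
      then have "s * 2 ^ n + 1 \<le> real m" using m by linarith
      then show ?case using elim by (intro hat_sum_extend[symmetric]) auto
    qed
  qed
  have eq: "?f t = (\<Sum>j<m. a j * hat (t * 2 ^ n - real j))"
  proof -
    have "t * 2 ^ n \<le> (t + 1) * 2 ^ n" by (intro mult_right_mono) auto
    then have "t * 2 ^ n + 1 \<le> real m" using m by linarith
    then show ?thesis using t by (intro hat_sum_extend) auto
  qed
  show "continuous (at t within {0..}) ?f"
    unfolding continuous_within eq
    by (rule Lim_transform_eventually[OF c[unfolded continuous_within] ev])
qed

lemma polygon_at:
  assumes "t \<ge> 0" "t * 2 ^ n + 1 \<le> real m"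
  shows "path_at (polygon n a) t = (\<Sum>j<m. a j * hat (t * 2 ^ n - real j))"
  unfolding polygon_def
  using path_at_cpath_of[OF polygon_continuous assms(1)] hat_sum_extend[OF _ assms(2)] assms by simp

lemma polygon_floor:
  fixes n :: nat
  assumes "t \<ge> 0"
  defines "j \<equiv> nat \<lfloor>t * 2 ^ n\<rfloor>"
  shows "path_at (polygon n a) t - a j = (t * 2 ^ n - real j) * (a (Suc j) - a j)"
    and "0 \<le> t * 2 ^ n - real j" "t * 2 ^ n - real j \<le> 1"
proof -
  let ?\<tau> = "t * 2 ^ n"
  have t: "0 \<le> ?\<tau>" using assms by simp
  show r: "0 \<le> ?\<tau> - real j" "?\<tau> - real j \<le> 1" using t unfolding j_def by linarith+
  have "path_at (polygon n a) t = (\<Sum>i<Suc (Suc j). a i * hat (?\<tau> - real i))"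
    using r by (intro polygon_at assms(1)) simp
  also have "\<dots> = (\<Sum>i<j. a i * hat (?\<tau> - real i)) + a j * hat (?\<tau> - real j) + a (Suc j) * hat (?\<tau> - real (Suc j))"
    by simp
  also have "(\<Sum>i<j. a i * hat (?\<tau> - real i)) = 0"
  proof (rule sum.neutral, rule ballI)
    fix i assume "i \<in> {..<j}"
    then have "real i + 1 \<le> real j" by auto
    then show "a i * hat (?\<tau> - real i) = 0" using r by (subst hat_eq_0) auto
  qed
  also have "hat (?\<tau> - real j) = 1 - (?\<tau> - real j)" using r by (simp add: hat_def)
  also have "hat (?\<tau> - real (Suc j)) = ?\<tau> - real j" using r by (simp add: hat_def)
  finally show "path_at (polygon n a) t - a j = (?\<tau> - real j) * (a (Suc j) - a j)"
    by (simp add: algebra_simps)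
qed

lemma polygon_diff:
  assumes "t \<ge> 0" "t * 2 ^ n + 1 \<le> real m"
  shows "\<bar>path_at (polygon n a) t - path_at (polygon n b) t\<bar> \<le> (\<Sum>j<m. \<bar>a j - b j\<bar>)"
proof -
  have "path_at (polygon n a) t - path_at (polygon n b) t = (\<Sum>j<m. (a j - b j) * hat (t * 2 ^ n - real j))"
    by (simp add: polygon_at[OF assms] left_diff_distrib flip: sum_subtractf)
  also have "\<bar>\<dots>\<bar> \<le> (\<Sum>j<m. \<bar>(a j - b j) * hat (t * 2 ^ n - real j)\<bar>)" by (rule sum_abs)
  also have "\<dots> \<le> (\<Sum>j<m. \<bar>a j - b j\<bar>)"
    by (intro sum_mono) (auto simp: abs_mult hat_bounds intro!: mult_left_le)
  finally show ?thesis .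
qed

text \<open>A polygon on \<open>[0, K]\<close> depends on finitely many values, and the times beyond \<open>K\<close> cost at most \<open>1 / (1 + K)\<close>.\<close>

lemma cdist_polygon:
  "cdist (polygon n a) (polygon n b) \<le> (\<Sum>j<Suc (K * 2 ^ n). \<bar>a j - b j\<bar>) + 1 / (1 + real K)"
proof (rule cdist_le_local)
  fix t assume t: "0 \<le> t" "t < real K"
  then have "t * 2 ^ n \<le> real K * 2 ^ n" by (intro mult_right_mono) auto
  then show "\<bar>path_at (polygon n a) t - path_at (polygon n b) t\<bar> \<le> (\<Sum>j<Suc (K * 2 ^ n). \<bar>a j - b j\<bar>)"
    using t by (intro polygon_diff) auto
qed (auto intro: sum_nonneg)

lemma continuous_on_polygon: "continuous_on UNIV (polygon n)"
  unfolding continuous_on_def tendsto_cpath_iff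
proof (intro ballI allI uniform_limitI)
  fix a :: "nat \<Rightarrow> real" and T e :: real assume e: "e > 0"
  define m where "m = nat \<lceil>T * 2 ^ n\<rceil> + 1"
  have m: "T * 2 ^ n + 1 \<le> real m" unfolding m_def by linarith
  have coord: "((\<lambda>b. b j) \<longlongrightarrow> a j) (at a)" for j
    using continuous_on_product_coordinates[of j, where 'b = real] unfolding continuous_on_def by auto
  have "((\<lambda>b. \<Sum>j<m. \<bar>b j - a j\<bar>) \<longlongrightarrow> (\<Sum>j<m. \<bar>a j - a j\<bar>)) (at a)"
    by (intro tendsto_intros coord)
  then have "\<forall>\<^sub>F b in at a. (\<Sum>j<m. \<bar>b j - a j\<bar>) < e"
    using e by (intro order_tendstoD(2)) auto
  then show "\<forall>\<^sub>F b in at a. \<forall>t\<in>{0..T}. dist (path_at (polygon n b) t) (path_at (polygon n a) t) < e"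
  proof eventually_elim
    case (elim b)
    show ?case
    proof
      fix t assume t: "t \<in> {0..T}"
      then have "t * 2 ^ n \<le> T * 2 ^ n" by (intro mult_right_mono) auto
      then have "t * 2 ^ n + 1 \<le> real m" using m by linarith
      then show "dist (path_at (polygon n b) t) (path_at (polygon n a) t) < e"
        using polygon_diff[of t n m b a] t elim by (auto simp: dist_real_def)
    qed
  qed
qed

lemma floor_dyadic_bounds:
  assumes "t \<ge> 0"
  shows "real (nat \<lfloor>t * 2 ^ n\<rfloor>) / 2 ^ n \<le> t" "t < real (Suc (nat \<lfloor>t * 2 ^ n\<rfloor>)) / 2 ^ n"
proof -
  have "0 \<le> t * 2 ^ n" using assms by simp
  then have "real (nat \<lfloor>t * 2 ^ n\<rfloor>) \<le> t * 2 ^ n" "t * 2 ^ n < real (Suc (nat \<lfloor>t * 2 ^ n\<rfloor>))"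
    by linarith+
  then show "real (nat \<lfloor>t * 2 ^ n\<rfloor>) / 2 ^ n \<le> t" "t < real (Suc (nat \<lfloor>t * 2 ^ n\<rfloor>)) / 2 ^ n"
    by (simp_all only: divide_le_eq less_divide_eq) auto
qed

lemma polygon_grid_tendsto: "(\<lambda>n. polygon n (grid n x)) \<longlonglongrightarrow> x"
  unfolding tendsto_cpath_iff
proof (intro allI uniform_limitI)
  fix T e :: real assume e: "e > 0"
  have "uniformly_continuous_on {0..\<bar>T\<bar> + 1} (path_at x)"
    by (intro compact_uniformly_continuous continuous_on_path_at) auto
  then obtain d where d: "d > 0"
    "\<And>s t. s \<in> {0..\<bar>T\<bar> + 1} \<Longrightarrow> t \<in> {0..\<bar>T\<bar> + 1} \<Longrightarrow> dist s t < d \<Longrightarrow> dist (path_at x s) (path_at x t) < e / 3"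
    using e unfolding uniformly_continuous_on_def by (metis zero_less_divide_iff zero_less_numeral)
  have "(\<lambda>n. (1 / 2 :: real) ^ n) \<longlonglongrightarrow> 0" by (intro LIMSEQ_power_zero) auto
  then have "\<forall>\<^sub>F n in sequentially. (1 / 2 :: real) ^ n < min d 1"
    using d(1) by (intro order_tendstoD(2)) auto
  then show "\<forall>\<^sub>F n in sequentially. \<forall>t\<in>{0..T}. dist (path_at (polygon n (grid n x)) t) (path_at x t) < e"
  proof eventually_elim
    case (elim n)
    show ?case
    proof
      fix t assume t: "t \<in> {0..T}"
      define j where "j = nat \<lfloor>t * 2 ^ n\<rfloor>"
      have small: "1 / 2 ^ n < d" "1 / 2 ^ n < (1 :: real)" using elim by (auto simp: power_one_over)
      have b: "real j / 2 ^ n \<le> t" "t < real (Suc j) / 2 ^ n"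
        using floor_dyadic_bounds[of t n] t unfolding j_def by auto
      have S: "real (Suc j) / 2 ^ n = real j / 2 ^ n + 1 / 2 ^ n" by (simp add: add_divide_distrib)
      have 0: "0 \<le> real j / 2 ^ n" by simp
      have in': "real j / 2 ^ n \<in> {0..\<bar>T\<bar> + 1}" "real (Suc j) / 2 ^ n \<in> {0..\<bar>T\<bar> + 1}" "t \<in> {0..\<bar>T\<bar> + 1}"
        using b t small(2) 0 unfolding S atLeastAtMost_iff by linarith+
      have d1: "dist (path_at x (real j / 2 ^ n)) (path_at x t) < e / 3"
        using in' b small S by (intro d(2)) (auto simp: dist_real_def)
      have d2: "dist (path_at x (real (Suc j) / 2 ^ n)) (path_at x (real j / 2 ^ n)) < e / 3"
        using in' b small S by (intro d(2)) (auto simp: dist_real_def)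
      have "\<bar>path_at (polygon n (grid n x)) t - grid n x j\<bar> \<le> \<bar>grid n x (Suc j) - grid n x j\<bar>"
        using polygon_floor(1)[where t = t and n = n and a = "grid n x"] polygon_floor(2,3)[where t = t and n = n] t
        unfolding j_def[symmetric] by (auto simp: abs_mult intro!: mult_left_le_one_le)
      moreover have "\<bar>grid n x j - path_at x t\<bar> < e / 3" "\<bar>grid n x (Suc j) - grid n x j\<bar> < e / 3"
        using d1 d2 by (simp_all add: dist_real_def grid_def)
      ultimately show "dist (path_at (polygon n (grid n x)) t) (path_at x t) < e"
        using e unfolding dist_real_def by linarith
    qed
  qed
qed

lemma borel_measurable_polygon_grid:
  assumes "continuous_on UNIV \<Phi>" "\<And>t. t \<ge> 0 \<Longrightarrow> (\<lambda>w. path_at (X w) t) \<in> borel_measurable M"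
  shows "(\<lambda>w. \<Phi> (polygon n (grid n (X w)))) \<in> borel_measurable M"
proof -
  have "(\<lambda>w. grid n (X w)) \<in> borel_measurable M"
    by (rule measurable_coordinatewise_then_product) (simp add: grid_def assms(2))
  moreover have "continuous_on UNIV (\<lambda>a. \<Phi> (polygon n a))"
    by (rule continuous_on_compose2[OF assms(1) continuous_on_polygon]) auto
  ultimately show ?thesis by (rule measurable_compose[OF _ borel_measurable_continuous_onI])
qed

lemma continuous_on_tendsto: "continuous_on UNIV \<Phi> \<Longrightarrow> (X \<longlongrightarrow> x) F \<Longrightarrow> ((\<lambda>n. \<Phi> (X n)) \<longlongrightarrow> \<Phi> x) F"
  by (rule continuous_on_tendsto_compose[where s = UNIV]) auto

text \<open>An open set is where the envelope of its indicator is positive. Along a path-valued map this envelope is the limit of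
  its values at the interpolating polygons, which depend on countably many coordinates.\<close>

lemma borel_measurable_cpath:
  fixes X :: "'a \<Rightarrow> cpath"
  assumes X: "\<And>t. t \<ge> 0 \<Longrightarrow> (\<lambda>w. path_at (X w) t) \<in> borel_measurable M"
  shows "X \<in> borel_measurable M"
proof (rule borel_measurableI)
  fix U :: "cpath set" assume U: "open U"
  define \<Phi> where "\<Phi> = lipschitz_envelope 1 (indicator U)"
  have b: "\<bar>indicator U x :: real\<bar> \<le> 1" for x :: cpath by (simp add: indicator_def)
  have c: "continuous_on UNIV \<Phi>"
    unfolding \<Phi>_def by (rule cdist_lipschitz_continuous, rule envelope_lipschitz[OF b]) auto
  have iff: "x \<in> U \<longleftrightarrow> \<Phi> x > 0" for x
  proof
    assume "x \<in> U"
    then obtain e where e: "e > 0" "\<And>y. cdist x y < e \<Longrightarrow> y \<in> U" using open_cpath_cdist[OF U] by blast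
    have "min e 1 \<le> \<Phi> x" unfolding \<Phi>_def
    proof (rule envelope_greatest[OF b])
      show "min e 1 \<le> indicator U y + 1 * cdist x y" for y
        using e(2)[of y] cdist_nonneg[of x y] by (cases "y \<in> U"; cases "cdist x y < e") (auto simp: min_le_iff_disj)
    qed auto
    then show "\<Phi> x > 0" using e(1) by auto
  next
    assume "\<Phi> x > 0"
    moreover have "\<Phi> x \<le> indicator U x" unfolding \<Phi>_def by (rule envelope_le[OF b]) auto
    ultimately show "x \<in> U" by (cases "x \<in> U") auto
  qed
  have "(\<lambda>w. \<Phi> (X w)) \<in> borel_measurable M"
    by (rule borel_measurable_LIMSEQ_real[where u = "\<lambda>n w. \<Phi> (polygon n (grid n (X w)))"])
      (auto intro!: continuous_on_tendsto[OF c] polygon_grid_tendsto borel_measurable_polygon_grid c X)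
  then have "{w \<in> space M. 0 < \<Phi> (X w)} \<in> sets M" by measurable
  also have "{w \<in> space M. 0 < \<Phi> (X w)} = X -` U \<inter> space M" using iff by auto
  finally show "X -` U \<inter> space M \<in> sets M" .
qed

lemma borel_measurable_path_at:
  fixes X :: "'a \<Rightarrow> cpath"
  assumes "X \<in> borel_measurable M" "t \<ge> 0"
  shows "(\<lambda>w. path_at (X w) t) \<in> borel_measurable M"
proof -
  have "continuous_on UNIV (\<lambda>x. path_at x t)"
    unfolding continuous_on_def
  proof
    fix x :: cpath
    have "((\<lambda>y. y) \<longlongrightarrow> x) (at x)" by (rule tendsto_ident_at)
    then have "uniform_limit {0..t} path_at (path_at x) (at x)" by (auto simp: tendsto_cpath_iff)
    then show "((\<lambda>x. path_at x t) \<longlongrightarrow> path_at x t) (at x)"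
      using assms(2) by (intro tendsto_uniform_limitI[where S = "{0..t}"]) auto
  qed
  then show ?thesis by (rule continuous_imp_borel[OF _ assms(1)])
qed

section \<open>A fourth-moment criterion for weak convergence\<close>

text \<open>A bound for the largest increment of \<open>x\<close> over dyadic intervals of level \<open>l\<close> in \<open>[0, K]\<close> whose mean needs only fourth
  moments: it comes from \<open>\<bar>a\<bar> \<le> q + a\<^sup>4 / q\<^sup>3\<close> with \<open>q = (9/10)\<^sup>l\<close>. Under a bound \<open>C (t - s)\<^sup>2\<close> for the fourth moments the
  mean of the sum is of order \<open>(1 / (2 (9/10)\<^sup>3))\<^sup>l\<close>. The ratio \<open>9/10\<close> serves because it is below \<open>1\<close> and its fourth power
  exceeds \<open>1/2\<close>, so that both parts decay like \<open>(9/10)\<^sup>l\<close>.\<close>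

definition chain_weight :: "nat \<Rightarrow> nat \<Rightarrow> cpath \<Rightarrow> real" where
  "chain_weight K l x = (9/10) ^ l + (\<Sum>j<K * 2 ^ l. (grid l x (Suc j) - grid l x j) ^ 4 / (9/10) ^ (3 * l))"

lemma le_add_power4:
  fixes a q :: real
  assumes "q > 0"
  shows "\<bar>a\<bar> \<le> q + a ^ 4 / q ^ 3"
proof (cases "\<bar>a\<bar> \<le> q")
  case True
  then show ?thesis using assms by (simp add: add_increasing2)
next
  case False
  then have "q ^ 3 \<le> \<bar>a\<bar> ^ 3" using assms by (intro power_mono) auto
  then have "\<bar>a\<bar> * q ^ 3 \<le> \<bar>a\<bar> * \<bar>a\<bar> ^ 3" by (intro mult_left_mono) auto
  also have "\<dots> = a ^ 4" by (simp flip: power_Suc)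
  finally have "\<bar>a\<bar> \<le> a ^ 4 / q ^ 3" using assms by (simp add: pos_le_divide_eq)
  then show ?thesis using assms by simp
qed

lemma chain_weight_nonneg: "0 \<le> chain_weight K l x"
  unfolding chain_weight_def by (intro add_nonneg_nonneg sum_nonneg) auto

lemma increment_le_chain_weight:
  assumes "j < K * 2 ^ l"
  shows "\<bar>grid l x (Suc j) - grid l x j\<bar> \<le> chain_weight K l x"
proof -
  have "\<bar>grid l x (Suc j) - grid l x j\<bar> \<le> (9/10) ^ l + (grid l x (Suc j) - grid l x j) ^ 4 / ((9/10) ^ l) ^ 3"
    by (rule le_add_power4) simp
  also have "((9/10) ^ l) ^ 3 = ((9/10) ^ (3 * l) :: real)" by (simp add: power_mult mult.commute)
  also have "(grid l x (Suc j) - grid l x j) ^ 4 / (9/10) ^ (3 * l) \<le>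
      (\<Sum>j<K * 2 ^ l. (grid l x (Suc j) - grid l x j) ^ 4 / (9/10) ^ (3 * l))"
    by (rule member_le_sum) (use assms in auto)
  finally show ?thesis unfolding chain_weight_def by simp
qed

lemma floor_dyadic_less:
  assumes "0 \<le> t" "t < real K"
  shows "nat \<lfloor>t * 2 ^ l\<rfloor> < K * 2 ^ l"
proof -
  have "real (nat \<lfloor>t * 2 ^ l\<rfloor>) \<le> t * 2 ^ l" using assms(1) by simp
  also have "t * 2 ^ l < real K * 2 ^ l" using assms(2) by (intro mult_strict_right_mono) auto
  also have "\<dots> = real (K * 2 ^ l)" by simp
  finally show ?thesis by (simp only: of_nat_less_iff)
qed

text \<open>Passing from level \<open>l\<close> to level \<open>l + 1\<close>, the dyadic point to the left of \<open>t\<close> stays or moves by one interval of the finer level.\<close>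

lemma dyadic_refinement_step:
  assumes "0 \<le> t" "t < real K"
  shows "\<bar>grid (Suc l) x (nat \<lfloor>t * 2 ^ Suc l\<rfloor>) - grid l x (nat \<lfloor>t * 2 ^ l\<rfloor>)\<bar> \<le> chain_weight K (Suc l) x"
proof -
  define j where "j = nat \<lfloor>t * 2 ^ l\<rfloor>"
  define i where "i = nat \<lfloor>t * 2 ^ Suc l\<rfloor>"
  have 0: "0 \<le> t * 2 ^ l" using assms by simp
  have "i = 2 * j \<or> i = Suc (2 * j)"
    using 0 unfolding i_def j_def power_Suc by linarith
  moreover have "grid l x j = grid (Suc l) x (2 * j)" by (simp add: grid_def)
  moreover have "i < K * 2 ^ Suc l" unfolding i_def by (rule floor_dyadic_less[OF assms])
  ultimately show ?thesis
    unfolding i_def[symmetric] j_def[symmetric]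
    using increment_le_chain_weight[of "2 * j" K "Suc l" x] chain_weight_nonneg[of K "Suc l" x] by auto
qed

lemma dyadic_chain:
  assumes "0 \<le> t" "t < real K"
  shows "\<bar>grid (n + m) x (nat \<lfloor>t * 2 ^ (n + m)\<rfloor>) - grid n x (nat \<lfloor>t * 2 ^ n\<rfloor>)\<bar> + chain_weight K n x
    \<le> (\<Sum>l<Suc m. chain_weight K (n + l) x)"
proof (induction m)
  case 0
  then show ?case by simp
next
  case (Suc m)
  have "\<bar>grid (n + Suc m) x (nat \<lfloor>t * 2 ^ (n + Suc m)\<rfloor>) - grid (n + m) x (nat \<lfloor>t * 2 ^ (n + m)\<rfloor>)\<bar>
      \<le> chain_weight K (n + Suc m) x"
    using dyadic_refinement_step[OF assms, of "n + m" x] by (simp only: add_Suc_right)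
  then show ?case using Suc unfolding sum.lessThan_Suc[of _ "Suc m"] by linarith
qed

lemma grid_floor_tendsto:
  assumes "t \<ge> 0"
  shows "(\<lambda>m. grid (n + m) x (nat \<lfloor>t * 2 ^ (n + m)\<rfloor>)) \<longlonglongrightarrow> path_at x t"
  unfolding grid_def
proof (rule continuous_on_tendsto_compose[where s = "{0..}" and f = "path_at x"])
  show "continuous_on {0..} (path_at x)" by (rule continuous_on_path_at) simp
  show "(\<lambda>m. real (nat \<lfloor>t * 2 ^ (n + m)\<rfloor>) / 2 ^ (n + m)) \<longlonglongrightarrow> t"
  proof (rule tendsto_sandwich[where f = "\<lambda>m. t - (1 / 2) ^ (n + m)" and h = "\<lambda>_. t"])
    show "\<forall>\<^sub>F m in sequentially. t - (1 / 2) ^ (n + m) \<le> real (nat \<lfloor>t * 2 ^ (n + m)\<rfloor>) / 2 ^ (n + m)"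
      using floor_dyadic_bounds(2)[OF assms]
      by (intro always_eventually allI) (simp add: add_divide_distrib power_one_over less_imp_le diff_le_eq add.commute)
    show "\<forall>\<^sub>F m in sequentially. real (nat \<lfloor>t * 2 ^ (n + m)\<rfloor>) / 2 ^ (n + m) \<le> t"
      using floor_dyadic_bounds(1)[OF assms] by (intro always_eventually allI)
    have "(\<lambda>m. (1 / 2 :: real) ^ (m + n)) \<longlonglongrightarrow> 0"
      by (rule LIMSEQ_ignore_initial_segment) (rule LIMSEQ_power_zero, simp)
    then have "(\<lambda>m. t - (1 / 2) ^ (m + n)) \<longlonglongrightarrow> t - 0" by (intro tendsto_intros)
    then show "(\<lambda>m. t - (1 / 2) ^ (n + m)) \<longlonglongrightarrow> t" by (simp add: add.commute)
  qed auto
qed (use assms in auto)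

text \<open>Chaining: a path is joined to its polygon of level \<open>n\<close> through the dyadic approximations of \<open>t\<close> of all levels above \<open>n\<close>,
  each link costing one increment. Nonnegative extended reals avoid a case distinction on convergence in later integrals.\<close>

lemma polygon_approximation:
  "ennreal (cdist x (polygon n (grid n x))) \<le> ennreal (1 / (1 + real K)) + (\<Sum>l. ennreal (chain_weight K (n + l) x))"
proof (cases "\<Sum>l. ennreal (chain_weight K (n + l) x)")
  case top
  then show ?thesis by simp
next
  case (real r)
  have part: "(\<Sum>l<m. chain_weight K (n + l) x) \<le> r" for m
  proof -
    have "ennreal (\<Sum>l<m. chain_weight K (n + l) x) = (\<Sum>l<m. ennreal (chain_weight K (n + l) x))"
      by (simp add: sum_ennreal chain_weight_nonneg)
    also have "\<dots> \<le> (\<Sum>l. ennreal (chain_weight K (n + l) x))" by (rule sum_le_suminf) auto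
    finally show ?thesis using real by simp
  qed
  have "cdist x (polygon n (grid n x)) \<le> r + 1 / (1 + real K)"
  proof (rule cdist_le_local)
    fix t assume t: "0 \<le> t" "t < real K"
    define j where "j = nat \<lfloor>t * 2 ^ n\<rfloor>"
    have "(\<lambda>m. \<bar>grid (n + m) x (nat \<lfloor>t * 2 ^ (n + m)\<rfloor>) - grid n x j\<bar> + chain_weight K n x)
        \<longlonglongrightarrow> \<bar>path_at x t - grid n x j\<bar> + chain_weight K n x"
      by (intro tendsto_intros grid_floor_tendsto t(1))
    then have 1: "\<bar>path_at x t - grid n x j\<bar> + chain_weight K n x \<le> r"
      by (rule LIMSEQ_le_const2) (use dyadic_chain[OF t] part j_def order_trans in blast)
    have "\<bar>path_at (polygon n (grid n x)) t - grid n x j\<bar> \<le> \<bar>grid n x (Suc j) - grid n x j\<bar>"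
      using polygon_floor(1)[where t = t and n = n and a = "grid n x"]
        polygon_floor(2,3)[where t = t and n = n] t
      unfolding j_def[symmetric] by (auto simp: abs_mult intro!: mult_left_le_one_le)
    also have "\<dots> \<le> chain_weight K n x"
      unfolding j_def by (intro increment_le_chain_weight floor_dyadic_less t)
    finally show "\<bar>path_at x t - path_at (polygon n (grid n x)) t\<bar> \<le> r" using 1 by linarith
  qed (use real in auto)
  then show ?thesis using real by (simp add: add.commute ennreal_plus[symmetric] del: ennreal_plus)
qed

lemma expectation_chain_weight:
  fixes X :: "'a \<Rightarrow> cpath"
  assumes M: "prob_space M" and X: "X \<in> borel_measurable M" and C: "C \<ge> 0"
    and mom: "\<And>s t. 0 \<le> s \<Longrightarrow> s \<le> t \<Longrightarrow>
      (\<integral>\<^sup>+w. ennreal ((path_at (X w) t - path_at (X w) s) ^ 4) \<partial>M) \<le> ennreal (C * (t - s)\<^sup>2)"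
  shows "(\<integral>\<^sup>+w. ennreal (chain_weight K l (X w)) \<partial>M) \<le> ennreal ((1 + C * real K) * (9/10) ^ l)"
proof -
  interpret prob_space M by fact
  let ?q = "9/10 :: real"
  have [measurable]: "(\<lambda>w. grid l (X w) j) \<in> borel_measurable M" for j
    unfolding grid_def by (rule borel_measurable_path_at[OF X]) simp
  have increment_moment: "(\<integral>\<^sup>+w. ennreal ((grid l (X w) (Suc j) - grid l (X w) j) ^ 4 / ?q ^ (3 * l)) \<partial>M)
      \<le> ennreal (C * (1 / 2 ^ l)\<^sup>2 / ?q ^ (3 * l))" for j
  proof -
    have "(\<integral>\<^sup>+w. ennreal ((grid l (X w) (Suc j) - grid l (X w) j) ^ 4 / ?q ^ (3 * l)) \<partial>M)
      = (\<integral>\<^sup>+w. ennreal (1 / ?q ^ (3 * l)) * ennreal ((grid l (X w) (Suc j) - grid l (X w) j) ^ 4) \<partial>M)"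
      by (intro nn_integral_cong) (simp flip: ennreal_mult')
    also have "\<dots> = ennreal (1 / ?q ^ (3 * l)) * (\<integral>\<^sup>+w. ennreal ((grid l (X w) (Suc j) - grid l (X w) j) ^ 4) \<partial>M)"
      by (rule nn_integral_cmult) measurable
    also have "\<dots> \<le> ennreal (1 / ?q ^ (3 * l)) * ennreal (C * (real (Suc j) / 2 ^ l - real j / 2 ^ l)\<^sup>2)"
      unfolding grid_def by (intro mult_left_mono mom) (auto simp: divide_right_mono)
    also have "\<dots> = ennreal (C * (1 / 2 ^ l)\<^sup>2 / ?q ^ (3 * l))"
      by (simp add: ennreal_mult'[symmetric] add_divide_distrib)
    finally show ?thesis .
  qed
  have "(\<integral>\<^sup>+w. ennreal (chain_weight K l (X w)) \<partial>M) =
      (\<integral>\<^sup>+w. ennreal (?q ^ l) + (\<Sum>j<K * 2 ^ l. ennreal ((grid l (X w) (Suc j) - grid l (X w) j) ^ 4 / ?q ^ (3 * l))) \<partial>M)"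
    unfolding chain_weight_def by (intro nn_integral_cong) (simp add: sum_nonneg)
  also have "\<dots> = ennreal (?q ^ l) + (\<Sum>j<K * 2 ^ l. \<integral>\<^sup>+w. ennreal ((grid l (X w) (Suc j) - grid l (X w) j) ^ 4 / ?q ^ (3 * l)) \<partial>M)"
    by (subst nn_integral_add) (auto simp: nn_integral_sum emeasure_space_1 simp del: sum_ennreal)
  also have "\<dots> \<le> ennreal (?q ^ l) + (\<Sum>j<K * 2 ^ l. ennreal (C * (1 / 2 ^ l)\<^sup>2 / ?q ^ (3 * l)))"
    by (intro add_left_mono sum_mono increment_moment)
  also have "\<dots> = ennreal (?q ^ l + (\<Sum>j<K * 2 ^ l. C * (1 / 2 ^ l)\<^sup>2 / ?q ^ (3 * l)))"
    using C by (simp add: sum_ennreal ennreal_plus sum_nonneg del: sum_constant)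
  also have "\<dots> \<le> ennreal ((1 + C * real K) * ?q ^ l)"
  proof (rule ennreal_leI)
    have "(\<Sum>j<K * 2 ^ l. C * (1 / 2 ^ l)\<^sup>2 / ?q ^ (3 * l)) = C * real K * (2 ^ l * (1 / 2 ^ l)\<^sup>2 / ?q ^ (3 * l))"
      by simp
    also have "2 ^ l * (1 / 2 ^ l)\<^sup>2 / ?q ^ (3 * l) = (1 / (2 * ?q ^ 3)) ^ l"
    proof -
      have "2 ^ l * (1 / 2 ^ l)\<^sup>2 = (1 / 2 :: real) ^ l" by (simp add: power2_eq_square power_one_over)
      then have "2 ^ l * (1 / 2 ^ l)\<^sup>2 / ?q ^ (3 * l) = (1 / 2 / ?q ^ 3) ^ l"
        by (simp only: power_mult power_divide)
      then show ?thesis by (simp only: divide_divide_eq_left)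
    qed
    also have "C * real K * (1 / (2 * ?q ^ 3)) ^ l \<le> C * real K * ?q ^ l"
      using C by (intro mult_left_mono power_mono) (auto simp: power3_eq_cube)
    finally show "?q ^ l + (\<Sum>j<K * 2 ^ l. C * (1 / 2 ^ l)\<^sup>2 / ?q ^ (3 * l)) \<le> (1 + C * real K) * ?q ^ l"
      by (simp add: algebra_simps)
  qed
  finally show ?thesis .
qed

lemma polygon_expectation_error:
  fixes X :: "'a \<Rightarrow> cpath"
  assumes M: "prob_space M" and X: "X \<in> borel_measurable M" and C: "C \<ge> 0"
    and mom: "\<And>s t. 0 \<le> s \<Longrightarrow> s \<le> t \<Longrightarrow>
      (\<integral>\<^sup>+w. ennreal ((path_at (X w) t - path_at (X w) s) ^ 4) \<partial>M) \<le> ennreal (C * (t - s)\<^sup>2)"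
    and \<Phi>: "cdist_lipschitz m \<Phi>" "\<And>x. \<bar>\<Phi> x\<bar> \<le> D"
  shows "\<bar>(\<integral>w. \<Phi> (X w) \<partial>M) - (\<integral>w. \<Phi> (polygon n (grid n (X w))) \<partial>M)\<bar>
    \<le> m * (1 / (1 + real K) + 10 * (1 + C * real K) * (9/10) ^ n)"
proof -
  interpret prob_space M by fact
  let ?q = "9/10 :: real"
  note cont = cdist_lipschitz_continuous[OF \<Phi>(1)]
  have [measurable]: "(\<lambda>w. grid l (X w) j) \<in> borel_measurable M" for l j
    unfolding grid_def by (rule borel_measurable_path_at[OF X]) simp
  have [measurable]: "(\<lambda>w. chain_weight K l (X w)) \<in> borel_measurable M" for l
    unfolding chain_weight_def by measurable
  have geo: "(\<lambda>l. (1 + C * real K) * ?q ^ (n + l)) sums (10 * (1 + C * real K) * ?q ^ n)"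
  proof -
    have "(\<lambda>l. A * ?q ^ n * ?q ^ l) sums (A * ?q ^ n * (1 / (1 - ?q)))" for A :: real
      by (intro sums_mult geometric_sums) auto
    from this[of "1 + C * real K"] show ?thesis
      by (simp only: power_add mult.assoc) (simp add: mult_ac)
  qed
  show ?thesis
  proof (rule expectation_lipschitz_difference[OF \<Phi>])
    show "(\<lambda>w. \<Phi> (X w)) \<in> borel_measurable M" by (rule continuous_imp_borel[OF cont X])
    show "(\<lambda>w. \<Phi> (polygon n (grid n (X w)))) \<in> borel_measurable M"
      by (intro borel_measurable_polygon_grid[OF cont] borel_measurable_path_at[OF X])
    show "0 \<le> 1 / (1 + real K) + 10 * (1 + C * real K) * ?q ^ n" using C by simp
    have "(\<integral>\<^sup>+w. ennreal (cdist (X w) (polygon n (grid n (X w)))) \<partial>M)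
        \<le> (\<integral>\<^sup>+w. ennreal (1 / (1 + real K)) + (\<Sum>l. ennreal (chain_weight K (n + l) (X w))) \<partial>M)"
      by (intro nn_integral_mono polygon_approximation)
    also have "\<dots> = ennreal (1 / (1 + real K)) + (\<Sum>l. \<integral>\<^sup>+w. ennreal (chain_weight K (n + l) (X w)) \<partial>M)"
      by (subst nn_integral_add) (auto simp: emeasure_space_1 nn_integral_suminf)
    also have "\<dots> \<le> ennreal (1 / (1 + real K)) + (\<Sum>l. ennreal ((1 + C * real K) * ?q ^ (n + l)))"
      by (intro add_left_mono suminf_le expectation_chain_weight[OF M X C mom] summableI) auto
    also have "(\<Sum>l. ennreal ((1 + C * real K) * ?q ^ (n + l))) = ennreal (10 * (1 + C * real K) * ?q ^ n)"
      unfolding sums_unique[OF geo] using C by (intro suminf_ennreal2 sums_summable[OF geo]) auto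
    also have "ennreal (1 / (1 + real K)) + ennreal (10 * (1 + C * real K) * ?q ^ n)
        = ennreal (1 / (1 + real K) + 10 * (1 + C * real K) * ?q ^ n)"
      using C by (intro ennreal_plus[symmetric]) auto
    finally show "(\<integral>\<^sup>+w. ennreal (cdist (X w) (polygon n (grid n (X w)))) \<partial>M)
        \<le> ennreal (1 / (1 + real K) + 10 * (1 + C * real K) * ?q ^ n)" .
  qed
qed

text \<open>The fourth moments make the error of polygonal interpolation small uniformly in \<open>i\<close>, so the limits in \<open>i\<close> and in the
  grid level may be interchanged.\<close>

theorem kolmogorov_weak_convergence:
  fixes X :: "'i \<Rightarrow> 'a \<Rightarrow> cpath" and Y :: "'b \<Rightarrow> cpath"
  assumes M: "prob_space M" and N: "prob_space N"
    and X: "\<And>i. X i \<in> borel_measurable M" and Y: "Y \<in> borel_measurable N" and C: "C \<ge> 0"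
    and mom: "\<And>i s t. 0 \<le> s \<Longrightarrow> s \<le> t \<Longrightarrow>
      (\<integral>\<^sup>+w. ennreal ((path_at (X i w) t - path_at (X i w) s) ^ 4) \<partial>M) \<le> ennreal (C * (t - s)\<^sup>2)"
    and fdd: "\<And>n \<Psi> m D. cdist_lipschitz m \<Psi> \<Longrightarrow> (\<And>x. \<bar>\<Psi> x\<bar> \<le> D) \<Longrightarrow>
      ((\<lambda>i. \<integral>w. \<Psi> (polygon n (grid n (X i w))) \<partial>M) \<longlongrightarrow> (\<integral>w. \<Psi> (polygon n (grid n (Y w))) \<partial>N)) F"
    and \<Phi>: "cdist_lipschitz m \<Phi>" "\<And>x. \<bar>\<Phi> x\<bar> \<le> D"
  shows "((\<lambda>i. \<integral>w. \<Phi> (X i w) \<partial>M) \<longlongrightarrow> (\<integral>w. \<Phi> (Y w) \<partial>N)) F"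
proof (rule tendstoI)
  fix e :: real assume e: "e > 0"
  interpret N: prob_space N by fact
  have m: "m \<ge> 0" using \<Phi>(1) by (simp add: cdist_lipschitz_def)
  note c = cdist_lipschitz_continuous[OF \<Phi>(1)]
  \<comment> \<open>the three errors below get \<open>e / 3\<close> each; half of the first is spent on the times beyond \<open>K\<close>\<close>
  obtain K :: nat where K: "real K > 6 * m / e" using reals_Archimedean2 by blast
  have "m * (1 / (1 + real K)) < e / 6"
    using K e by (simp add: field_simps)
  then have "m * (1 / (1 + real K) + 10 * (1 + C * real K) * 0) < e / 3"
    using e by (simp only: mult_zero_right add_0_right)
  moreover have "(\<lambda>n. m * (1 / (1 + real K) + 10 * (1 + C * real K) * (9/10) ^ n)) \<longlonglongrightarrow>
      m * (1 / (1 + real K) + 10 * (1 + C * real K) * 0)"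
    by (intro tendsto_intros LIMSEQ_power_zero) auto
  ultimately have 1: "\<forall>\<^sub>F n in sequentially. m * (1 / (1 + real K) + 10 * (1 + C * real K) * (9/10) ^ n) < e / 3"
    by (intro order_tendstoD(2))
  have "(\<lambda>n. \<integral>w. \<Phi> (polygon n (grid n (Y w))) \<partial>N) \<longlonglongrightarrow> (\<integral>w. \<Phi> (Y w) \<partial>N)"
  proof (rule integral_dominated_convergence[where w = "\<lambda>_. D"])
    show "(\<lambda>w. \<Phi> (Y w)) \<in> borel_measurable N" by (rule continuous_imp_borel[OF c Y])
    show "(\<lambda>w. \<Phi> (polygon n (grid n (Y w)))) \<in> borel_measurable N" for n
      by (intro borel_measurable_polygon_grid[OF c] borel_measurable_path_at[OF Y])
    show "AE w in N. (\<lambda>n. \<Phi> (polygon n (grid n (Y w)))) \<longlonglongrightarrow> \<Phi> (Y w)"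
      by (intro AE_I2 continuous_on_tendsto[OF c] polygon_grid_tendsto)
  qed (use \<Phi>(2) in auto)
  then have 2: "\<forall>\<^sub>F n in sequentially. dist (\<integral>w. \<Phi> (polygon n (grid n (Y w))) \<partial>N) (\<integral>w. \<Phi> (Y w) \<partial>N) < e / 3"
    using e by (intro tendstoD) auto
  obtain n where n: "m * (1 / (1 + real K) + 10 * (1 + C * real K) * (9/10) ^ n) < e / 3"
    "dist (\<integral>w. \<Phi> (polygon n (grid n (Y w))) \<partial>N) (\<integral>w. \<Phi> (Y w) \<partial>N) < e / 3"
    using eventually_happens[OF eventually_conj[OF 1 2]] by auto
  have "\<forall>\<^sub>F i in F. dist (\<integral>w. \<Phi> (polygon n (grid n (X i w))) \<partial>M) (\<integral>w. \<Phi> (polygon n (grid n (Y w))) \<partial>N) < e / 3"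
    using e by (intro tendstoD[OF fdd[OF \<Phi>]]) auto
  then show "\<forall>\<^sub>F i in F. dist (\<integral>w. \<Phi> (X i w) \<partial>M) (\<integral>w. \<Phi> (Y w) \<partial>N) < e"
  proof eventually_elim
    case (elim i)
    have "\<bar>(\<integral>w. \<Phi> (X i w) \<partial>M) - (\<integral>w. \<Phi> (polygon n (grid n (X i w))) \<partial>M)\<bar> < e / 3"
      using polygon_expectation_error[OF M X C mom \<Phi>, where n = n and K = K] n(1) by (meson le_less_trans)
    then show ?case using elim n(2) unfolding dist_real_def by linarith
  qed
qed

section \<open>Weak convergence of independent coordinates\<close>

lemma tendsto_coordinatewise_then_product:
  fixes f :: "'i \<Rightarrow> 'j \<Rightarrow> 'c :: topological_space"
  assumes "\<And>j. ((\<lambda>i. f i j) \<longlongrightarrow> l j) F"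
  shows "(f \<longlongrightarrow> l) F"
proof (rule topological_tendstoI)
  fix U :: "('j \<Rightarrow> 'c) set" assume U: "open U" "l \<in> U"
  obtain X where X: "l \<in> PiE UNIV X" "\<And>j. open (X j)" "finite {j. X j \<noteq> UNIV}" "PiE UNIV X \<subseteq> U"
    using product_topology_open_contains_basis[OF U(1)[unfolded open_fun_def] U(2)] by auto
  have "\<forall>\<^sub>F i in F. \<forall>j\<in>{j. X j \<noteq> UNIV}. f i j \<in> X j"
    using X by (intro eventually_ball_finite ballI topological_tendstoD[OF assms]) auto
  then show "\<forall>\<^sub>F i in F. f i \<in> U"
  proof eventually_elim
    case (elim i)
    have "f i j \<in> X j" for j using elim by (cases "X j = UNIV") auto
    then show ?case using X(4) by blast
  qed
qed

text \<open>The joint law of independent variables is the product of the marginal laws.\<close>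

lemma indep_expectation_eq:
  fixes W :: "nat \<Rightarrow> 'a \<Rightarrow> real" and V :: "nat \<Rightarrow> 'b \<Rightarrow> real" and g :: "(nat \<Rightarrow> real) \<Rightarrow> real"
  assumes M: "prob_space M" and N: "prob_space N"
    and W: "prob_space.indep_vars M (\<lambda>_. borel) W UNIV" and V: "prob_space.indep_vars N (\<lambda>_. borel) V UNIV"
    and eq: "\<And>j. distr M borel (W j) = distr N borel (V j)"
    and g: "g \<in> borel_measurable borel"
  shows "(\<integral>w. g (\<lambda>j. W j w) \<partial>M) = (\<integral>w. g (\<lambda>j. V j w) \<partial>N)"
proof -
  have g': "g \<in> borel_measurable (PiM UNIV (\<lambda>_. borel))"
    using g sets_PiM_equal_borel[where 'a = nat and 'b = real] measurable_cong_sets by blast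
  have *: "(\<integral>w. g (\<lambda>j. U j w) \<partial>L) = (\<integral>x. g x \<partial>(PiM UNIV (\<lambda>j. distr L borel (U j))))"
    if L: "prob_space L" and U: "prob_space.indep_vars L (\<lambda>_. borel) U UNIV" for L :: "'c measure" and U
  proof -
    interpret prob_space L by fact
    have rv: "random_variable borel (U j)" for j using U unfolding indep_vars_def by auto
    have "(\<integral>x. g x \<partial>distr L (PiM UNIV (\<lambda>_. borel)) (\<lambda>x. \<lambda>i\<in>UNIV. U i x)) = (\<integral>x. g (\<lambda>i\<in>UNIV. U i x) \<partial>L)"
      by (rule integral_distr[OF _ g']) (intro measurable_restrict rv)
    then show ?thesis
      unfolding indep_vars_iff_distr_eq_PiM[THEN iffD1, OF UNIV_not_empty rv U] by (simp add: restrict_UNIV)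
  qed
  show ?thesis using *[OF M W] *[OF N V] eq by simp
qed

text \<open>Skorohod's theorem represents each coordinate by almost surely convergent variables. On the product of the
  representing spaces all coordinates converge simultaneously and are independent, so dominated convergence applies.\<close>

lemma indep_weak_convergence_joint:
  fixes W :: "nat \<Rightarrow> nat \<Rightarrow> 'a \<Rightarrow> real" and V :: "nat \<Rightarrow> 'b \<Rightarrow> real" and g :: "(nat \<Rightarrow> real) \<Rightarrow> real"
  assumes M: "prob_space M" and N: "prob_space N"
    and W: "\<And>i. prob_space.indep_vars M (\<lambda>_. borel) (W i) UNIV"
    and V: "prob_space.indep_vars N (\<lambda>_. borel) V UNIV"
    and weak: "\<And>j. weak_conv_m (\<lambda>i. distr M borel (W i j)) (distr N borel (V j))"
    and g: "continuous_on UNIV g" "\<And>x. \<bar>g x\<bar> \<le> C"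
  shows "(\<lambda>i. \<integral>w. g (\<lambda>j. W i j w) \<partial>M) \<longlonglongrightarrow> (\<integral>w. g (\<lambda>j. V j w) \<partial>N)"
proof -
  interpret M: prob_space M by fact
  interpret N: prob_space N by fact
  have rW [measurable]: "W i j \<in> borel_measurable M" for i j using W[of i] unfolding M.indep_vars_def by auto
  have rV [measurable]: "V j \<in> borel_measurable N" for j using V unfolding N.indep_vars_def by auto
  have "\<exists>(\<Omega> :: real measure) S T. prob_space \<Omega> \<and> (\<forall>i::nat. S i \<in> measurable \<Omega> borel) \<and>
      (\<forall>i. distr \<Omega> borel (S i) = distr M borel (W i j)) \<and> T \<in> measurable \<Omega> lborel \<and>
      distr \<Omega> borel T = distr N borel (V j) \<and> (\<forall>x\<in>space \<Omega>. (\<lambda>i. S i x) \<longlonglongrightarrow> T x)" for j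
    by (rule Skorohod) (auto intro!: weak M.real_distribution_distr N.real_distribution_distr)
  then obtain \<Omega> :: "nat \<Rightarrow> real measure" and S T where
    P: "\<And>j. prob_space (\<Omega> j)" and S [measurable]: "\<And>j i::nat. S j i \<in> borel_measurable (\<Omega> j)"
    and dS: "\<And>j i. distr (\<Omega> j) borel (S j i) = distr M borel (W i j)"
    and T: "\<And>j. T j \<in> measurable (\<Omega> j) lborel"
    and dT: "\<And>j. distr (\<Omega> j) borel (T j) = distr N borel (V j)"
    and lim: "\<And>j x. x \<in> space (\<Omega> j) \<Longrightarrow> (\<lambda>i. S j i x) \<longlonglongrightarrow> T j x"
    by metis
  have T' [measurable]: "T j \<in> borel_measurable (\<Omega> j)" for j using T[of j] by simp
  let ?P = "PiM UNIV \<Omega>"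
  interpret \<Omega>: prob_space "\<Omega> j" for j by (rule P)
  interpret Q: prob_space ?P by (rule prob_space_PiM) (rule P)
  have coord_distr: "distr ?P (\<Omega> j) (\<lambda>x. x j) = \<Omega> j" for j
    by (rule distr_PiM_component[OF P]) auto
  have coord: "Q.indep_vars \<Omega> (\<lambda>j x. x j) UNIV"
  proof -
    have "distr ?P (PiM UNIV \<Omega>) (\<lambda>x. \<lambda>i\<in>UNIV. x i) = ?P"
      by (simp only: restrict_UNIV distr_id)
    then have "distr ?P (PiM UNIV \<Omega>) (\<lambda>x. \<lambda>i\<in>UNIV. x i) = PiM UNIV (\<lambda>j. distr ?P (\<Omega> j) (\<lambda>x. x j))"
      by (simp only: coord_distr)
    then show ?thesis by (subst Q.indep_vars_iff_distr_eq_PiM) auto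
  qed
  have comp: "Q.indep_vars (\<lambda>_. borel) (\<lambda>j x. U j (x j)) UNIV" "distr ?P borel (\<lambda>x. U j (x j)) = distr (\<Omega> j) borel (U j)"
    if "\<And>j. U j \<in> borel_measurable (\<Omega> j)" for U :: "nat \<Rightarrow> real \<Rightarrow> real" and j
  proof -
    show "Q.indep_vars (\<lambda>_. borel) (\<lambda>j x. U j (x j)) UNIV"
      by (rule Q.indep_vars_compose2[OF coord]) (use that in auto)
    have "distr (distr ?P (\<Omega> j) (\<lambda>x. x j)) borel (U j) = distr ?P borel (\<lambda>x. U j (x j))"
      by (subst distr_distr) (use that in \<open>auto simp: comp_def\<close>)
    then show "distr ?P borel (\<lambda>x. U j (x j)) = distr (\<Omega> j) borel (U j)"
      by (simp only: coord_distr)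
  qed
  have gb: "g \<in> borel_measurable borel" by (rule borel_measurable_continuous_onI[OF g(1)])
  have gm: "(\<lambda>x. g (\<lambda>j. U j (x j))) \<in> borel_measurable ?P"
    if [measurable]: "\<And>j. U j \<in> borel_measurable (\<Omega> j)" for U :: "nat \<Rightarrow> real \<Rightarrow> real"
  proof -
    have "(\<lambda>x j. U j (x j)) \<in> borel_measurable ?P"
      by (rule measurable_coordinatewise_then_product) measurable
    then show ?thesis by (rule measurable_compose[OF _ gb])
  qed
  have e1: "(\<integral>w. g (\<lambda>j. W i j w) \<partial>M) = (\<integral>x. g (\<lambda>j. S j i (x j)) \<partial>?P)" for i
    by (rule indep_expectation_eq[OF M Q.prob_space_axioms W comp(1) _ gb])
      (auto simp: comp(2)[of "\<lambda>j. S j i"] dS)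
  have e2: "(\<integral>w. g (\<lambda>j. V j w) \<partial>N) = (\<integral>x. g (\<lambda>j. T j (x j)) \<partial>?P)"
    by (rule indep_expectation_eq[OF N Q.prob_space_axioms V comp(1) _ gb])
      (auto simp: comp(2)[of T] dT)
  have "(\<lambda>i. \<integral>x. g (\<lambda>j. S j i (x j)) \<partial>?P) \<longlonglongrightarrow> (\<integral>x. g (\<lambda>j. T j (x j)) \<partial>?P)"
  proof (rule integral_dominated_convergence[where w = "\<lambda>_. C"])
    show "(\<lambda>x. g (\<lambda>j. T j (x j))) \<in> borel_measurable ?P" by (rule gm) auto
    show "(\<lambda>x. g (\<lambda>j. S j i (x j))) \<in> borel_measurable ?P" for i by (rule gm) auto
    show "AE x in ?P. (\<lambda>i. g (\<lambda>j. S j i (x j))) \<longlonglongrightarrow> g (\<lambda>j. T j (x j))"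
    proof (rule AE_I2)
      fix x assume x: "x \<in> space ?P"
      have "(\<lambda>i j. S j i (x j)) \<longlonglongrightarrow> (\<lambda>j. T j (x j))"
        by (rule tendsto_coordinatewise_then_product) (use x in \<open>auto simp: space_PiM intro!: lim\<close>)
      then show "(\<lambda>i. g (\<lambda>j. S j i (x j))) \<longlonglongrightarrow> g (\<lambda>j. T j (x j))"
        by (rule continuous_on_tendsto_compose[OF g(1)]) auto
    qed
  qed (use g(2) in auto)
  then show ?thesis by (simp add: e1 e2)
qed

section \<open>Euler products and the sum over primes\<close>

text \<open>Summation over \<^term>\<open>Suc n\<close> matches the indexing of \<^const>\<open>dirichlet_sum\<close> and \<^const>\<open>zeta_real\<close>.\<close>

definition dseries :: "(nat \<Rightarrow> real) \<Rightarrow> real \<Rightarrow> real" where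
  "dseries a r = (\<Sum>n. a (Suc n) / real (Suc n) powr r)"

abbreviation zeta_sum :: "real \<Rightarrow> real" where
  "zeta_sum \<equiv> dseries (\<lambda>_. 1)"

definition prime_zeta :: "real \<Rightarrow> real" where
  "prime_zeta = dseries (\<lambda>n. of_bool (prime n))"

definition primes_upto :: "nat \<Rightarrow> nat set" where
  "primes_upto N = {p. prime p \<and> p \<le> N}"

lemma finite_primes_upto [simp]: "finite (primes_upto N)"
  unfolding primes_upto_def by (rule finite_subset[of _ "{..N}"]) auto

lemma summable_powr_Suc: "r > 1 \<Longrightarrow> summable (\<lambda>n. 1 / real (Suc n) powr r)"
proof -
  assume "r > 1"
  then have "summable (\<lambda>n. real n powr (- r))" by (subst summable_real_powr_iff) auto
  then have "summable (\<lambda>n. real (Suc n) powr (- r))" by (subst summable_Suc_iff)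
  then show ?thesis by (simp add: powr_minus_divide)
qed

lemma dseries_summable:
  assumes "\<And>n. \<bar>a n\<bar> \<le> 1" "r > 1"
  shows "summable (\<lambda>n. a (Suc n) / real (Suc n) powr r)"
proof (rule summable_comparison_test'[OF summable_powr_Suc[OF assms(2)]])
  show "norm (a (Suc n) / real (Suc n) powr r) \<le> 1 / real (Suc n) powr r" for n
    using assms(1)[of "Suc n"] by (auto simp: abs_divide intro!: divide_right_mono)
qed

lemma prime_zeta_sums: "r > 1 \<Longrightarrow> (\<lambda>n. of_bool (prime (Suc n)) / real (Suc n) powr r) sums prime_zeta r"
  unfolding prime_zeta_def dseries_def by (intro summable_sums dseries_summable[where a = "\<lambda>n. of_bool (prime n)"]) auto

lemma powr_decrement_bounds:
  fixes x u :: real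
  assumes "x > 0" "u > 0"
  shows "u / (x + 1) powr (1 + u) \<le> 1 / x powr u - 1 / (x + 1) powr u"
    and "1 / x powr u - 1 / (x + 1) powr u \<le> u / x powr (1 + u)"
proof -
  have "\<exists>z>x. z < x + 1 \<and> (x + 1) powr (- u) - x powr (- u) = (x + 1 - x) * (- u * z powr (- u - 1))"
    by (rule MVT2) (use assms in \<open>auto intro!: derivative_eq_intros\<close>)
  then obtain z where z: "x < z" "z < x + 1" and e: "(x + 1) powr (- u) - x powr (- u) = - u * z powr (- u - 1)"
    by auto
  have "- u - 1 = - (1 + u)" by simp
  then have eq: "1 / x powr u - 1 / (x + 1) powr u = u / z powr (1 + u)"
    using e by (simp only: powr_minus_divide) simp
  have "z powr (1 + u) \<le> (x + 1) powr (1 + u)" "x powr (1 + u) \<le> z powr (1 + u)"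
    using z assms by (auto intro!: powr_mono2)
  then show "u / (x + 1) powr (1 + u) \<le> 1 / x powr u - 1 / (x + 1) powr u"
    "1 / x powr u - 1 / (x + 1) powr u \<le> u / x powr (1 + u)"
    unfolding eq using z assms by (auto intro!: divide_left_mono mult_pos_pos)
qed

text \<open>The differences \<open>n\<^sup>-\<^sup>u - (n + 1)\<^sup>-\<^sup>u\<close> telescope to \<open>1\<close>, and each lies between \<open>u (n + 1)\<^sup>-\<^sup>1\<^sup>-\<^sup>u\<close> and \<open>u n\<^sup>-\<^sup>1\<^sup>-\<^sup>u\<close>.\<close>

lemma zeta_sum_bounds:
  assumes "u > 0"
  shows "1 / u \<le> zeta_sum (1 + u)" "zeta_sum (1 + u) \<le> 1 + 1 / u"
proof -
  have "(\<lambda>n. 1 / real (Suc n) powr u) \<longlonglongrightarrow> 0"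
    using assms by (intro real_tendsto_divide_at_top[OF tendsto_const]) real_asymp
  from telescope_sums'[OF this]
  have tel: "(\<lambda>n. 1 / real (Suc n) powr u - 1 / real (Suc (Suc n)) powr u) sums 1" by simp
  have s: "summable (\<lambda>n. 1 / real (Suc n) powr (1 + u))" using assms by (intro summable_powr_Suc) auto
  have "1 = (\<Sum>n. 1 / real (Suc n) powr u - 1 / real (Suc (Suc n)) powr u)" using tel by (simp add: sums_iff)
  also have "\<dots> \<le> (\<Sum>n. u * (1 / real (Suc n) powr (1 + u)))"
    using powr_decrement_bounds(2)[of "real (Suc n)" u for n] assms
    by (intro suminf_le sums_summable[OF tel] summable_mult s) (auto simp: add.commute)
  also have "\<dots> = u * zeta_sum (1 + u)" unfolding dseries_def by (rule suminf_mult[OF s])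
  finally show "1 / u \<le> zeta_sum (1 + u)" using assms by (simp add: field_simps)
  have "u * (zeta_sum (1 + u) - 1) = u * (\<Sum>n. 1 / real (Suc (Suc n)) powr (1 + u))"
    unfolding dseries_def using suminf_split_head[OF s] by simp
  also have "\<dots> = (\<Sum>n. u * (1 / real (Suc (Suc n)) powr (1 + u)))"
    by (rule suminf_mult[symmetric]) (subst summable_Suc_iff[of "\<lambda>n. 1 / real (Suc n) powr (1 + u)"], rule s)
  also have "\<dots> \<le> (\<Sum>n. 1 / real (Suc n) powr u - 1 / real (Suc (Suc n)) powr u)"
  proof (intro suminf_le sums_summable[OF tel] summable_mult)
    show "summable (\<lambda>n. 1 / real (Suc (Suc n)) powr (1 + u))"
      by (subst summable_Suc_iff[of "\<lambda>n. 1 / real (Suc n) powr (1 + u)"]) (rule s)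
    show "u * (1 / real (Suc (Suc n)) powr (1 + u)) \<le> 1 / real (Suc n) powr u - 1 / real (Suc (Suc n)) powr u" for n
      using powr_decrement_bounds(1)[of "real (Suc n)" u] assms by (auto simp: add.commute)
  qed
  also have "\<dots> = 1" using tel by (simp add: sums_iff)
  finally show "zeta_sum (1 + u) \<le> 1 + 1 / u" using assms by (simp add: field_simps)
qed

definition smooth_squarefree :: "nat \<Rightarrow> nat set" where
  "smooth_squarefree N = {n. squarefree n \<and> prime_factors n \<subseteq> {..N}}"

lemma prime_factors_prod_primes:
  assumes "finite A" "\<And>p. p \<in> A \<Longrightarrow> prime (p::nat)"
  shows "prime_factors (\<Prod>A) = A" "squarefree (\<Prod>A)"
proof -
  have "prime_factorization (\<Prod>A) = (\<Sum>p\<in>A. prime_factorization p)"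
    using assms by (intro prime_factorization_prod) (auto dest: prime_gt_0_nat)
  also have "\<dots> = (\<Sum>p\<in>A. {#p#})" using assms by (intro sum.cong prime_factorization_prime) auto
  also have "\<dots> = mset_set A" using assms(1) by (induction rule: finite_induct) auto
  finally show "prime_factors (\<Prod>A) = A" using assms by simp
  show "squarefree (\<Prod>A)"
    using assms by (intro squarefree_prod_coprime squarefree_prime) (auto intro: primes_coprime)
qed

lemma squarefree_eq_prod_primes:
  assumes "squarefree (n::nat)"
  shows "\<Prod>(prime_factors n) = n"
proof -
  have n: "n \<noteq> 0" using assms by (metis not_squarefree_0)
  have "n = (\<Prod>p\<in>prime_factors n. p ^ multiplicity p n)"
    using n by (simp add: prime_factorization_nat)
  also have "\<dots> = (\<Prod>p\<in>prime_factors n. p)"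
  proof (rule prod.cong)
    fix p assume p: "p \<in> prime_factors n"
    then have "multiplicity p n = 1"
      using assms n squarefree_factorial_semiring''[of n] by (auto simp: prime_factors_multiplicity le_Suc_eq)
    then show "p ^ multiplicity p n = p" by simp
  qed simp
  finally show ?thesis by simp
qed

text \<open>A square-free number is the same as the set of its prime factors.\<close>

lemma smooth_squarefree_bij: "bij_betw (\<lambda>A. \<Prod>A) (Pow (primes_upto N)) (smooth_squarefree N)"
proof (rule bij_betwI[where g = prime_factors])
  have A: "finite A" "p \<in> A \<Longrightarrow> prime p" if "A \<in> Pow (primes_upto N)" for A p
    using that finite_subset[OF _ finite_primes_upto] by (auto simp: primes_upto_def)
  show "(\<lambda>A. \<Prod>A) \<in> Pow (primes_upto N) \<rightarrow> smooth_squarefree N"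
  proof
    fix S assume S: "S \<in> Pow (primes_upto N)"
    show "\<Prod>S \<in> smooth_squarefree N"
      using prime_factors_prod_primes[OF A[OF S]] S by (auto simp: smooth_squarefree_def primes_upto_def)
  qed
  show "prime_factors \<in> smooth_squarefree N \<rightarrow> Pow (primes_upto N)"
    by (auto simp: smooth_squarefree_def primes_upto_def)
  show "prime_factors (\<Prod>S) = S" if "S \<in> Pow (primes_upto N)" for S
    by (rule prime_factors_prod_primes(1)[OF A[OF that]])
  show "\<Prod>(prime_factors n) = n" if "n \<in> smooth_squarefree N" for n
    using that by (intro squarefree_eq_prod_primes) (simp add: smooth_squarefree_def)
qed

lemma finite_smooth_squarefree [simp]: "finite (smooth_squarefree N)"
  using bij_betw_finite[OF smooth_squarefree_bij[of N]] by simp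

lemma zero_notin_smooth_squarefree [simp]: "0 \<notin> smooth_squarefree N"
  by (simp add: smooth_squarefree_def)

lemma squarefree_le_smooth: "squarefree n \<Longrightarrow> n \<le> N \<Longrightarrow> n \<in> smooth_squarefree N"
  unfolding smooth_squarefree_def
  by (auto dest!: in_prime_factors_imp_dvd dvd_imp_le intro: Nat.gr0I)

text \<open>Multiplying out the product gives one term for every set of primes up to \<open>N\<close>.\<close>

lemma euler_product_squarefree:
  fixes h :: "nat \<Rightarrow> real"
  assumes "\<And>n. squarefree n \<Longrightarrow> h n = (\<Prod>p\<in>prime_factors n. h p)"
  shows "(\<Prod>p\<in>primes_upto N. 1 + h p) = (\<Sum>n\<in>smooth_squarefree N. h n)"
proof -
  have "(\<Prod>p\<in>primes_upto N. h p + 1) = (\<Sum>A\<in>Pow (primes_upto N). (\<Prod>p\<in>A. h p) * (\<Prod>p\<in>primes_upto N - A. 1))"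
    by (rule prod_add) simp
  also have "\<dots> = (\<Sum>A\<in>Pow (primes_upto N). h (\<Prod>A))"
  proof (rule sum.cong)
    fix S assume S: "S \<in> Pow (primes_upto N)"
    then have "finite S" "\<And>p. p \<in> S \<Longrightarrow> prime p"
      using finite_subset[OF _ finite_primes_upto] by (auto simp: primes_upto_def)
    note * = prime_factors_prod_primes[OF this]
    show "(\<Prod>p\<in>S. h p) * (\<Prod>p\<in>primes_upto N - S. 1) = h (\<Prod>S)"
      using assms[OF *(2)] *(1) by simp
  qed simp
  also have "\<dots> = (\<Sum>n\<in>smooth_squarefree N. h n)"
    by (rule sum.reindex_bij_betw[OF smooth_squarefree_bij])
  finally show ?thesis by (simp add: add.commute)
qed

lemma powr_squarefree:
  assumes "squarefree n"
  shows "real n powr r = (\<Prod>p\<in>prime_factors n. real p powr r)"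
proof -
  have "real n = real (\<Prod>(prime_factors n))"
    by (simp only: squarefree_eq_prod_primes[OF assms])
  also have "\<dots> = (\<Prod>p\<in>prime_factors n. real p)" by (rule of_nat_prod)
  finally show ?thesis using prod_powr_distrib[of real "prime_factors n" r] by simp
qed

lemma euler_product_powr:
  "(\<Prod>p\<in>primes_upto N. 1 + 1 / real p powr r) = (\<Sum>n\<in>smooth_squarefree N. 1 / real n powr r)"
  by (rule euler_product_squarefree) (simp add: powr_squarefree prod_dividef)

text \<open>Translates the partial sums of series over all integers, with the primes marked by \<^const>\<open>of_bool\<close>, into finite sums over primes.\<close>

lemma sum_primes_upto:
  fixes g :: "nat \<Rightarrow> real"
  shows "(\<Sum>n<N. of_bool (prime (Suc n)) * g (Suc n)) = (\<Sum>p\<in>primes_upto N. g p)"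
proof -
  have "(\<Sum>n<N. of_bool (prime (Suc n)) * g (Suc n)) = (\<Sum>n\<in>Suc ` {..<N}. of_bool (prime n) * g n)"
    by (rule sum.reindex_cong[where l = Suc, symmetric]) auto
  also have "\<dots> = (\<Sum>p\<in>primes_upto N. g p)"
  proof (rule sum.mono_neutral_cong_right)
    show "primes_upto N \<subseteq> Suc ` {..<N}"
      unfolding image_Suc_lessThan by (auto simp: primes_upto_def prime_gt_0_nat Suc_leI)
  qed (auto simp: primes_upto_def)
  finally show ?thesis .
qed

lemma sum_le_zeta_sum:
  assumes "finite A" "0 \<notin> A" "r > 1"
  shows "(\<Sum>n\<in>A. 1 / real n powr r) \<le> zeta_sum r"
proof -
  have "(\<lambda>n. Suc (n - 1)) ` A = (\<lambda>n. n) ` A"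
  proof (rule image_cong)
    fix n assume "n \<in> A"
    then have "n \<noteq> 0" using assms(2) by metis
    then show "Suc (n - 1) = n" by simp
  qed simp
  then have A: "A = Suc ` (\<lambda>n. n - 1) ` A" by (simp add: image_image)
  have "(\<Sum>n\<in>A. 1 / real n powr r) = (\<Sum>n\<in>(\<lambda>n. n - 1) ` A. 1 / real (Suc n) powr r)"
    by (subst A, subst sum.reindex) auto
  also have "\<dots> \<le> (\<Sum>n. 1 / real (Suc n) powr r)"
    using assms by (intro sum_le_suminf summable_powr_Suc) auto
  finally show ?thesis by (simp add: dseries_def)
qed

lemma zeta_sum_ge_1: "r > 1 \<Longrightarrow> 1 \<le> zeta_sum r"
  using sum_le_zeta_sum[of "{1}" r] by simp

lemma zeta_sum_2_ge_1: "1 \<le> zeta_sum 2"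
  by (rule zeta_sum_ge_1) simp

lemma square_part_ge_1: "n \<noteq> 0 \<Longrightarrow> 1 \<le> square_part (n::nat)"
  by (metis less_one not_le square_part_0_iff)

text \<open>Every \<open>n\<close> is uniquely \<open>a b\<^sup>2\<close> with square-free \<open>a\<close>; the squares contribute at most the factor \<open>\<zeta>(2)\<close> because \<open>2 r \<ge> 2\<close>.\<close>

lemma zeta_partial_le_squarefree:
  assumes "r \<ge> 1"
  shows "(\<Sum>n\<in>{1..N}. 1 / real n powr r) \<le> zeta_sum 2 * (\<Sum>n\<in>smooth_squarefree N. 1 / real n powr r)"
proof -
  let ?f = "\<lambda>n::nat. (squarefree_part n, square_part n)"
  have inj: "inj_on ?f {1..N}"
    by (rule inj_onI) (metis Pair_inject squarefree_decompose)
  have sub: "?f ` {1..N} \<subseteq> smooth_squarefree N \<times> {1..N}"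
  proof
    fix z assume "z \<in> ?f ` {1..N}"
    then obtain n where n: "n \<in> {1..N}" "z = ?f n" by blast
    have d: "n = squarefree_part n * square_part n ^ 2" by (rule squarefree_decompose)
    have "1 \<le> square_part n" using n by (intro square_part_ge_1) auto
    moreover have "squarefree_part n \<le> n" "square_part n \<le> n"
      using n d by (metis (no_types) atLeastAtMost_iff dvd_imp_le dvd_triv_left less_le_trans zero_less_one,
         metis (no_types) atLeastAtMost_iff dvd_imp_le dvd_trans dvd_triv_left less_le_trans power2_eq_square square_part_square_dvd zero_less_one)
    ultimately show "z \<in> smooth_squarefree N \<times> {1..N}"
      using n by (auto intro!: squarefree_le_smooth)
  qed
  have "(\<Sum>n\<in>{1..N}. 1 / real n powr r) \<le> (\<Sum>n\<in>{1..N}. (\<lambda>(a, b). 1 / real a powr r * (1 / real b powr 2)) (?f n))"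
  proof (rule sum_mono)
    fix n assume n: "n \<in> {1..N}"
    have b: "real (square_part n) \<ge> 1" using n square_part_ge_1[of n] by simp
    have "real n = real (squarefree_part n) * real (square_part n) ^ 2"
      by (subst squarefree_decompose[of n]) simp
    then have "real n powr r = real (squarefree_part n) powr r * (real (square_part n) ^ 2) powr r"
      by (simp add: powr_mult)
    moreover have "(real (square_part n) ^ 2) powr 1 \<le> (real (square_part n) ^ 2) powr r"
      using b assms by (intro powr_mono) auto
    ultimately have "real (squarefree_part n) powr r * real (square_part n) powr 2 \<le> real n powr r"
      using b by (simp add: mult_left_mono)
    then have "1 / real n powr r \<le> 1 / (real (squarefree_part n) powr r * real (square_part n) powr 2)"
      using b n by (intro divide_left_mono mult_pos_pos) auto
    then show "1 / real n powr r \<le> (\<lambda>(a, b). 1 / real a powr r * (1 / real b powr 2)) (?f n)" by simp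
  qed
  also have "\<dots> = (\<Sum>(a, b)\<in>?f ` {1..N}. 1 / real a powr r * (1 / real b powr 2))"
    by (subst sum.reindex[OF inj]) simp
  also have "\<dots> \<le> (\<Sum>(a, b)\<in>smooth_squarefree N \<times> {1..N}. 1 / real a powr r * (1 / real b powr 2))"
    by (rule sum_mono2) (use sub in auto)
  also have "\<dots> = (\<Sum>a\<in>smooth_squarefree N. 1 / real a powr r) * (\<Sum>b\<in>{1..N}. 1 / real b powr 2)"
    by (simp add: sum_product sum.cartesian_product)
  also have "\<dots> \<le> (\<Sum>a\<in>smooth_squarefree N. 1 / real a powr r) * zeta_sum 2"
    by (intro mult_left_mono sum_le_zeta_sum sum_nonneg) auto
  finally show ?thesis by (simp add: mult.commute)
qed

text \<open>The square-free numbers carry the zeta sum up to a factor between \<open>1 / \<zeta>(2)\<close> and \<open>1\<close>, and their Euler product has the logarithm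
  \<open>\<Sum>\<^sub>p log (1 + p\<^sup>-\<^sup>r)\<close>, which differs from \<open>\<Sum>\<^sub>p p\<^sup>-\<^sup>r\<close> by at most \<open>\<Sum>\<^sub>p p\<^sup>-\<^sup>2\<^sup>r\<close>.\<close>

lemma prime_zeta_log_zeta:
  assumes r: "r > 1"
  shows "\<bar>ln (zeta_sum r) - prime_zeta r\<bar> \<le> zeta_sum 2"
proof -
  let ?S = "\<lambda>N. \<Sum>p\<in>primes_upto N. 1 / real p powr r"
  let ?P = "\<lambda>N. \<Prod>p\<in>primes_upto N. 1 + 1 / real p powr r"
  have S: "?S \<longlonglongrightarrow> prime_zeta r"
    using prime_zeta_sums[OF r] unfolding sums_def by (simp add: sum_primes_upto[where g = "\<lambda>n. 1 / real n powr r", simplified])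
  have Z: "(\<lambda>N. \<Sum>n\<in>{1..N}. 1 / real n powr r) \<longlonglongrightarrow> zeta_sum r"
    using summable_LIMSEQ[OF summable_powr_Suc[OF r]]
    by (simp add: dseries_def sum.shift_bounds_Suc_ivl sum.atLeast1_atMost_eq)
  have p1: "1 / real p powr r \<le> 1" if "p \<in> primes_upto N" for p N
    using that r prime_gt_0_nat[of p] by (auto simp: primes_upto_def intro!: ge_one_powr_ge_zero)
  have lnP: "ln (?P N) = (\<Sum>p\<in>primes_upto N. ln (1 + 1 / real p powr r))" for N
  proof (rule ln_prod)
    show "1 + 1 / real p powr r \<noteq> 0" for p :: nat
      using add_pos_nonneg[of 1 "1 / real p powr r"] by simp
  qed simp
  have Ppos: "?P N > 0" for N by (intro prod_pos) (auto simp: add_pos_nonneg)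
  have zr: "1 \<le> zeta_sum r" "1 \<le> zeta_sum 2" using r by (auto intro!: zeta_sum_ge_1)
  have "?S N \<le> ln (zeta_sum r) + zeta_sum 2" for N
  proof -
    have "?S N \<le> (\<Sum>p\<in>primes_upto N. ln (1 + 1 / real p powr r) + 1 / real p powr 2)"
    proof (rule sum_mono)
      fix p assume p: "p \<in> primes_upto N"
      then have p': "real p \<ge> 1" using prime_gt_0_nat[of p] by (auto simp: primes_upto_def)
      have "1 / real p powr r \<le> ln (1 + 1 / real p powr r) + (1 / real p powr r)\<^sup>2"
        using abs_ln_one_plus_x_minus_x_bound_nonneg[of "1 / real p powr r"] p1[OF p] by auto
      also have "(1 / real p powr r)\<^sup>2 = 1 / real p powr (2 * r)"
        by (simp add: power_divide powr_powr power2_eq_square flip: powr_add)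
      also have "\<dots> \<le> 1 / real p powr 2"
        using r p' by (intro divide_left_mono powr_mono) auto
      finally show "1 / real p powr r \<le> ln (1 + 1 / real p powr r) + 1 / real p powr 2" by simp
    qed
    also have "\<dots> = ln (?P N) + (\<Sum>p\<in>primes_upto N. 1 / real p powr 2)" by (simp add: lnP sum.distrib)
    also have "\<dots> \<le> ln (zeta_sum r) + zeta_sum 2"
    proof (rule add_mono)
      show "ln (?P N) \<le> ln (zeta_sum r)"
      proof (subst ln_le_cancel_iff)
        show "?P N \<le> zeta_sum r" unfolding euler_product_powr
          by (rule sum_le_zeta_sum) (use r in auto)
      qed (use Ppos zr in auto)
      show "(\<Sum>p\<in>primes_upto N. 1 / real p powr 2) \<le> zeta_sum 2"
        by (rule sum_le_zeta_sum) (auto simp: primes_upto_def intro: finite_primes_upto[unfolded primes_upto_def])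
    qed
    finally show ?thesis .
  qed
  then have "prime_zeta r \<le> ln (zeta_sum r) + zeta_sum 2"
    by (intro LIMSEQ_le_const2[OF S]) auto
  moreover have "ln (zeta_sum r) \<le> ln (zeta_sum 2) + prime_zeta r"
  proof (rule LIMSEQ_le)
    show "(\<lambda>N. ln (\<Sum>n\<in>{1..N}. 1 / real n powr r)) \<longlonglongrightarrow> ln (zeta_sum r)"
      using zr by (intro tendsto_ln Z) auto
    show "(\<lambda>N. ln (zeta_sum 2) + ?S N) \<longlonglongrightarrow> ln (zeta_sum 2) + prime_zeta r"
      by (intro tendsto_intros S)
    have "ln (\<Sum>n\<in>{1..N}. 1 / real n powr r) \<le> ln (zeta_sum 2) + ?S N" if N: "N \<ge> 1" for N
    proof -
      have "0 < (\<Sum>n\<in>{1..N}. 1 / real n powr r)" using N by (intro sum_pos) auto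
      moreover have "(\<Sum>n\<in>{1..N}. 1 / real n powr r) \<le> zeta_sum 2 * ?P N"
        unfolding euler_product_powr using r by (intro zeta_partial_le_squarefree) auto
      ultimately have "ln (\<Sum>n\<in>{1..N}. 1 / real n powr r) \<le> ln (zeta_sum 2 * ?P N)" by simp
      also have "\<dots> = ln (zeta_sum 2) + ln (?P N)" using Ppos[of N] zr by (intro ln_mult_pos) auto
      also have "ln (?P N) \<le> ?S N" unfolding lnP by (intro sum_mono ln_add_one_self_le_self) auto
      finally show ?thesis by simp
    qed
    then show "\<exists>k. \<forall>N\<ge>k. ln (\<Sum>n\<in>{1..N}. 1 / real n powr r) \<le> ln (zeta_sum 2) + ?S N" by blast
  qed
  moreover have "ln (zeta_sum 2) \<le> zeta_sum 2" using ln_bound[of "zeta_sum 2"] zr by simp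
  ultimately show ?thesis by linarith
qed

lemma prime_zeta_asymptotics:
  assumes "0 < u" "u \<le> 2"
  shows "\<bar>prime_zeta (1 + u) - ln (1 / u)\<bar> \<le> zeta_sum 2 + 2"
proof -
  have z: "1 / u \<le> zeta_sum (1 + u)" "zeta_sum (1 + u) \<le> 1 + 1 / u" using zeta_sum_bounds assms by auto
  have zpos: "0 < zeta_sum (1 + u)" using less_le_trans[OF _ z(1)] assms by simp
  have "ln (1 / u) \<le> ln (zeta_sum (1 + u))" using z assms zpos by (subst ln_le_cancel_iff) auto
  moreover have "ln (zeta_sum (1 + u)) \<le> ln (1 / u) + 2"
  proof -
    have "0 < 1 / u" using assms by simp
    then have "ln (zeta_sum (1 + u)) \<le> ln (1 / u * (1 + u))"
      using z assms zpos by (subst ln_le_cancel_iff) (auto simp: field_simps add_pos_pos)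
    also have "\<dots> = ln (1 / u) + ln (1 + u)" using assms by (intro ln_mult_pos) auto
    also have "ln (1 + u) \<le> u" using assms by (intro ln_add_one_self_le_self) auto
    finally show ?thesis using assms by simp
  qed
  ultimately show ?thesis using prime_zeta_log_zeta[of "1 + u"] assms by linarith
qed

section \<open>The variance of an increment over the primes\<close>

text \<open>The coefficient of \<open>f(n)\<close> in \<open>Y(u) - Y(v)\<close>, where \<open>Y(u) = \<Sum>\<^sub>p f(p) p\<^sup>-\<^sup>1\<^sup>/\<^sup>2\<^sup>-\<^sup>u\<close>.\<close>

definition prime_weight :: "real \<Rightarrow> real \<Rightarrow> nat \<Rightarrow> real" where
  "prime_weight u v n = of_bool (prime n) * (1 / real n powr (1 / 2 + u) - 1 / real n powr (1 / 2 + v))"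

text \<open>On this range of primes \<open>p\<^sup>-\<^sup>v\<close> has already decayed while \<open>p\<^sup>-\<^sup>u\<close> has not; for \<open>u\<close> much smaller than \<open>v\<close> it carries almost
  all of the variance. The half-open
  condition makes the blocks of consecutive parameter intervals disjoint.\<close>

definition prime_block :: "real \<Rightarrow> real \<Rightarrow> nat set" where
  "prime_block u v = {p. prime p \<and> 1 / v < ln (real p) \<and> ln (real p) \<le> 1 / u}"

lemma finite_prime_block [simp]: "finite (prime_block u v)"
proof (rule finite_subset)
  show "prime_block u v \<subseteq> {..nat \<lceil>exp (1 / u)\<rceil>}"
  proof
    fix p assume "p \<in> prime_block u v"
    then have "ln (real p) \<le> 1 / u" "real p > 0" by (auto simp: prime_block_def prime_gt_0_nat)
    then have "real p \<le> exp (1 / u)" by (metis exp_le_cancel_iff exp_ln)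
    then show "p \<in> {..nat \<lceil>exp (1 / u)\<rceil>}" by simp linarith
  qed
qed simp

lemma prime_weight_sq_eq_exp:
  assumes "prime n"
  shows "(prime_weight u v n)\<^sup>2 = (exp (- (u * ln (real n))) - exp (- (v * ln (real n))))\<^sup>2 / real n"
proof -
  have n: "real n > 0" using assms prime_gt_0_nat by simp
  have e: "1 / real n powr (1 / 2 + w) = 1 / sqrt (real n) * exp (- (w * ln (real n)))" for w
  proof -
    have "real n powr (1 / 2 + w) = sqrt (real n) * exp (w * ln (real n))"
      using n by (simp add: powr_add powr_half_sqrt) (simp add: powr_def)
    then show ?thesis by (simp add: exp_minus field_simps)
  qed
  have "prime_weight u v n = 1 / sqrt (real n) * (exp (- (u * ln (real n))) - exp (- (v * ln (real n))))"
    using assms unfolding prime_weight_def e by (simp add: algebra_simps)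
  then show ?thesis using n by (simp add: power_mult_distrib power_divide)
qed

lemma prime_weight_sums:
  assumes "u > 0" "v > 0"
  shows "(\<lambda>n. (prime_weight u v (Suc n))\<^sup>2) sums
    (prime_zeta (1 + 2 * u) - 2 * prime_zeta (1 + (u + v)) + prime_zeta (1 + 2 * v))"
proof -
  let ?f = "\<lambda>r n. of_bool (prime (Suc n)) / real (Suc n) powr r"
  have "(\<lambda>n. ?f (1 + 2 * u) n - 2 * ?f (1 + (u + v)) n + ?f (1 + 2 * v) n) sums
    (prime_zeta (1 + 2 * u) - 2 * prime_zeta (1 + (u + v)) + prime_zeta (1 + 2 * v))"
    using assms by (intro sums_add sums_diff sums_mult prime_zeta_sums) auto
  moreover have "?f (1 + 2 * u) n - 2 * ?f (1 + (u + v)) n + ?f (1 + 2 * v) n = (prime_weight u v (Suc n))\<^sup>2" for n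
  proof -
    have p: "1 / real (Suc n) powr (1 + (a + b)) = 1 / real (Suc n) powr (1 / 2 + a) * (1 / real (Suc n) powr (1 / 2 + b))" for a b
      by (simp flip: powr_add)
    show ?thesis
      using p[of u u] p[of u v] p[of v v] unfolding prime_weight_def by (simp add: power2_eq_square algebra_simps)
  qed
  ultimately show ?thesis by simp
qed

lemma prime_weight_summable: "u > 0 \<Longrightarrow> v > 0 \<Longrightarrow> summable (\<lambda>n. (prime_weight u v (Suc n))\<^sup>2)"
  by (rule sums_summable[OF prime_weight_sums])

text \<open>From \<open>x e\<^sup>-\<^sup>x \<le> 1\<close> and \<open>x / 2 \<le> e\<^sup>x\<^sup>/\<^sup>2 - 1\<close>.\<close>

lemma square_exp_le_exp_diff:
  fixes x :: real
  assumes "x \<ge> 0"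
  shows "x\<^sup>2 * exp (- 2 * x) \<le> 2 * (exp (- x / 2) - exp (- x))"
proof -
  have 1: "x * exp (- x) \<le> 1"
  proof -
    have "x \<le> exp x" using exp_ge_add_one_self[of x] by linarith
    then show ?thesis by (simp add: exp_minus field_simps)
  qed
  have "x\<^sup>2 * exp (- 2 * x) = (x * exp (- x)) * (x * exp (- x))" 
    by (simp add: power2_eq_square mult_ac flip: exp_add)
  also have "\<dots> \<le> 1 * (x * exp (- x))" using 1 assms by (intro mult_right_mono) auto
  also have "\<dots> \<le> 2 * (exp (x / 2) - 1) * exp (- x)"
  proof -
    have "x / 2 * 2 \<le> (exp (x / 2) - 1) * 2"
      using exp_ge_add_one_self[of "x / 2"] by (intro mult_right_mono) (auto simp: le_diff_eq add.commute)
    then have "x \<le> 2 * (exp (x / 2) - 1)" by simp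
    then show ?thesis by (simp add: mult_right_mono)
  qed
  also have "\<dots> = 2 * (exp (- x / 2) - exp (- x))"
    by (simp add: algebra_simps flip: exp_add)
  finally show ?thesis .
qed

lemma exp_difference_sq_le:
  fixes u v l :: real
  assumes "u \<le> v" "l \<ge> 0"
  shows "(exp (- (u * l)) - exp (- (v * l)))\<^sup>2 \<le> ((v - u) * l)\<^sup>2 * exp (- 2 * (u * l))"
proof -
  have "exp (- (u * l)) - exp (- (v * l)) = exp (- (u * l)) * (1 - exp (- ((v - u) * l)))"
    by (simp add: algebra_simps flip: exp_add)
  also have "\<dots> \<le> exp (- (u * l)) * ((v - u) * l)"
    using exp_ge_add_one_self[of "- ((v - u) * l)"] by (intro mult_left_mono) auto
  finally have "exp (- (u * l)) - exp (- (v * l)) \<le> exp (- (u * l)) * ((v - u) * l)" .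
  moreover have "0 \<le> exp (- (u * l)) - exp (- (v * l))" using assms by (simp add: mult_right_mono)
  ultimately have "(exp (- (u * l)) - exp (- (v * l)))\<^sup>2 \<le> (exp (- (u * l)) * ((v - u) * l))\<^sup>2"
    by (intro power_mono)
  also have "\<dots> = ((v - u) * l)\<^sup>2 * exp (- 2 * (u * l))"
    by (simp add: power_mult_distrib mult_ac flip: exp_double)
  finally show ?thesis .
qed

text \<open>Equal to \<open>(e\<^sup>-\<^sup>w\<^sup>l\<^sup>/\<^sup>2 - e\<^sup>-\<^sup>w\<^sup>l) / p\<close> with \<open>l = log p\<close>: a bump at \<open>l \<approx> 1 / w\<close>. Its sum over all primes stays bounded as \<open>w\<close> tends to \<open>0\<close>,
  since the logarithmic singularities of the two sums cancel. The error terms of this section are dominated by such bumps.\<close>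

definition prime_bump :: "real \<Rightarrow> nat \<Rightarrow> real" where
  "prime_bump w n = of_bool (prime n) / real n powr (1 + w / 2) - of_bool (prime n) / real n powr (1 + w)"

lemma prime_bump_sums:
  assumes "0 < w"
  shows "(\<lambda>n. prime_bump w (Suc n)) sums (prime_zeta (1 + w / 2) - prime_zeta (1 + w))"
  unfolding prime_bump_def using assms by (intro sums_diff prime_zeta_sums) auto

lemma prime_bump_suminf_le:
  assumes "0 < w" "w \<le> 2"
  shows "(\<Sum>n. prime_bump w (Suc n)) \<le> 2 * zeta_sum 2 + 5"
proof -
  have "ln (1 / (w / 2)) = ln (1 / w) + ln 2"
    using assms by (simp add: ln_div)
  then show ?thesis
    using prime_zeta_asymptotics[of "w / 2"] prime_zeta_asymptotics[of w] assms
      sums_unique[OF prime_bump_sums[OF assms(1)]] ln_2_less_1 by auto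
qed

lemma prime_bump_eq_exp:
  assumes "prime n"
  shows "prime_bump w n = (exp (- (w * ln (real n)) / 2) - exp (- (w * ln (real n)))) / real n"
proof -
  have n: "real n > 0" using assms prime_gt_0_nat by simp
  then have "1 / real n powr (1 + c) = exp (- (c * ln (real n))) / real n" for c
    by (simp add: powr_add) (simp add: powr_def exp_minus field_simps)
  from this[of w] this[of "w / 2"] show ?thesis
    using assms unfolding prime_bump_def by (simp add: diff_divide_distrib)
qed

lemma prime_bump_nonneg: "w \<ge> 0 \<Longrightarrow> 0 \<le> prime_bump w n"
proof (cases "prime n")
  case True
  assume "w \<ge> 0"
  moreover have "ln (real n) \<ge> 0" using prime_gt_0_nat[OF True] by simp
  ultimately have "0 \<le> w * ln (real n)" by simp
  then show ?thesis unfolding prime_bump_eq_exp[OF True] by simp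
qed (simp add: prime_bump_def)

lemma log_sq_le_prime_bump:
  assumes "prime n" "w \<ge> 0"
  shows "(w * ln (real n))\<^sup>2 * exp (- 2 * (w * ln (real n))) / real n \<le> 2 * prime_bump w n"
proof -
  have "0 \<le> w * ln (real n)" using assms prime_gt_0_nat[OF assms(1)] by simp
  from divide_right_mono[OF square_exp_le_exp_diff[OF this], of "real n"]
  show ?thesis using assms(1) by (simp add: prime_bump_eq_exp)
qed

text \<open>Useful for \<open>v \<le> 2 u\<close>, where it makes the variance quadratically small in \<open>(v - u) / u\<close>.\<close>

lemma prime_weight_near:
  assumes "0 < u" "u \<le> v"
  shows "(prime_weight u v n)\<^sup>2 \<le> ((v - u) / u)\<^sup>2 * (2 * prime_bump u n)"
proof (cases "prime n")
  case True
  let ?l = "ln (real n)"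
  have l: "?l \<ge> 0" using prime_gt_0_nat[OF True] by simp
  have "(prime_weight u v n)\<^sup>2 \<le> ((v - u) * ?l)\<^sup>2 * exp (- 2 * (u * ?l)) / real n"
    unfolding prime_weight_sq_eq_exp[OF True] by (intro divide_right_mono exp_difference_sq_le assms l) auto
  also have "\<dots> = ((v - u) / u)\<^sup>2 * ((u * ?l)\<^sup>2 * exp (- 2 * (u * ?l)) / real n)"
    using assms by (simp add: power_mult_distrib power_divide)
  also have "\<dots> \<le> ((v - u) / u)\<^sup>2 * (2 * prime_bump u n)"
    using assms True by (intro mult_left_mono log_sq_le_prime_bump) auto
  finally show ?thesis .
qed (simp add: prime_weight_def prime_bump_def)

text \<open>Below the block, \<open>v l \<le> 1\<close> and the weight is at most of order \<open>v l\<close>, which is comparable with the bump at \<open>1 / v\<close>. Above it,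
  \<open>u l > 1\<close> and the weight decays like the bump at \<open>1 / u\<close>.\<close>

lemma prime_weight_outside_block:
  assumes "0 < u" "u \<le> v" "n \<notin> prime_block u v"
  shows "(prime_weight u v n)\<^sup>2 \<le> 2 * prime_bump u n + 2 * exp 2 * prime_bump v n"
proof (cases "prime n")
  case True
  let ?l = "ln (real n)"
  have l: "?l \<ge> 0" using prime_gt_0_nat[OF True] by simp
  have n: "real n > 0" using prime_gt_0_nat[OF True] by simp
  have nn: "0 \<le> prime_bump u n" "0 \<le> prime_bump v n" using assms by (auto intro!: prime_bump_nonneg)
  consider "?l \<le> 1 / v" | "1 / u < ?l" using assms True by (force simp: prime_block_def)
  then show ?thesis
  proof cases
    case 1
    then have vl: "v * ?l \<le> 1" using assms by (simp add: field_simps)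
    have "(prime_weight u v n)\<^sup>2 \<le> ((v - u) * ?l)\<^sup>2 * exp (- 2 * (u * ?l)) / real n"
      unfolding prime_weight_sq_eq_exp[OF True] by (intro divide_right_mono exp_difference_sq_le assms l) auto
    also have "\<dots> \<le> (v * ?l)\<^sup>2 * (exp 2 * exp (- 2 * (v * ?l))) / real n"
    proof (intro divide_right_mono mult_mono power_mono)
      have "exp (- 2 * (u * ?l)) \<le> 1" using assms l by simp
      also have "1 \<le> exp (2 - 2 * (v * ?l))" using vl by simp
      finally show "exp (- 2 * (u * ?l)) \<le> exp 2 * exp (- 2 * (v * ?l))" by (simp flip: exp_add)
    qed (use assms l in \<open>auto intro!: mult_right_mono\<close>)
    also have "\<dots> = exp 2 * ((v * ?l)\<^sup>2 * exp (- 2 * (v * ?l)) / real n)" by simp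
    also have "\<dots> \<le> exp 2 * (2 * prime_bump v n)"
      using assms True by (intro mult_left_mono log_sq_le_prime_bump) auto
    finally show ?thesis using nn by simp
  next
    case 2
    then have ul: "1 \<le> u * ?l" using assms by (simp add: field_simps)
    have "(prime_weight u v n)\<^sup>2 \<le> (exp (- (u * ?l)))\<^sup>2 / real n"
      unfolding prime_weight_sq_eq_exp[OF True] using assms l
      by (intro divide_right_mono power_mono) (auto simp: mult_right_mono)
    also have "\<dots> = 1 * exp (- 2 * (u * ?l)) / real n" by (simp flip: exp_double)
    also have "\<dots> \<le> (u * ?l)\<^sup>2 * exp (- 2 * (u * ?l)) / real n"
      using ul by (intro divide_right_mono mult_right_mono) auto
    also have "\<dots> \<le> 2 * prime_bump u n"
      using assms True by (intro log_sq_le_prime_bump) auto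
    finally show ?thesis using nn by (simp add: add_increasing2)
  qed
qed (simp add: prime_weight_def prime_bump_def)

text \<open>A common value for the absolute constants of this section, with no attempt at sharpness.\<close>

definition block_const :: real where
  "block_const = 20 * exp 2 * (zeta_sum 2 + 5)"

lemma block_const_ge: "20 * (zeta_sum 2 + 5) \<le> block_const"
proof -
  have "20 * 1 * (zeta_sum 2 + 5) \<le> block_const"
    unfolding block_const_def using zeta_sum_2_ge_1 by (intro mult_right_mono mult_left_mono) auto
  then show ?thesis by simp
qed

lemma block_const_nonneg: "0 \<le> block_const"
  using zeta_sum_2_ge_1 by (intro order_trans[OF _ block_const_ge]) simp

lemma outside_block_sum_le:
  assumes "0 < u" "u \<le> v" "v \<le> 1"
  shows "(\<Sum>n. of_bool (Suc n \<notin> prime_block u v) * (prime_weight u v (Suc n))\<^sup>2) \<le> block_const"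
proof -
  have s: "summable (\<lambda>n. prime_bump u (Suc n))" "summable (\<lambda>n. prime_bump v (Suc n))"
    using assms by (auto intro!: sums_summable[OF prime_bump_sums])
  have nn: "0 \<le> prime_bump u n" "0 \<le> prime_bump v n" for n using assms by (auto intro!: prime_bump_nonneg)
  have pt: "of_bool (Suc n \<notin> prime_block u v) * (prime_weight u v (Suc n))\<^sup>2 \<le>
      2 * prime_bump u (Suc n) + 2 * exp 2 * prime_bump v (Suc n)" for n
    using prime_weight_outside_block[OF assms(1,2), of "Suc n"] nn[of "Suc n"]
    by (cases "Suc n \<in> prime_block u v") auto
  have s': "summable (\<lambda>n. 2 * prime_bump u (Suc n) + 2 * exp 2 * prime_bump v (Suc n))"
    by (intro summable_add summable_mult s)
  have "(\<Sum>n. of_bool (Suc n \<notin> prime_block u v) * (prime_weight u v (Suc n))\<^sup>2) \<le>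
      (\<Sum>n. 2 * prime_bump u (Suc n) + 2 * exp 2 * prime_bump v (Suc n))"
    by (rule suminf_le[OF pt _ s'])
      (rule summable_comparison_test'[OF s', of 0], use pt in simp)
  also have "\<dots> = 2 * (\<Sum>n. prime_bump u (Suc n)) + 2 * exp 2 * (\<Sum>n. prime_bump v (Suc n))"
    by (simp add: suminf_add[symmetric] suminf_mult summable_mult s)
  also have "\<dots> \<le> 2 * exp 2 * (2 * zeta_sum 2 + 5) + 2 * exp 2 * (2 * zeta_sum 2 + 5)"
  proof (rule add_mono)
    have "0 \<le> (\<Sum>n. prime_bump u (Suc n))" by (intro suminf_nonneg s nn)
    then have "2 * (\<Sum>n. prime_bump u (Suc n)) \<le> 2 * exp 2 * (\<Sum>n. prime_bump u (Suc n))"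
      by (intro mult_right_mono) auto
    also have "\<dots> \<le> 2 * exp 2 * (2 * zeta_sum 2 + 5)"
      using assms by (intro mult_left_mono prime_bump_suminf_le) auto
    finally show "2 * (\<Sum>n. prime_bump u (Suc n)) \<le> \<dots>" .
    show "2 * exp 2 * (\<Sum>n. prime_bump v (Suc n)) \<le> 2 * exp 2 * (2 * zeta_sum 2 + 5)"
      using assms by (intro mult_left_mono prime_bump_suminf_le) auto
  qed
  also have "\<dots> \<le> block_const"
    using zeta_sum_2_ge_1 unfolding block_const_def by (simp add: algebra_simps)
  finally show ?thesis .
qed

text \<open>Expanding the square, the three sums over primes combine to \<open>log ((u + v)\<^sup>2 / (4 u v))\<close>, which differs from \<open>log (v / u)\<close> by
  \<open>2 log ((u + v) / (2 v))\<close>, a number between \<open>- 2 log 2\<close> and \<open>0\<close>.\<close>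

lemma prime_weight_total_asymptotics:
  assumes "0 < u" "u \<le> v" "v \<le> 1"
  shows "\<bar>(\<Sum>n. (prime_weight u v (Suc n))\<^sup>2) - ln (v / u)\<bar> \<le> 4 * zeta_sum 2 + 10"
proof -
  define q where "q = ln ((u + v)\<^sup>2 / (4 * u * v)) - ln (v / u)"
  have ln4: "ln 4 = 2 * ln (2 :: real)" using ln_realpow[of 2 2] by simp
  then have "q = 2 * ln ((u + v) / (2 * v))"
    using assms unfolding q_def by (simp add: ln_div ln_mult ln_realpow)
  moreover have "ln (1 / 2) \<le> ln ((u + v) / (2 * v))"
    using assms by (subst ln_le_cancel_iff) (auto simp: field_simps)
  moreover have "ln ((u + v) / (2 * v)) \<le> ln 1"
    using assms by (subst ln_le_cancel_iff) (auto simp: field_simps)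
  ultimately have q: "\<bar>q\<bar> \<le> 2" using ln_2_less_1 by (simp add: ln_div)
  from ln4 have "ln (1 / (2 * u)) - 2 * ln (1 / (u + v)) + ln (1 / (2 * v)) = ln (v / u) + q"
    using assms unfolding q_def by (simp add: ln_div ln_mult ln_realpow)
  then show ?thesis
    using prime_zeta_asymptotics[of "2 * u"] prime_zeta_asymptotics[of "u + v"] prime_zeta_asymptotics[of "2 * v"]
      sums_unique[OF prime_weight_sums[of u v]] assms q by auto
qed

lemma sums_prime_block:
  fixes g :: "nat \<Rightarrow> real"
  shows "(\<lambda>n. of_bool (Suc n \<in> prime_block u v) * g (Suc n)) sums (\<Sum>p\<in>prime_block u v. g p)"
proof -
  let ?f = "\<lambda>n. of_bool (Suc n \<in> prime_block u v) * g (Suc n)"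
  have "?f sums (\<Sum>n\<in>(\<lambda>n. n - 1) ` prime_block u v. ?f n)"
  proof (rule sums_finite)
    fix n assume "n \<notin> (\<lambda>n. n - 1) ` prime_block u v"
    then have "Suc n \<notin> prime_block u v" by force
    then show "?f n = 0" by simp
  qed simp
  also have "(\<Sum>n\<in>(\<lambda>n. n - 1) ` prime_block u v. ?f n) = (\<Sum>p\<in>prime_block u v. g p)"
  proof (rule sum.reindex_cong[where l = "\<lambda>n. n - 1"])
    show "inj_on (\<lambda>n. n - 1) (prime_block u v)"
      by (rule inj_onI) (auto simp: prime_block_def dest!: prime_gt_0_nat)
    show "?f (p - 1) = g p" if "p \<in> prime_block u v" for p
      using that prime_gt_0_nat[of p] by (auto simp: prime_block_def)
  qed simp
  finally show ?thesis .
qed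

lemma block_sum_asymptotics:
  assumes "0 < u" "u \<le> v" "v \<le> 1"
  shows "\<bar>(\<Sum>p\<in>prime_block u v. (prime_weight u v p)\<^sup>2) - ln (v / u)\<bar> \<le> 2 * block_const"
proof -
  let ?w = "\<lambda>n. (prime_weight u v (Suc n))\<^sup>2"
  let ?in = "\<lambda>n. of_bool (Suc n \<in> prime_block u v) * ?w n"
  let ?out = "\<lambda>n. of_bool (Suc n \<notin> prime_block u v) * ?w n"
  have s: "summable ?w" using assms by (intro prime_weight_summable) auto
  have si: "summable ?in" by (rule summable_comparison_test'[OF s, of 0]) auto
  have so: "summable ?out" by (rule summable_comparison_test'[OF s, of 0]) auto
  have "(\<Sum>n. ?w n) = (\<Sum>n. ?in n + ?out n)" by (intro suminf_cong) auto
  also have "\<dots> = (\<Sum>n. ?in n) + (\<Sum>n. ?out n)" by (rule suminf_add[OF si so, symmetric])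
  also have "(\<Sum>n. ?in n) = (\<Sum>p\<in>prime_block u v. (prime_weight u v p)\<^sup>2)"
    using sums_unique[OF sums_prime_block[of u v "\<lambda>p. (prime_weight u v p)\<^sup>2"]] by simp
  finally have "(\<Sum>n. ?w n) = (\<Sum>p\<in>prime_block u v. (prime_weight u v p)\<^sup>2) + (\<Sum>n. ?out n)" .
  moreover have "0 \<le> (\<Sum>n. ?out n)" by (rule suminf_nonneg[OF so]) auto
  moreover have "4 * zeta_sum 2 + 10 \<le> block_const"
    using zeta_sum_2_ge_1 by (intro order_trans[OF _ block_const_ge]) simp
  ultimately show ?thesis
    using prime_weight_total_asymptotics[OF assms] outside_block_sum_le[OF assms] by linarith
qed

text \<open>The bound has no additive constant, which tightness needs for small increments. If \<open>v > 2 u\<close>, the error \<open>O(1)\<close> of the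
  asymptotics is absorbed by \<open>log (v / u) > log 2\<close>; otherwise the quadratic bound for nearby parameters applies.\<close>

lemma prime_weight_total_le:
  assumes "0 < u" "u \<le> v" "v \<le> 1"
  shows "(\<Sum>n. (prime_weight u v (Suc n))\<^sup>2) \<le> block_const * ln (v / u)"
proof (cases "v \<le> 2 * u")
  case True
  define x where "x = (v - u) / u"
  have x: "0 \<le> x" "x \<le> 1" "v / u = 1 + x" using assms True by (auto simp: x_def field_simps)
  have ln: "x / 2 \<le> ln (1 + x)"
  proof -
    have "ln (1 / (1 + x)) \<le> 1 / (1 + x) - 1" using x by (intro ln_le_minus_one) auto
    then have "x / (1 + x) \<le> ln (1 + x)" using x by (simp add: ln_div field_simps)
    moreover have "x / 2 \<le> x / (1 + x)" using x by (intro divide_left_mono) auto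
    ultimately show ?thesis by linarith
  qed
  have s: "summable (\<lambda>n. prime_bump u (Suc n))" using assms by (auto intro!: sums_summable[OF prime_bump_sums])
  have sw: "summable (\<lambda>n. (prime_weight u v (Suc n))\<^sup>2)"
    using assms by (intro prime_weight_summable) auto
  have "(\<Sum>n. (prime_weight u v (Suc n))\<^sup>2) \<le> (\<Sum>n. x\<^sup>2 * (2 * prime_bump u (Suc n)))"
    unfolding x_def by (intro suminf_le prime_weight_near assms sw summable_mult s)
  also have "\<dots> = x\<^sup>2 * (2 * (\<Sum>n. prime_bump u (Suc n)))"
    by (simp add: suminf_mult summable_mult s)
  also have "\<dots> \<le> x * (2 * (2 * zeta_sum 2 + 5))"
  proof (intro mult_mono prime_bump_suminf_le)
    show "x\<^sup>2 \<le> x" using x by (simp add: power2_eq_square mult_left_le)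
    show "0 \<le> (\<Sum>n. prime_bump u (Suc n))"
      using assms by (intro suminf_nonneg s prime_bump_nonneg) auto
    then show "0 \<le> 2 * (\<Sum>n. prime_bump u (Suc n))"
      by simp
  qed (use assms x in auto)
  also have "\<dots> \<le> (2 * ln (1 + x)) * (2 * (2 * zeta_sum 2 + 5))"
    using ln zeta_sum_2_ge_1 by (intro mult_right_mono) auto
  also have "\<dots> = (4 * (2 * zeta_sum 2 + 5)) * ln (v / u)" by (simp add: x)
  also have "\<dots> \<le> block_const * ln (v / u)"
  proof (rule mult_right_mono)
    show "4 * (2 * zeta_sum 2 + 5) \<le> block_const" using zeta_sum_2_ge_1 by (intro order_trans[OF _ block_const_ge]) simp
    show "0 \<le> ln (v / u)" using x by simp
  qed
  finally show ?thesis .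
next
  case False
  then have "2 < v / u" using assms by (simp add: field_simps)
  then have "ln 2 \<le> ln (v / u)" by simp
  then have l: "1 / 2 \<le> ln (v / u)" using ln2_ge_two_thirds by linarith
  have "(\<Sum>n. (prime_weight u v (Suc n))\<^sup>2) \<le> ln (v / u) + (4 * zeta_sum 2 + 10) * 1"
    using prime_weight_total_asymptotics[OF assms] by (simp add: abs_le_iff)
  also have "\<dots> \<le> ln (v / u) + (4 * zeta_sum 2 + 10) * (2 * ln (v / u))"
    using l zeta_sum_2_ge_1 by (intro add_left_mono mult_left_mono) auto
  also have "\<dots> = (8 * zeta_sum 2 + 21) * ln (v / u)" by (simp add: algebra_simps)
  also have "\<dots> \<le> block_const * ln (v / u)"
  proof (rule mult_right_mono)
    show "8 * zeta_sum 2 + 21 \<le> block_const" using zeta_sum_2_ge_1 by (intro order_trans[OF _ block_const_ge]) simp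
    show "0 \<le> ln (v / u)" using l by simp
  qed
  finally show ?thesis .
qed

section \<open>Dirichlet series with controlled partial sums\<close>

lemma continuous_on_suminf_dominated:
  fixes g :: "nat \<Rightarrow> real \<Rightarrow> real"
  assumes "\<And>n. continuous_on A (g n)" "\<And>n x. x \<in> A \<Longrightarrow> \<bar>g n x\<bar> \<le> b n" "summable b"
  shows "continuous_on A (\<lambda>x. \<Sum>n. g n x)"
proof (rule uniform_limit_theorem)
  show "\<forall>\<^sub>F N in sequentially. continuous_on A (\<lambda>x. \<Sum>n<N. g n x)"
    by (intro always_eventually allI continuous_on_sum assms(1))
  show "uniform_limit A (\<lambda>N x. \<Sum>n<N. g n x) (\<lambda>x. \<Sum>n. g n x) sequentially"
    by (rule Weierstrass_m_test) (use assms in auto)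
qed auto

lemma continuous_on_halfline_locally:
  fixes g :: "real \<Rightarrow> real"
  assumes "\<And>a b. \<theta> < a \<Longrightarrow> a < b \<Longrightarrow> continuous_on {a<..<b} g"
  shows "continuous_on {\<theta><..} g"
proof (subst continuous_on_eq_continuous_at)
  show "\<forall>x\<in>{\<theta><..}. isCont g x"
  proof
    fix x assume x: "x \<in> {\<theta><..}"
    define a where "a = (\<theta> + x) / 2"
    have a: "\<theta> < a" "a < x" using x by (auto simp: a_def)
    have "continuous_on {a<..<x + 1} g" using a by (intro assms) auto
    then show "isCont g x" using a by (subst (asm) continuous_on_eq_continuous_at) auto
  qed
qed auto

context
  fixes a :: "nat \<Rightarrow> real" and C \<theta> :: real
  assumes growth: "\<And>N. N \<ge> 1 \<Longrightarrow> \<bar>\<Sum>n<N. a (Suc n)\<bar> \<le> C * real N powr \<theta>" and \<theta>: "\<theta> > 0"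
begin

text \<open>The \<open>n\<close>-th term of the series after summation by parts.\<close>

definition abel_term :: "nat \<Rightarrow> real \<Rightarrow> real" where
  "abel_term n r = (\<Sum>k<Suc n. a (Suc k)) * (1 / real (Suc n) powr r - 1 / real (Suc (Suc n)) powr r)"

lemma abel_partial:
  "(\<Sum>n<N. a (Suc n) / real (Suc n) powr r) =
    (\<Sum>n<N. a (Suc n)) / real (Suc N) powr r + (\<Sum>n<N. abel_term n r)"
proof (induction N)
  case (Suc N)
  then show ?case by (simp add: abel_term_def field_simps del: of_nat_Suc)
qed simp

lemma growth_C_nonneg: "0 \<le> C"
  using growth[of 1] by simp

lemma abel_term_bound:
  assumes "r > 0"
  shows "\<bar>abel_term n r\<bar> \<le> C * r * (1 / real (Suc n) powr (1 + r - \<theta>))"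
proof -
  let ?d = "1 / real (Suc n) powr r - 1 / real (Suc (Suc n)) powr r"
  have d: "0 \<le> ?d" using assms by (auto intro!: divide_left_mono powr_mono2)
  have d2: "?d \<le> r / real (Suc n) powr (1 + r)"
    using powr_decrement_bounds(2)[of "real (Suc n)" r] assms by (simp add: add.commute)
  have "\<bar>abel_term n r\<bar> = \<bar>\<Sum>k<Suc n. a (Suc k)\<bar> * ?d"
    unfolding abel_term_def using d by (simp only: abs_mult abs_of_nonneg)
  also have "\<dots> \<le> (C * real (Suc n) powr \<theta>) * (r / real (Suc n) powr (1 + r))"
    using growth_C_nonneg d d2 by (intro mult_mono growth) auto
  also have "\<dots> = C * r * (real (Suc n) powr \<theta> / real (Suc n) powr (1 + r))" by simp
  also have "real (Suc n) powr \<theta> / real (Suc n) powr (1 + r) = 1 / real (Suc n) powr (1 + r - \<theta>)"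
  proof -
    have "real (Suc n) powr \<theta> / real (Suc n) powr (1 + r) = real (Suc n) powr (- (1 + r - \<theta>))"
      by (simp add: powr_diff[symmetric])
    then show ?thesis by (simp only: powr_minus_divide)
  qed
  finally show ?thesis .
qed

lemma dseries_abel:
  assumes "r > \<theta>"
  shows "(\<lambda>n. a (Suc n) / real (Suc n) powr r) sums (\<Sum>n. abel_term n r)"
proof -
  have r: "r > 0" using assms \<theta> by simp
  have "summable (\<lambda>n. C * r * (1 / real (Suc n) powr (1 + r - \<theta>)))"
    using assms by (intro summable_mult summable_powr_Suc) auto
  then have "summable (\<lambda>n. abel_term n r)"
    by (rule summable_comparison_test') (use abel_term_bound[OF r] in auto)
  then have 1: "(\<lambda>N. \<Sum>n<N. abel_term n r) \<longlonglongrightarrow> (\<Sum>n. abel_term n r)" by (rule summable_LIMSEQ)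
  have 2: "(\<lambda>N. (\<Sum>n<N. a (Suc n)) / real (Suc N) powr r) \<longlonglongrightarrow> 0"
  proof (rule Lim_null_comparison)
    have "(\<lambda>N. C * real (Suc N) powr (- (r - \<theta>))) \<longlonglongrightarrow> C * 0"
      by (intro tendsto_mult tendsto_const tendsto_neg_powr filterlim_compose[OF filterlim_real_sequentially filterlim_Suc])
        (use assms in auto)
    then show "(\<lambda>N. C * real (Suc N) powr (- (r - \<theta>))) \<longlonglongrightarrow> 0" by simp
    show "\<forall>\<^sub>F N in sequentially. norm ((\<Sum>n<N. a (Suc n)) / real (Suc N) powr r) \<le> C * real (Suc N) powr (- (r - \<theta>))"
      using eventually_ge_at_top[of 1]
    proof eventually_elim
      case (elim N)
      have "norm ((\<Sum>n<N. a (Suc n)) / real (Suc N) powr r) = \<bar>\<Sum>n<N. a (Suc n)\<bar> / real (Suc N) powr r" by simp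
      also have "\<dots> \<le> (C * real (Suc N) powr \<theta>) / real (Suc N) powr r"
      proof (intro divide_right_mono order_trans[OF growth[OF elim]] mult_left_mono powr_mono2)
      qed (use \<theta> growth_C_nonneg in auto)
      also have "\<dots> = C * real (Suc N) powr (- (r - \<theta>))" by (simp add: powr_diff)
      finally show ?case .
    qed
  qed
  show ?thesis unfolding sums_def abel_partial using tendsto_add[OF 2 1] by simp
qed

text \<open>After summation by parts the series converges absolutely and locally uniformly in the exponent.\<close>

lemma dseries_continuous: "continuous_on {\<theta><..} (dseries a)"
proof (rule continuous_on_halfline_locally)
  fix l u assume l: "\<theta> < l" "l < u"
  have "continuous_on {l<..<u} (\<lambda>r. \<Sum>n. abel_term n r)"
  proof (rule continuous_on_suminf_dominated)
    show "continuous_on {l<..<u} (abel_term n)" for n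
      unfolding abel_term_def by (intro continuous_intros) auto
    show "summable (\<lambda>n. C * u * (1 / real (Suc n) powr (1 + l - \<theta>)))"
      using l by (intro summable_mult summable_powr_Suc) auto
    fix n r assume r: "r \<in> {l<..<u}"
    have "\<bar>abel_term n r\<bar> \<le> C * r * (1 / real (Suc n) powr (1 + r - \<theta>))"
      using r l \<theta> by (intro abel_term_bound) auto
    also have "\<dots> \<le> C * u * (1 / real (Suc n) powr (1 + l - \<theta>))"
      using r l \<theta> growth_C_nonneg by (intro mult_mono divide_left_mono powr_mono mult_pos_pos mult_nonneg_nonneg) auto
    finally show "\<bar>abel_term n r\<bar> \<le> C * u * (1 / real (Suc n) powr (1 + l - \<theta>))" .
  qed
  then show "continuous_on {l<..<u} (dseries a)"
    by (rule continuous_on_eq) (use l in \<open>auto simp: dseries_def sums_unique[OF dseries_abel]\<close>)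
qed

end

lemma zeta_sum_continuous: "continuous_on {1<..} zeta_sum"
  by (rule dseries_continuous[where C = 1]) auto

section \<open>The logarithm of an Euler product of signs\<close>

text \<open>The derivative of the left-hand side without absolute value is \<open>z\<^sup>2 / (1 + z)\<close>, and \<open>1 + z \<ge> 1/4\<close>. The range \<open>3/4\<close> is
  chosen to include \<open>2\<^sup>-\<^sup>1\<^sup>/\<^sup>2\<close>, a bound for the terms of the Euler products below.\<close>

lemma ln_one_plus_cubic:
  fixes x :: real
  assumes "\<bar>x\<bar> \<le> 3 / 4"
  shows "\<bar>ln (1 + x) - x + x\<^sup>2 / 2\<bar> \<le> 4 * \<bar>x\<bar> ^ 3"
proof (cases "x = 0")
  case False
  let ?h = "\<lambda>x::real. ln (1 + x) - x + x\<^sup>2 / 2"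
  let ?h' = "\<lambda>x::real. 1 / (1 + x) - 1 + x"
  have deriv: "(?h has_real_derivative ?h' z) (at z)" if "- 1 < z" for z
    using that by (auto intro!: derivative_eq_intros)
  have "\<exists>z. \<bar>z\<bar> \<le> \<bar>x\<bar> \<and> ?h x = x * ?h' z"
  proof (cases "x > 0")
    case True
    then have "\<exists>z>0. z < x \<and> ?h x - ?h 0 = (x - 0) * ?h' z"
      by (intro MVT2 deriv) auto
    then obtain z where "0 < z" "z < x" "?h x - ?h 0 = (x - 0) * ?h' z" by blast
    then show ?thesis by (intro exI[of _ z]) auto
  next
    case F: False
    then have "\<exists>z>x. z < 0 \<and> ?h 0 - ?h x = (0 - x) * ?h' z"
      using assms False by (intro MVT2 deriv) auto
    then obtain z where "x < z" "z < 0" "?h 0 - ?h x = (0 - x) * ?h' z" by blast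
    then show ?thesis by (intro exI[of _ z]) auto
  qed
  then obtain z where z: "\<bar>z\<bar> \<le> \<bar>x\<bar>" "?h x = x * ?h' z" by blast
  have z1: "1 / 4 \<le> 1 + z" using z assms by linarith
  have "?h' z = z\<^sup>2 / (1 + z)" using z1 by (simp add: field_simps power2_eq_square)
  also have "\<bar>\<dots>\<bar> \<le> z\<^sup>2 / (1 / 4)"
    using z1 by (simp add: abs_divide) (intro divide_left_mono[of "1/4" "1 + z" "z\<^sup>2", simplified], auto)
  also have "\<dots> \<le> 4 * \<bar>x\<bar>\<^sup>2" using power_mono[OF z(1), of 2] by simp
  finally have "\<bar>?h x\<bar> \<le> \<bar>x\<bar> * (4 * \<bar>x\<bar>\<^sup>2)"
    unfolding z(2) abs_mult by (intro mult_left_mono) auto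
  then show ?thesis by (simp add: power3_eq_cube power2_eq_square mult_ac)
qed simp

definition prime_part :: "(nat \<Rightarrow> real) \<Rightarrow> nat \<Rightarrow> real" where
  "prime_part a n = of_bool (prime n) * a n"

definition euler_log :: "(nat \<Rightarrow> real) \<Rightarrow> real \<Rightarrow> real" where
  "euler_log a r = (\<Sum>n. ln (1 + prime_part a (Suc n) / real (Suc n) powr r))"

text \<open>Square-root cancellation of the partial sums up to arbitrarily small powers.\<close>

definition subpolynomial_growth :: "(nat \<Rightarrow> real) \<Rightarrow> bool" where
  "subpolynomial_growth a \<longleftrightarrow>
    (\<forall>\<delta>>0. \<exists>C. \<forall>N\<ge>1. \<bar>\<Sum>n<N. a (Suc n)\<bar> \<le> C * real N powr (1 / 2 + \<delta>))"

lemma growth_dseries_sums: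
  assumes "subpolynomial_growth a" "u > 0"
  shows "(\<lambda>n. a (Suc n) / real (Suc n) powr (1 / 2 + u)) sums dseries a (1 / 2 + u)"
proof -
  obtain C where C: "\<And>N. N \<ge> 1 \<Longrightarrow> \<bar>\<Sum>n<N. a (Suc n)\<bar> \<le> C * real N powr (1 / 2 + u / 2)"
    using assms unfolding subpolynomial_growth_def by (metis half_gt_zero)
  have "(\<lambda>n. a (Suc n) / real (Suc n) powr (1 / 2 + u)) sums (\<Sum>n. abel_term a n (1 / 2 + u))"
    by (rule dseries_abel[OF C]) (use assms in auto)
  then show ?thesis unfolding dseries_def by (simp add: sums_iff)
qed

lemma growth_dseries_continuous:
  assumes "subpolynomial_growth a"
  shows "continuous_on {0<..} (\<lambda>u. dseries a (1 / 2 + u))"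
proof (rule continuous_on_halfline_locally)
  fix l b :: real assume l: "0 < l"
  obtain C where C: "\<And>N. N \<ge> 1 \<Longrightarrow> \<bar>\<Sum>n<N. a (Suc n)\<bar> \<le> C * real N powr (1 / 2 + l)"
    using assms l unfolding subpolynomial_growth_def by metis
  have "continuous_on {1 / 2 + l<..} (dseries a)"
    by (rule dseries_continuous[OF C]) (use l in auto)
  then show "continuous_on {l<..<b} (\<lambda>u. dseries a (1 / 2 + u))"
    by (rule continuous_on_compose2) (auto intro!: continuous_intros)
qed

context
  fixes a :: "nat \<Rightarrow> real"
  assumes sign: "\<And>p. prime p \<Longrightarrow> a p = 1 \<or> a p = - 1"
begin

abbreviation euler_term :: "real \<Rightarrow> nat \<Rightarrow> real" where
  "euler_term u n \<equiv> prime_part a (Suc n) / real (Suc n) powr (1 / 2 + u)"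

lemma euler_term_square: "(euler_term u n)\<^sup>2 = of_bool (prime (Suc n)) / real (Suc n) powr (1 + 2 * u)"
proof (cases "prime (Suc n)")
  case True
  have "(real (Suc n) powr (1 / 2 + u))\<^sup>2 = real (Suc n) powr (1 + 2 * u)"
    by (simp add: power2_eq_square flip: powr_add)
  then show ?thesis using True sign[OF True] by (auto simp: prime_part_def power_divide)
qed (simp add: prime_part_def)

lemma euler_term_small:
  assumes "u > 0"
  shows "\<bar>euler_term u n\<bar> \<le> 3 / 4"
proof -
  have "(euler_term u n)\<^sup>2 \<le> (3 / 4)\<^sup>2"
  proof (cases "prime (Suc n)")
    case True
    have n: "real (Suc n) \<ge> 2" using prime_ge_2_nat[OF True] by linarith
    have "2 \<le> real (Suc n) powr 1" using n by simp
    also have "\<dots> \<le> real (Suc n) powr (1 + 2 * u)" using n assms by (intro powr_mono) auto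
    finally have "1 / real (Suc n) powr (1 + 2 * u) \<le> 1 / 2" by (intro divide_left_mono) auto
    also have "1 / 2 \<le> (3 / 4 :: real)\<^sup>2" by (simp add: power2_eq_square)
    finally show ?thesis unfolding euler_term_square using True by (simp only: of_bool_eq)
  qed (simp add: prime_part_def)
  then have "\<bar>euler_term u n\<bar>\<^sup>2 \<le> (3 / 4)\<^sup>2" by (simp only: power2_abs)
  then show ?thesis by (rule power2_le_imp_le) simp
qed

lemma euler_term_cube:
  assumes "u > 0"
  shows "\<bar>euler_term u n\<bar> ^ 3 \<le> 1 / real (Suc n) powr (3 / 2)"
proof -
  have "\<bar>euler_term u n\<bar> \<le> 1 / real (Suc n) powr (1 / 2)"
  proof (cases "prime (Suc n)")
    case True
    have "\<bar>euler_term u n\<bar> = 1 / real (Suc n) powr (1 / 2 + u)"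
      using sign[OF True] True by (auto simp: prime_part_def)
    also have "\<dots> \<le> 1 / real (Suc n) powr (1 / 2)"
      using assms by (intro divide_left_mono powr_mono) auto
    finally show ?thesis .
  qed (simp add: prime_part_def)
  then have "\<bar>euler_term u n\<bar> ^ 3 \<le> (1 / real (Suc n) powr (1 / 2)) ^ 3" by (intro power_mono) auto
  also have "\<dots> = 1 / real (Suc n) powr (3 / 2)"
    by (simp add: power_divide powr_powr flip: powr_realpow)
  finally show ?thesis .
qed

lemma euler_log_term_bound:
  assumes "u > 0"
  shows "\<bar>ln (1 + euler_term u n) - euler_term u n\<bar> \<le> 4 * (1 / real (Suc n) powr (1 + 2 * u))"
proof -
  let ?x = "euler_term u n"
  have "\<bar>?x\<bar> ^ 3 \<le> 3 / 4 * ?x\<^sup>2"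
    using mult_right_mono[OF euler_term_small[OF assms, of n], of "?x\<^sup>2"]
    by (simp add: power3_eq_cube power2_eq_square mult.assoc)
  moreover have "\<bar>ln (1 + ?x) - ?x + ?x\<^sup>2 / 2\<bar> \<le> 4 * \<bar>?x\<bar> ^ 3" by (rule ln_one_plus_cubic[OF euler_term_small[OF assms]])
  moreover have "0 \<le> ?x\<^sup>2" by simp
  ultimately have "\<bar>ln (1 + ?x) - ?x\<bar> \<le> 4 * ?x\<^sup>2" unfolding abs_le_iff by linarith
  also have "?x\<^sup>2 \<le> 1 / real (Suc n) powr (1 + 2 * u)" unfolding euler_term_square by simp
  finally show ?thesis by simp
qed

lemma euler_term_gt: "u > 0 \<Longrightarrow> 0 < 1 + euler_term u n"
  using euler_term_small[of u n] by linarith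

context
  assumes growth: "subpolynomial_growth (prime_part a)"
begin

lemma euler_log_sums:
  assumes u: "u > 0"
  shows "(\<lambda>n. ln (1 + euler_term u n)) sums euler_log a (1 / 2 + u)"
    and "(\<lambda>n. ln (1 + euler_term u n) - euler_term u n) sums (euler_log a (1 / 2 + u) - dseries (prime_part a) (1 / 2 + u))"
proof -
  have s: "summable (\<lambda>n. 4 * (1 / real (Suc n) powr (1 + 2 * u)))"
    using u by (intro summable_mult summable_powr_Suc) auto
  have "summable (\<lambda>n. ln (1 + euler_term u n) - euler_term u n)"
    by (rule summable_comparison_test'[OF s]) (use euler_log_term_bound[OF u] in auto)
  from summable_add[OF this sums_summable[OF growth_dseries_sums[OF growth u]]]
  have "summable (\<lambda>n. ln (1 + euler_term u n))" by simp
  then show 1: "(\<lambda>n. ln (1 + euler_term u n)) sums euler_log a (1 / 2 + u)"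
    unfolding euler_log_def by (rule summable_sums)
  show "(\<lambda>n. ln (1 + euler_term u n) - euler_term u n) sums (euler_log a (1 / 2 + u) - dseries (prime_part a) (1 / 2 + u))"
    by (intro sums_diff 1 growth_dseries_sums growth u)
qed

lemma euler_log_continuous: "continuous_on {0<..} (\<lambda>u. euler_log a (1 / 2 + u))"
proof -
  have "continuous_on {0<..} (\<lambda>u. \<Sum>n. ln (1 + euler_term u n) - euler_term u n)"
  proof (rule continuous_on_halfline_locally, rule continuous_on_suminf_dominated)
    fix l b :: real assume l: "0 < l" "l < b"
    show "continuous_on {l<..<b} (\<lambda>u. ln (1 + euler_term u n) - euler_term u n)" for n
    proof -
      have "1 + euler_term u n \<noteq> 0" if "u \<in> {l<..<b}" for u
        using euler_term_gt[of u n] that l by (simp del: of_nat_Suc)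
      then have "continuous_on {l<..<b} (\<lambda>u. ln (1 + euler_term u n))"
        by (intro continuous_on_ln continuous_intros ballI) (auto simp del: of_nat_Suc)
      then show ?thesis by (rule continuous_on_diff) (intro continuous_intros, auto)
    qed
    show "summable (\<lambda>n. 4 * (1 / real (Suc n) powr (1 + 2 * l)))"
      using l by (intro summable_mult summable_powr_Suc) auto
    fix n u assume u: "u \<in> {l<..<b}"
    then have "\<bar>ln (1 + euler_term u n) - euler_term u n\<bar> \<le> 4 * (1 / real (Suc n) powr (1 + 2 * u))"
      using l by (intro euler_log_term_bound) auto
    also have "\<dots> \<le> 4 * (1 / real (Suc n) powr (1 + 2 * l))"
      using u by (intro mult_left_mono divide_left_mono powr_mono) auto
    finally show "\<bar>ln (1 + euler_term u n) - euler_term u n\<bar> \<le> 4 * (1 / real (Suc n) powr (1 + 2 * l))" .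
  qed
  then have "continuous_on {0<..} (\<lambda>u. dseries (prime_part a) (1 / 2 + u) + (\<Sum>n. ln (1 + euler_term u n) - euler_term u n))"
    by (intro continuous_on_add growth_dseries_continuous growth)
  then show ?thesis
  proof (rule continuous_on_eq)
    show "dseries (prime_part a) (1 / 2 + u) + (\<Sum>n. ln (1 + euler_term u n) - euler_term u n) = euler_log a (1 / 2 + u)"
      if "u \<in> {0<..}" for u
      using sums_unique[OF euler_log_sums(2)[of u]] that by (simp del: of_nat_Suc)
  qed
qed

text \<open>The quadratic terms \<open>f(p)\<^sup>2 p\<^sup>-\<^sup>1\<^sup>-\<^sup>2\<^sup>u = p\<^sup>-\<^sup>1\<^sup>-\<^sup>2\<^sup>u\<close> of the logarithm do not depend on the signs, and the cubic ones are at most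
  \<open>p\<^sup>-\<^sup>3\<^sup>/\<^sup>2\<close> in modulus, hence summable uniformly in \<open>u\<close>.\<close>

lemma euler_log_expansion:
  assumes u: "u > 0"
  shows "\<bar>euler_log a (1 / 2 + u) - dseries (prime_part a) (1 / 2 + u) + prime_zeta (1 + 2 * u) / 2\<bar> \<le> 4 * zeta_sum (3 / 2)"
proof -
  have "(\<lambda>n. ln (1 + euler_term u n) - euler_term u n + (euler_term u n)\<^sup>2 / 2) sums
     (euler_log a (1 / 2 + u) - dseries (prime_part a) (1 / 2 + u) + prime_zeta (1 + 2 * u) / 2)"
    unfolding euler_term_square using u by (intro sums_add sums_divide euler_log_sums prime_zeta_sums) auto
  note s = this
  have b: "norm (ln (1 + euler_term u n) - euler_term u n + (euler_term u n)\<^sup>2 / 2) \<le> 4 * (1 / real (Suc n) powr (3 / 2))" for n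
    using ln_one_plus_cubic[OF euler_term_small[OF u], of n] euler_term_cube[OF u, of n] by simp
  have sb: "summable (\<lambda>n. 4 * (1 / real (Suc n) powr (3 / 2)))" by (intro summable_mult summable_powr_Suc) auto
  have "norm (\<Sum>n. ln (1 + euler_term u n) - euler_term u n + (euler_term u n)\<^sup>2 / 2) \<le> (\<Sum>n. 4 * (1 / real (Suc n) powr (3 / 2)))"
    by (rule norm_suminf_le[OF b sb])
  also have "\<dots> = 4 * zeta_sum (3 / 2)"
    unfolding dseries_def by (intro suminf_mult summable_powr_Suc) auto
  finally show ?thesis using sums_unique[OF s] by simp
qed

lemma euler_product_tendsto:
  assumes u: "u > 0"
  shows "(\<lambda>N. \<Prod>p\<in>primes_upto N. 1 + a p / real p powr (1 / 2 + u)) \<longlonglongrightarrow> exp (euler_log a (1 / 2 + u))"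
proof -
  have "(\<lambda>N. exp (\<Sum>n<N. ln (1 + euler_term u n))) \<longlonglongrightarrow> exp (euler_log a (1 / 2 + u))"
    using euler_log_sums(1)[OF u] unfolding sums_def by (rule tendsto_exp)
  moreover have "exp (\<Sum>n<N. ln (1 + euler_term u n)) = (\<Prod>p\<in>primes_upto N. 1 + a p / real p powr (1 / 2 + u))" for N
  proof -
    have "(\<Sum>n<N. ln (1 + euler_term u n)) = (\<Sum>n<N. of_bool (prime (Suc n)) * ln (1 + prime_part a (Suc n) / real (Suc n) powr (1 / 2 + u)))"
      by (intro sum.cong) (auto simp: prime_part_def)
    also have "\<dots> = (\<Sum>p\<in>primes_upto N. ln (1 + prime_part a p / real p powr (1 / 2 + u)))"
      by (rule sum_primes_upto)
    also have "exp \<dots> = (\<Prod>p\<in>primes_upto N. exp (ln (1 + prime_part a p / real p powr (1 / 2 + u))))"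
      by (rule exp_sum) simp
    also have "\<dots> = (\<Prod>p\<in>primes_upto N. 1 + a p / real p powr (1 / 2 + u))"
    proof (rule prod.cong)
      fix p assume p: "p \<in> primes_upto N"
      then have "Suc (p - 1) = p" using prime_gt_0_nat[of p] by (auto simp: primes_upto_def)
      then have "0 < 1 + prime_part a p / real p powr (1 / 2 + u)" using euler_term_gt[OF u, of "p - 1"] by simp
      then show "exp (ln (1 + prime_part a p / real p powr (1 / 2 + u))) = 1 + a p / real p powr (1 / 2 + u)"
        using p by (simp add: prime_part_def primes_upto_def)
    qed simp
    finally show ?thesis .
  qed
  ultimately show ?thesis by simp
qed

end

end

section \<open>Partial sums of orthogonal random variables\<close>

text \<open>The squares of the sums over the left halves of all dyadic subintervals of \<open>{m..<m + 2 ^ k}\<close>, together with the squares of the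
  single terms.\<close>

fun dyadic_energy :: "(nat \<Rightarrow> real) \<Rightarrow> nat \<Rightarrow> nat \<Rightarrow> real" where
  "dyadic_energy x 0 m = (x m)\<^sup>2"
| "dyadic_energy x (Suc k) m =
    (\<Sum>i\<in>{m..<m + 2 ^ k}. x i)\<^sup>2 + dyadic_energy x k m + dyadic_energy x k (m + 2 ^ k)"

lemma dyadic_energy_nonneg: "0 \<le> dyadic_energy x k m"
  by (induction k arbitrary: m) auto

lemma weighted_square_sum:
  fixes a b :: real and k :: nat
  shows "(a + b)\<^sup>2 \<le> (real k + 2) * (a\<^sup>2 + b\<^sup>2 / (real k + 1))"
proof -
  have "(real k + 2) * (a\<^sup>2 + b\<^sup>2 / (real k + 1)) - (a + b)\<^sup>2 = ((real k + 1) * a - b)\<^sup>2 / (real k + 1)"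
    by (simp add: field_simps power2_eq_square)
  also have "\<dots> \<ge> 0" by simp
  finally show ?thesis by simp
qed

text \<open>By the binary expansion of \<open>r\<close>, a partial sum is a sum of at most \<open>k + 1\<close> of the dyadic sums counted in the energy.
  The weights in \<open>weighted_square_sum\<close> are those that make the factor grow from \<open>k + 1\<close> to \<open>k + 2\<close>.\<close>

lemma partial_sum_le_dyadic_energy:
  assumes "r \<le> 2 ^ k"
  shows "(\<Sum>i\<in>{m..<m + r}. x i)\<^sup>2 \<le> (real k + 1) * dyadic_energy x k m"
  using assms
proof (induction k arbitrary: m r)
  case 0
  then have "r = 0 \<or> r = 1" by auto
  then show ?case by auto
next
  case (Suc k)
  let ?S = "\<lambda>m r. \<Sum>i\<in>{m..<m + r}. x i"
  show ?case
  proof (cases "r \<le> 2 ^ k")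
    case True
    have "(?S m r)\<^sup>2 \<le> (real k + 1) * dyadic_energy x k m" by (rule Suc.IH[OF True])
    also have "\<dots> \<le> (real (Suc k) + 1) * dyadic_energy x (Suc k) m"
      by (intro mult_mono) (auto simp: dyadic_energy_nonneg)
    finally show ?thesis .
  next
    case False
    define r' where "r' = r - 2 ^ k"
    have r': "r' \<le> 2 ^ k" "r = 2 ^ k + r'" using False Suc.prems by (auto simp: r'_def)
    have "?S m r = ?S m (2 ^ k) + ?S (m + 2 ^ k) r'"
      unfolding r'(2) by (subst sum.atLeastLessThan_concat[symmetric, of m "m + 2 ^ k"]) (auto simp: add.assoc)
    then have "(?S m r)\<^sup>2 \<le> (real k + 2) * ((?S m (2 ^ k))\<^sup>2 + (?S (m + 2 ^ k) r')\<^sup>2 / (real k + 1))"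
      using weighted_square_sum by simp
    also have "\<dots> \<le> (real k + 2) * ((?S m (2 ^ k))\<^sup>2 + dyadic_energy x k (m + 2 ^ k))"
      using Suc.IH[OF r'(1), of "m + 2 ^ k"]
      by (intro mult_left_mono add_left_mono) (auto simp: pos_divide_le_eq mult.commute)
    also have "\<dots> \<le> (real k + 2) * dyadic_energy x (Suc k) m"
      by (intro mult_left_mono) (auto simp: dyadic_energy_nonneg)
    finally show ?thesis by (simp add: add.commute)
  qed
qed

lemma power_two_between:
  assumes "N \<ge> (1::nat)"
  obtains k where "N \<le> 2 ^ k" "2 ^ k \<le> 2 * N"
proof (cases "N = 1")
  case True
  then show ?thesis using that[of 0] by simp
next
  case False
  then obtain n where "2 ^ n < N" "N \<le> 2 ^ (n + 1)" using ex_power_ivl2[of 2 N] assms by auto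
  then show ?thesis using that[of "Suc n"] by simp
qed

context prob_space
begin

lemma integrable_AE_bounded:
  fixes X :: "'a \<Rightarrow> real"
  assumes "X \<in> borel_measurable M" "AE w in M. \<bar>X w\<bar> \<le> C"
  shows "integrable M X"
  by (rule integrable_const_bound[where B = C]) (use assms in auto)

context
  fixes X :: "'i \<Rightarrow> 'a \<Rightarrow> real"
  assumes rv [measurable]: "\<And>i. X i \<in> borel_measurable M"
    and bounded: "\<And>i. AE w in M. \<bar>X i w\<bar> \<le> 1"
    and orthogonal: "\<And>i j. i \<noteq> j \<Longrightarrow> expectation (\<lambda>w. X i w * X j w) = 0"
begin

lemma integrable_product: "integrable M (\<lambda>w. X i w * X j w)"
proof (rule integrable_AE_bounded[where C = 1])
  show "AE w in M. \<bar>X i w * X j w\<bar> \<le> 1"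
    using bounded[of i] bounded[of j] by eventually_elim (simp add: abs_mult mult_le_one)
qed measurable

lemma expectation_square_le_1: "expectation (\<lambda>w. (X i w)\<^sup>2) \<le> 1"
proof -
  have "expectation (\<lambda>w. X i w * X i w) \<le> expectation (\<lambda>_. 1)"
  proof (rule integral_mono_AE[OF integrable_product])
    show "AE w in M. X i w * X i w \<le> 1"
      using bounded[of i] by eventually_elim (simp add: abs_square_le_1[unfolded power2_eq_square])
  qed simp
  then show ?thesis by (simp add: prob_space power2_eq_square)
qed

lemma square_sum_expand:
  "(\<Sum>i\<in>I. c i * X i w)\<^sup>2 = (\<Sum>i\<in>I. \<Sum>j\<in>I. c i * c j * (X i w * X j w))"
  by (simp add: power2_eq_square sum_product mult_ac)

lemma integrable_square_sum: "integrable M (\<lambda>w. (\<Sum>i\<in>I. c i * X i w)\<^sup>2)"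
  unfolding square_sum_expand by (intro Bochner_Integration.integrable_sum integrable_mult_right integrable_product)

lemma orthogonal_sum_variance:
  assumes "finite I"
  shows "expectation (\<lambda>w. (\<Sum>i\<in>I. c i * X i w)\<^sup>2) \<le> (\<Sum>i\<in>I. (c i)\<^sup>2)"
proof -
  have "expectation (\<lambda>w. (\<Sum>i\<in>I. c i * X i w)\<^sup>2) = (\<Sum>i\<in>I. \<Sum>j\<in>I. c i * c j * expectation (\<lambda>w. X i w * X j w))"
    unfolding square_sum_expand
    by (subst Bochner_Integration.integral_sum, intro Bochner_Integration.integrable_sum integrable_mult_right integrable_product,
        subst Bochner_Integration.integral_sum, intro integrable_mult_right integrable_product) simp
  also have "\<dots> = (\<Sum>i\<in>I. \<Sum>j\<in>I. if i = j then (c i)\<^sup>2 * expectation (\<lambda>w. (X i w)\<^sup>2) else 0)"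
    by (intro sum.cong refl) (auto simp: orthogonal power2_eq_square)
  also have "\<dots> = (\<Sum>i\<in>I. (c i)\<^sup>2 * expectation (\<lambda>w. (X i w)\<^sup>2))" using assms by simp
  also have "\<dots> \<le> (\<Sum>i\<in>I. (c i)\<^sup>2 * 1)"
    by (intro sum_mono mult_left_mono expectation_square_le_1) auto
  finally show ?thesis by simp
qed

end

lemma dyadic_energy_expectation:
  fixes X :: "nat \<Rightarrow> 'a \<Rightarrow> real"
  assumes rv: "\<And>i. X i \<in> borel_measurable M"
    and bounded: "\<And>i. AE w in M. \<bar>X i w\<bar> \<le> 1"
    and orthogonal: "\<And>i j. i \<noteq> j \<Longrightarrow> expectation (\<lambda>w. X i w * X j w) = 0"
  shows "integrable M (\<lambda>w. dyadic_energy (\<lambda>i. X i w) k m)"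
    and "expectation (\<lambda>w. dyadic_energy (\<lambda>i. X i w) k m) \<le> (real k + 1) * 2 ^ k"
proof -
  note int = integrable_square_sum[where X = X, OF assms, where c = "\<lambda>_. 1", simplified]
  note var = orthogonal_sum_variance[where X = X, OF assms, where c = "\<lambda>_. 1", simplified]
  have "integrable M (\<lambda>w. dyadic_energy (\<lambda>i. X i w) k m) \<and>
    expectation (\<lambda>w. dyadic_energy (\<lambda>i. X i w) k m) \<le> (real k + 1) * 2 ^ k"
  proof (induction k arbitrary: m)
    case 0
    then show ?case using int[where I = "{m}"] expectation_square_le_1[where X = X and i = m, OF assms] by simp
  next
    case (Suc k)
    have i: "integrable M (\<lambda>w. dyadic_energy (\<lambda>i. X i w) k m)" for m using Suc by blast
    have e: "expectation (\<lambda>w. dyadic_energy (\<lambda>i. X i w) k m) \<le> (real k + 1) * 2 ^ k" for m using Suc by blast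
    let ?S = "\<lambda>w. (\<Sum>i\<in>{m..<m + 2 ^ k}. X i w)\<^sup>2"
    have S: "integrable M ?S" "expectation ?S \<le> 2 ^ k"
      using int[where I = "{m..<m + 2 ^ k}"] var[where I = "{m..<m + 2 ^ k}"] by simp_all
    have "expectation (\<lambda>w. dyadic_energy (\<lambda>i. X i w) (Suc k) m) = expectation ?S +
        expectation (\<lambda>w. dyadic_energy (\<lambda>i. X i w) k m) + expectation (\<lambda>w. dyadic_energy (\<lambda>i. X i w) k (m + 2 ^ k))"
      using S(1) i by simp
    also have "\<dots> \<le> 2 ^ k + (real k + 1) * 2 ^ k + (real k + 1) * 2 ^ k"
      by (intro add_mono S(2) e)
    also have "\<dots> \<le> (real (Suc k) + 1) * 2 ^ Suc k" by (simp add: algebra_simps)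
    finally show ?case using S(1) i by simp
  qed
  then show "integrable M (\<lambda>w. dyadic_energy (\<lambda>i. X i w) k m)"
    "expectation (\<lambda>w. dyadic_energy (\<lambda>i. X i w) k m) \<le> (real k + 1) * 2 ^ k" by auto
qed

text \<open>The energy of level \<open>k\<close>, times \<open>k + 1\<close>, bounds the squares of all partial sums up to \<open>2\<^sup>k\<close> at once and has mean at most
  \<open>(k + 1)\<^sup>2 2\<^sup>k\<close>. Divided by
  \<open>2\<^sup>k\<^sup>(\<^sup>1\<^sup>+\<^sup>2\<^sup>\<delta>\<^sup>)\<close> these bounds are summable in mean, hence almost surely bounded.\<close>

lemma orthogonal_partial_sums_growth:
  fixes X :: "nat \<Rightarrow> 'a \<Rightarrow> real"
  assumes rv [measurable]: "\<And>i. X i \<in> borel_measurable M"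
    and bounded: "\<And>i. AE w in M. \<bar>X i w\<bar> \<le> 1"
    and orthogonal: "\<And>i j. i \<noteq> j \<Longrightarrow> expectation (\<lambda>w. X i w * X j w) = 0"
    and \<delta>: "\<delta> > 0"
  shows "AE w in M. \<exists>C. \<forall>N\<ge>1. \<bar>\<Sum>n<N. X n w\<bar> \<le> C * real N powr (1 / 2 + \<delta>)"
proof -
  \<comment> \<open>the bound for all squared partial sums up to \<open>2\<^sup>k\<close>, divided by the square of the claimed rate\<close>
  define e where "e k w = (real k + 1) * dyadic_energy (\<lambda>i. X i w) k 0 / 2 powr (real k * (1 + 2 * \<delta>))" for k :: nat and w
  have energy_meas [measurable]: "(\<lambda>w. dyadic_energy (\<lambda>i. X i w) k m) \<in> borel_measurable M" for k m
    using dyadic_energy_expectation(1)[OF rv bounded orthogonal] by auto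
  have [measurable]: "e k \<in> borel_measurable M" for k unfolding e_def by measurable
  have e_nonneg: "0 \<le> e k w" for k w unfolding e_def by (simp add: dyadic_energy_nonneg)
  have ie: "integrable M (e k)" for k
    unfolding e_def by (intro integrable_divide integrable_mult_right dyadic_energy_expectation(1)[OF rv bounded orthogonal])
  have Ee: "expectation (e k) \<le> (real k + 1)\<^sup>2 * (2 powr (- 2 * \<delta>)) ^ k" for k
  proof -
    have "expectation (e k) = (real k + 1) * expectation (\<lambda>w. dyadic_energy (\<lambda>i. X i w) k 0) / 2 powr (real k * (1 + 2 * \<delta>))"
      unfolding e_def by simp
    also have "\<dots> \<le> (real k + 1) * ((real k + 1) * 2 ^ k) / 2 powr (real k * (1 + 2 * \<delta>))"
      by (intro divide_right_mono mult_left_mono dyadic_energy_expectation(2)[OF rv bounded orthogonal]) auto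
    also have "\<dots> = (real k + 1)\<^sup>2 * (2 powr real k / 2 powr (real k * (1 + 2 * \<delta>)))"
      by (simp add: power2_eq_square powr_realpow)
    also have "2 powr real k / 2 powr (real k * (1 + 2 * \<delta>)) = 2 powr (- 2 * \<delta> * real k)"
      by (simp add: powr_diff[symmetric] algebra_simps)
    also have "\<dots> = (2 powr (- 2 * \<delta>)) ^ k" by (simp add: powr_powr flip: powr_realpow)
    finally show ?thesis .
  qed
  have q: "0 < 2 powr (- 2 * \<delta>)" "2 powr (- 2 * \<delta>) < 1" using \<delta> by (auto simp: powr_less_one)
  have "summable (\<lambda>k. (real k + 1)\<^sup>2 * (2 powr (- 2 * \<delta>)) ^ k)"
  proof -
    define c where "c = - ln (2 powr (- 2 * \<delta>))"
    have c: "c > 0" using \<delta> unfolding c_def by simp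
    have "(2 powr (- 2 * \<delta>)) ^ k = exp (- c * real k)" for k
      using q unfolding c_def by (simp add: exp_of_nat2_mult[symmetric] powr_def mult.commute)
    moreover have "summable (\<lambda>k. (real k + 1)\<^sup>2 * exp (- c * real k))"
    proof (rule summable_comparison_test_bigo)
      show "summable (\<lambda>k. norm (1 / real k ^ 2))"
        using inverse_power_summable[of 2, where 'a = real] by (simp add: inverse_eq_divide)
      show "(\<lambda>k. (real k + 1)\<^sup>2 * exp (- c * real k)) \<in> O(\<lambda>k. 1 / real k ^ 2)"
        using c by real_asymp
    qed
    ultimately show ?thesis by simp
  qed
  note sq = this
  have E0: "0 \<le> expectation (e k)" for k by (rule Bochner_Integration.integral_nonneg) (rule e_nonneg)
  have "summable (\<lambda>k. expectation (e k))"
  proof (rule summable_comparison_test'[OF sq])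
    show "norm (expectation (e k)) \<le> (real k + 1)\<^sup>2 * (2 powr (- 2 * \<delta>)) ^ k" for k
      using Ee[of k] E0[of k] by (simp only: real_norm_def abs_of_nonneg)
  qed
  from ennreal_suminf_neq_top[OF this E0] have fin: "(\<Sum>k. ennreal (expectation (e k))) \<noteq> \<infinity>"
    by (simp only: infinity_ennreal_def not_False_eq_True)
  have "(\<integral>\<^sup>+w. (\<Sum>k. ennreal (e k w)) \<partial>M) = (\<Sum>k. ennreal (expectation (e k)))"
    by (simp add: nn_integral_suminf nn_integral_eq_integral[OF ie] e_nonneg)
  then have "AE w in M. (\<Sum>k. ennreal (e k w)) \<noteq> \<infinity>"
    using fin by (intro nn_integral_PInf_AE) auto
  then show ?thesis
  proof eventually_elim
    case (elim w)
    then obtain B where B: "(\<Sum>k. ennreal (e k w)) = ennreal B" "B \<ge> 0"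
      by (metis ennreal_cases infinity_ennreal_def)
    have eB: "e k w \<le> B" for k
    proof -
      have "ennreal (e k w) \<le> (\<Sum>k. ennreal (e k w))"
        using sum_le_suminf[of "\<lambda>k. ennreal (e k w)" "{k}"] by simp
      then show ?thesis using B by simp
    qed
    show ?case
    proof (intro exI[of _ "sqrt (B * 2 powr (1 + 2 * \<delta>))"] allI impI)
      fix N :: nat assume N: "N \<ge> 1"
      obtain k where k: "N \<le> 2 ^ k" "2 ^ k \<le> 2 * N" using power_two_between[OF N] .
      have "(\<Sum>n<N. X n w)\<^sup>2 \<le> (real k + 1) * dyadic_energy (\<lambda>i. X i w) k 0"
        using partial_sum_le_dyadic_energy[OF k(1), where m = 0 and x = "\<lambda>i. X i w"] by (simp add: lessThan_atLeast0)
      also have "\<dots> = e k w * 2 powr (real k * (1 + 2 * \<delta>))" by (simp add: e_def)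
      also have "\<dots> \<le> B * 2 powr (real k * (1 + 2 * \<delta>))" by (intro mult_right_mono eB) auto
      also have "2 powr (real k * (1 + 2 * \<delta>)) = (2 ^ k) powr (1 + 2 * \<delta>)"
        by (simp add: powr_powr[symmetric] powr_realpow)
      also have "B * (2 ^ k) powr (1 + 2 * \<delta>) \<le> B * (2 * real N) powr (1 + 2 * \<delta>)"
      proof (intro mult_left_mono powr_mono2)
        show "2 ^ k \<le> 2 * real N" using k(2) by (metis of_nat_le_iff of_nat_mult of_nat_numeral of_nat_power)
      qed (use \<delta> B in auto)
      also have "\<dots> = B * 2 powr (1 + 2 * \<delta>) * (real N powr (1 / 2 + \<delta>))\<^sup>2"
        by (simp add: powr_mult power2_eq_square flip: powr_add)
      also have "\<dots> = (sqrt (B * 2 powr (1 + 2 * \<delta>)) * real N powr (1 / 2 + \<delta>))\<^sup>2"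
        using B(2) by (simp add: power_mult_distrib)
      finally show "\<bar>\<Sum>n<N. X n w\<bar> \<le> sqrt (B * 2 powr (1 + 2 * \<delta>)) * real N powr (1 / 2 + \<delta>)"
        by (rule abs_le_square_iff[THEN iffD2, THEN order_trans]) (use B(2) in auto)
    qed
  qed
qed

end

section \<open>The Rademacher multiplicative function and its Euler product\<close>

locale rademacher_rmf = prob_space M for M :: "'a measure" +
  fixes f :: "nat \<Rightarrow> 'a \<Rightarrow> real"
  assumes rademacher: "rademacher_multiplicative M f"
begin

lemma indep_primes: "indep_vars (\<lambda>_. borel) f {p. prime p}"
  using rademacher by (simp add: rademacher_multiplicative_def)

lemma rv_prime: "prime p \<Longrightarrow> f p \<in> borel_measurable M"
  using indep_primes by (auto simp: indep_vars_def)

lemma f_squarefree: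
  "squarefree n \<Longrightarrow> w \<in> space M \<Longrightarrow> f n w = (\<Prod>p\<in>prime_factors n. f p w)"
  using rademacher unfolding rademacher_multiplicative_def
  by (metis less_one not_le not_squarefree_0)

lemma f_not_squarefree: "n \<ge> 1 \<Longrightarrow> \<not> squarefree n \<Longrightarrow> w \<in> space M \<Longrightarrow> f n w = 0"
  using rademacher unfolding rademacher_multiplicative_def by metis

lemma rv_f: "n \<ge> 1 \<Longrightarrow> f n \<in> borel_measurable M"
proof (cases "squarefree n")
  case True
  have "(\<lambda>w. \<Prod>p\<in>prime_factors n. f p w) \<in> borel_measurable M"
    by (intro borel_measurable_prod rv_prime) auto
  then show ?thesis by (subst measurable_cong[OF f_squarefree[OF True]])
next
  case False
  assume "n \<ge> 1"
  then show ?thesis by (subst measurable_cong[OF f_not_squarefree[OF _ False]]) auto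
qed

lemma prob_sign:
  assumes "prime p"
  shows "prob {w \<in> space M. f p w = 1} = 1 / 2" "prob {w \<in> space M. f p w = - 1} = 1 / 2"
  using rademacher assms unfolding rademacher_multiplicative_def by metis+

lemma AE_prime_sign: "prime p \<Longrightarrow> AE w in M. f p w = 1 \<or> f p w = - 1"
proof -
  assume p: "prime p"
  note [measurable] = rv_prime[OF p]
  have "prob {w \<in> space M. f p w = 1 \<or> f p w = - 1} = prob ({w \<in> space M. f p w = 1} \<union> {w \<in> space M. f p w = - 1})"
    by (intro arg_cong[where f = prob]) auto
  also have "\<dots> = prob {w \<in> space M. f p w = 1} + prob {w \<in> space M. f p w = - 1}"
    by (rule finite_measure_Union) auto
  also have "\<dots> = 1" by (simp add: prob_sign[OF p])
  finally show ?thesis by (subst (asm) prob_Collect_eq_1) auto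
qed

lemma AE_all_signs: "AE w in M. \<forall>p. prime p \<longrightarrow> f p w = 1 \<or> f p w = - 1"
  by (subst AE_all_countable) (use AE_prime_sign in \<open>auto simp: AE_conj_iff intro: AE_mp\<close>)

lemma AE_f_bounded: "n \<ge> 1 \<Longrightarrow> AE w in M. \<bar>f n w\<bar> \<le> 1"
  using AE_all_signs AE_space
proof eventually_elim
  case (elim w)
  show ?case
  proof (cases "squarefree n")
    case True
    have "\<bar>f p w\<bar> = 1" if "p \<in> prime_factors n" for p using elim that by fastforce
    then show ?thesis using f_squarefree[OF True] elim by (simp add: abs_prod)
  next
    case False
    then show ?thesis using f_not_squarefree elim by simp
  qed
qed

lemma integral_sign_function:
  fixes h :: "real \<Rightarrow> 'b :: {banach, second_countable_topology}"
  assumes p: "prime p" and h: "h \<in> borel_measurable borel"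
  shows "(\<integral>w. h (f p w) \<partial>M) = (1 / 2) *\<^sub>R (h 1 + h (- 1))"
proof -
  note [measurable] = rv_prime[OF p] h
  let ?A = "\<lambda>s. {w \<in> space M. f p w = s}"
  have "(\<integral>w. h (f p w) \<partial>M) = (\<integral>w. indicator (?A 1) w *\<^sub>R h 1 + indicator (?A (- 1)) w *\<^sub>R h (- 1) \<partial>M)"
  proof (rule integral_cong_AE)
    show "AE w in M. h (f p w) = indicator (?A 1) w *\<^sub>R h 1 + indicator (?A (- 1)) w *\<^sub>R h (- 1)"
      using AE_prime_sign[OF p] AE_space by eventually_elim auto
  qed measurable
  also have "\<dots> = (\<integral>w. indicator (?A 1) w *\<^sub>R h 1 \<partial>M) + (\<integral>w. indicator (?A (- 1)) w *\<^sub>R h (- 1) \<partial>M)"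
    by (rule Bochner_Integration.integral_add) (auto intro!: integrable_scaleR_left simp: less_top[symmetric])
  also have "\<dots> = prob (?A 1) *\<^sub>R h 1 + prob (?A (- 1)) *\<^sub>R h (- 1)"
    by (subst (1 2) integral_scaleR_left) (auto simp: less_top[symmetric])
  also have "\<dots> = (1 / 2) *\<^sub>R (h 1 + h (- 1))"
    by (simp only: prob_sign[OF p] scaleR_add_right)
  finally show ?thesis .
qed

lemma expectation_prime: "prime p \<Longrightarrow> expectation (f p) = 0"
  using integral_sign_function[of p "\<lambda>x. x"] by simp

lemma integrable_prime: "prime p \<Longrightarrow> integrable M (f p)"
  using AE_f_bounded[of p] rv_prime prime_ge_1_nat by (intro integrable_AE_bounded[where C = 1]) auto

text \<open>A prime in exactly one of the two sets contributes a factor of mean zero.\<close>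

lemma expectation_product_zero:
  assumes "finite A" "finite B" "\<And>p. p \<in> A \<union> B \<Longrightarrow> prime p" "A \<noteq> B"
  shows "expectation (\<lambda>w. (\<Prod>p\<in>A. f p w) * (\<Prod>p\<in>B. f p w)) = 0"
proof -
  define g where "g p x = (if p \<in> A then x else 1) * (if p \<in> B then x else 1 :: real)" for p :: nat and x
  have gm [measurable]: "g p \<in> borel_measurable borel" for p unfolding g_def by measurable
  have ind: "indep_vars (\<lambda>_. borel) (\<lambda>p w. g p (f p w)) (A \<union> B)"
    by (rule indep_vars_compose2[OF indep_vars_subset[OF indep_primes]]) (use assms(3) in auto)
  have int: "integrable M (\<lambda>w. g p (f p w))" if p: "p \<in> A \<union> B" for p
  proof (rule integrable_AE_bounded[where C = 1])
    show "(\<lambda>w. g p (f p w)) \<in> borel_measurable M"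
      by (rule measurable_compose[OF rv_prime gm]) (use assms(3) p in auto)
    show "AE w in M. \<bar>g p (f p w)\<bar> \<le> 1"
      using AE_prime_sign[OF assms(3)[OF p]] by eventually_elim (auto simp: g_def)
  qed
  have e: "(\<Prod>p\<in>A. f p w) * (\<Prod>p\<in>B. f p w) = (\<Prod>p\<in>A \<union> B. g p (f p w))" for w
    unfolding g_def prod.distrib
    using assms(1,2) by (subst (1 2) prod.inter_restrict[symmetric]) (auto simp: Int_absorb1 Int_commute)
  have "expectation (\<lambda>w. (\<Prod>p\<in>A. f p w) * (\<Prod>p\<in>B. f p w)) = (\<Prod>p\<in>A \<union> B. expectation (\<lambda>w. g p (f p w)))"
    unfolding e by (rule indep_vars_lebesgue_integral[OF _ ind int]) (use assms in auto)
  also have "\<dots> = 0"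
  proof (subst prod_zero_iff)
    obtain p where p: "p \<in> A \<union> B" "(p \<in> A) \<noteq> (p \<in> B)" using assms(4) by blast
    then have "g p x = x" for x by (auto simp: g_def)
    then have "expectation (\<lambda>w. g p (f p w)) = 0" using expectation_prime[OF assms(3)[OF p(1)]] by simp
    then show "\<exists>p\<in>A \<union> B. expectation (\<lambda>w. g p (f p w)) = 0" using p(1) by blast
  qed (use assms in auto)
  finally show ?thesis .
qed

text \<open>Distinct square-free numbers have distinct sets of prime factors.\<close>

lemma f_orthogonal:
  assumes "n \<ge> 1" "m \<ge> 1" "n \<noteq> m"
  shows "expectation (\<lambda>w. f n w * f m w) = 0"
proof (cases "squarefree n \<and> squarefree m")
  case True
  then have "prime_factors n \<noteq> prime_factors m"
    using squarefree_eq_prod_primes assms(3) by metis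
  then have "expectation (\<lambda>w. (\<Prod>p\<in>prime_factors n. f p w) * (\<Prod>p\<in>prime_factors m. f p w)) = 0"
    by (intro expectation_product_zero) auto
  then show ?thesis
    using True by (subst Bochner_Integration.integral_cong[OF refl]) (auto simp: f_squarefree)
next
  case False
  then have "f n w * f m w = 0" if "w \<in> space M" for w using f_not_squarefree that assms by auto
  then have "expectation (\<lambda>w. f n w * f m w) = expectation (\<lambda>_. 0)"
    by (rule Bochner_Integration.integral_cong[OF refl])
  then show ?thesis by simp
qed

text \<open>With \<open>c = 1\<close> this is about the Dirichlet series of \<open>f\<close>, with the indicator of the primes about the series \<open>Y\<close>.\<close>

lemma AE_subpolynomial_growth:
  fixes c :: "nat \<Rightarrow> real"
  assumes c: "\<And>n. \<bar>c n\<bar> \<le> 1"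
  shows "AE w in M. subpolynomial_growth (\<lambda>n. c n * f n w)"
proof -
  have "AE w in M. \<exists>C. \<forall>N\<ge>1. \<bar>\<Sum>n<N. c (Suc n) * f (Suc n) w\<bar> \<le> C * real N powr (1 / 2 + 1 / real (Suc k))" for k
  proof (rule orthogonal_partial_sums_growth)
    show "(\<lambda>w. c (Suc i) * f (Suc i) w) \<in> borel_measurable M" for i
      using rv_f[of "Suc i"] by measurable
    show "AE w in M. \<bar>c (Suc i) * f (Suc i) w\<bar> \<le> 1" for i
      using AE_f_bounded[of "Suc i"] c[of "Suc i"] by (auto simp: abs_mult mult_le_one elim!: eventually_mono)
    show "expectation (\<lambda>w. c (Suc i) * f (Suc i) w * (c (Suc j) * f (Suc j) w)) = 0" if "i \<noteq> j" for i j
    proof -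
      have "expectation (\<lambda>w. c (Suc i) * f (Suc i) w * (c (Suc j) * f (Suc j) w)) =
          expectation (\<lambda>w. c (Suc i) * c (Suc j) * (f (Suc i) w * f (Suc j) w))" by (simp add: mult_ac)
      also have "\<dots> = 0" using f_orthogonal[of "Suc i" "Suc j"] that by simp
      finally show ?thesis .
    qed
  qed auto
  then have "AE w in M. \<forall>k. \<exists>C. \<forall>N\<ge>1. \<bar>\<Sum>n<N. c (Suc n) * f (Suc n) w\<bar> \<le> C * real N powr (1 / 2 + 1 / real (Suc k))"
    by (subst AE_all_countable) auto
  then show ?thesis
  proof eventually_elim
    case (elim w)
    show ?case unfolding subpolynomial_growth_def
    proof (intro allI impI)
      fix \<delta> :: real assume \<delta>: "\<delta> > 0"
      then obtain k where k: "1 / real (Suc k) < \<delta>" using nat_approx_posE by blast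
      obtain C where C: "\<And>N. N \<ge> 1 \<Longrightarrow> \<bar>\<Sum>n<N. c (Suc n) * f (Suc n) w\<bar> \<le> C * real N powr (1 / 2 + 1 / real (Suc k))"
        using elim by blast
      have C0: "C \<ge> 0" using C[of 1] by simp
      have "\<bar>\<Sum>n<N. c (Suc n) * f (Suc n) w\<bar> \<le> C * real N powr (1 / 2 + \<delta>)" if N: "N \<ge> 1" for N
      proof -
        have "C * real N powr (1 / 2 + 1 / real (Suc k)) \<le> C * real N powr (1 / 2 + \<delta>)"
          using C0 k N by (intro mult_left_mono powr_mono) auto
        then show ?thesis using C[OF N] by linarith
      qed
      then show "\<exists>C. \<forall>N\<ge>1. \<bar>\<Sum>n<N. c (Suc n) * f (Suc n) w\<bar> \<le> C * real N powr (1 / 2 + \<delta>)" by blast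
    qed
  qed
qed

lemma rmf_sum_second_moment:
  assumes "finite I" "0 \<notin> I"
  shows "integrable M (\<lambda>w. (\<Sum>n\<in>I. c n * f n w)\<^sup>2)"
    and "expectation (\<lambda>w. (\<Sum>n\<in>I. c n * f n w)\<^sup>2) \<le> (\<Sum>n\<in>I. (c n)\<^sup>2)"
proof -
  \<comment> \<open>\<open>f 0\<close> is arbitrary, hence replaced by zero to have an orthogonal family over all indices\<close>
  define X where "X n = (if n \<ge> 1 then f n else (\<lambda>_. 0))" for n
  have X: "X n \<in> borel_measurable M" "AE w in M. \<bar>X n w\<bar> \<le> 1" for n
    using rv_f[of n] AE_f_bounded[of n] by (auto simp: X_def)
  have Xo: "expectation (\<lambda>w. X n w * X m w) = 0" if "n \<noteq> m" for n m
    using f_orthogonal[of n m] that by (auto simp: X_def)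
  have eq: "(\<Sum>n\<in>I. c n * f n w) = (\<Sum>n\<in>I. c n * X n w)" for w
    using assms(2) by (intro sum.cong) (auto simp: X_def Suc_le_eq intro: Nat.gr0I)
  show "integrable M (\<lambda>w. (\<Sum>n\<in>I. c n * f n w)\<^sup>2)"
    unfolding eq by (rule integrable_square_sum[OF X(1) X(2) Xo])
  show "expectation (\<lambda>w. (\<Sum>n\<in>I. c n * f n w)\<^sup>2) \<le> (\<Sum>n\<in>I. (c n)\<^sup>2)"
    unfolding eq by (rule orthogonal_sum_variance[OF X(1) X(2) Xo assms(1)])
qed

text \<open>The finite Euler product contains every square-free \<open>n \<le> N\<close>, so its difference from the partial sum consists of terms with
  \<open>n > N\<close>. By orthogonality its variance is at most the tail of the zeta series.\<close>

lemma euler_product_error: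
  assumes u: "u > 0"
  shows "expectation (\<lambda>w. ((\<Prod>p\<in>primes_upto N. 1 + f p w / real p powr (1 / 2 + u)) - (\<Sum>n<N. f (Suc n) w / real (Suc n) powr (1 / 2 + u)))\<^sup>2)
     \<le> zeta_sum (1 + 2 * u) - (\<Sum>n<N. 1 / real (Suc n) powr (1 + 2 * u))"
    (is "expectation (\<lambda>w. (?P w - ?T w)\<^sup>2) \<le> _")
    and "integrable M (\<lambda>w. ((\<Prod>p\<in>primes_upto N. 1 + f p w / real p powr (1 / 2 + u)) - (\<Sum>n<N. f (Suc n) w / real (Suc n) powr (1 / 2 + u)))\<^sup>2)"
proof -
  define D where "D = smooth_squarefree N - {1..N}"
  let ?c = "\<lambda>n. 1 / real n powr (1 / 2 + u)"
  have D: "finite D" "0 \<notin> D"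
    unfolding D_def by auto
  have eq: "?P w - ?T w = (\<Sum>n\<in>D. ?c n * f n w)" if w: "w \<in> space M" for w
  proof -
    let ?h = "\<lambda>n. f n w / real n powr (1 / 2 + u)"
    have P: "?P w = (\<Sum>n\<in>smooth_squarefree N. ?h n)"
      by (rule euler_product_squarefree) (simp add: f_squarefree[OF _ w] powr_squarefree prod_dividef)
    have "?T w = (\<Sum>n\<in>{1..N}. ?h n)"
      by (simp add: sum.atLeast1_atMost_eq)
    also have "\<dots> = (\<Sum>n\<in>smooth_squarefree N \<inter> {1..N}. ?h n)"
    proof (rule sum.mono_neutral_right)
      show "\<forall>n\<in>{1..N} - smooth_squarefree N \<inter> {1..N}. ?h n = 0"
        using squarefree_le_smooth[of _ N] f_not_squarefree[OF _ _ w] by fastforce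
    qed auto
    finally have "?P w - ?T w = (\<Sum>n\<in>D. ?h n)"
      unfolding P D_def by (subst sum.Int_Diff[of "smooth_squarefree N" ?h "{1..N}"]) auto
    also have "\<dots> = (\<Sum>n\<in>D. ?c n * f n w)" by simp
    finally show ?thesis .
  qed
  have "integrable M (\<lambda>w. (\<Sum>n\<in>D. ?c n * f n w)\<^sup>2)"
    by (rule rmf_sum_second_moment(1)[OF D])
  then show "integrable M (\<lambda>w. (?P w - ?T w)\<^sup>2)"
    by (subst Bochner_Integration.integrable_cong[OF refl]) (simp_all only: eq)
  have "expectation (\<lambda>w. (?P w - ?T w)\<^sup>2) = expectation (\<lambda>w. (\<Sum>n\<in>D. ?c n * f n w)\<^sup>2)"
    by (intro Bochner_Integration.integral_cong) (simp_all only: eq)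
  also have "\<dots> \<le> (\<Sum>n\<in>D. (?c n)\<^sup>2)" by (rule rmf_sum_second_moment(2)[OF D])
  also have "\<dots> = (\<Sum>n\<in>D. 1 / real n powr (1 + 2 * u))"
    by (intro sum.cong) (auto simp: power_divide power2_eq_square simp flip: powr_add)
  also have "\<dots> = (\<Sum>n\<in>D \<union> {1..N}. 1 / real n powr (1 + 2 * u)) - (\<Sum>n\<in>{1..N}. 1 / real n powr (1 + 2 * u))"
    using D(1) by (subst sum.union_disjoint) (auto simp: D_def)
  also have "(\<Sum>n\<in>{1..N}. 1 / real n powr (1 + 2 * u)) = (\<Sum>n<N. 1 / real (Suc n) powr (1 + 2 * u))"
    by (simp add: sum.atLeast1_atMost_eq)
  also have "(\<Sum>n\<in>D \<union> {1..N}. 1 / real n powr (1 + 2 * u)) \<le> zeta_sum (1 + 2 * u)"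
    using D u by (intro sum_le_zeta_sum) force+
  finally show "expectation (\<lambda>w. (?P w - ?T w)\<^sup>2) \<le> zeta_sum (1 + 2 * u) - (\<Sum>n<N. 1 / real (Suc n) powr (1 + 2 * u))"
    by simp
qed

text \<open>The almost sure properties that make the series converge and the logarithm of the Euler product meaningful for a single realisation.\<close>

definition regular :: "'a \<Rightarrow> bool" where
  "regular w \<longleftrightarrow> (\<forall>p. prime p \<longrightarrow> f p w = 1 \<or> f p w = - 1) \<and>
     subpolynomial_growth (\<lambda>n. f n w) \<and> subpolynomial_growth (prime_part (\<lambda>n. f n w))"

lemma AE_regular: "AE w in M. regular w"
proof -
  have "AE w in M. subpolynomial_growth (\<lambda>n. 1 * f n w)" by (rule AE_subpolynomial_growth) auto
  moreover have "AE w in M. subpolynomial_growth (\<lambda>n. of_bool (prime n) * f n w)" by (rule AE_subpolynomial_growth) auto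
  ultimately show ?thesis
    using AE_all_signs by eventually_elim (simp add: regular_def prime_part_def[abs_def])
qed

text \<open>By Fatou's lemma the squared difference of the two almost sure limits has mean zero.\<close>

lemma AE_euler_product_at:
  assumes u: "u > 0"
  shows "AE w in M. dirichlet_sum f w (1 / 2 + u) = exp (euler_log (\<lambda>n. f n w) (1 / 2 + u))"
proof -
  let ?P = "\<lambda>N w. \<Prod>p\<in>primes_upto N. 1 + f p w / real p powr (1 / 2 + u)"
  let ?T = "\<lambda>N w. \<Sum>n<N. f (Suc n) w / real (Suc n) powr (1 / 2 + u)"
  let ?b = "\<lambda>N. zeta_sum (1 + 2 * u) - (\<Sum>n<N. 1 / real (Suc n) powr (1 + 2 * u))"
  have b: "?b \<longlonglongrightarrow> 0"
    using tendsto_diff[OF tendsto_const[of "zeta_sum (1 + 2 * u)"] summable_LIMSEQ[OF summable_powr_Suc[of "1 + 2 * u"]]] u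
    by (simp add: dseries_def)
  have m [measurable]: "(\<lambda>w. ennreal ((?P N w - ?T N w)\<^sup>2)) \<in> borel_measurable M" for N
    using euler_product_error(2)[OF u, of N] by auto
  have "(\<integral>\<^sup>+w. liminf (\<lambda>N. ennreal ((?P N w - ?T N w)\<^sup>2)) \<partial>M) \<le> liminf (\<lambda>N. \<integral>\<^sup>+w. ennreal ((?P N w - ?T N w)\<^sup>2) \<partial>M)"
    by (rule nn_integral_liminf) measurable
  also have "\<dots> \<le> liminf (\<lambda>N. ennreal (?b N))"
  proof (rule Liminf_mono, rule always_eventually, rule allI)
    fix N
    have "(\<integral>\<^sup>+w. ennreal ((?P N w - ?T N w)\<^sup>2) \<partial>M) = ennreal (expectation (\<lambda>w. (?P N w - ?T N w)\<^sup>2))"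
      by (rule nn_integral_eq_integral[OF euler_product_error(2)[OF u]]) simp
    also have "\<dots> \<le> ennreal (?b N)" by (intro ennreal_leI euler_product_error(1) u)
    finally show "(\<integral>\<^sup>+w. ennreal ((?P N w - ?T N w)\<^sup>2) \<partial>M) \<le> ennreal (?b N)" .
  qed
  also have "\<dots> = 0"
    using tendsto_ennrealI[OF b] by (intro lim_imp_Liminf) auto
  finally have zero: "(\<integral>\<^sup>+w. liminf (\<lambda>N. ennreal ((?P N w - ?T N w)\<^sup>2)) \<partial>M) = 0" by simp
  have "(\<lambda>w. liminf (\<lambda>N. ennreal ((?P N w - ?T N w)\<^sup>2))) \<in> borel_measurable M" by measurable
  from nn_integral_0_iff_AE[OF this, THEN iffD1, OF zero]
  have "AE w in M. liminf (\<lambda>N. ennreal ((?P N w - ?T N w)\<^sup>2)) = 0" .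
  then show ?thesis
    using AE_regular
  proof eventually_elim
    case (elim w)
    then have r: "\<And>p. prime p \<Longrightarrow> f p w = 1 \<or> f p w = - 1" "subpolynomial_growth (\<lambda>n. f n w)"
      "subpolynomial_growth (prime_part (\<lambda>n. f n w))" by (auto simp: regular_def)
    have "(\<lambda>N. ?P N w) \<longlonglongrightarrow> exp (euler_log (\<lambda>n. f n w) (1 / 2 + u))"
      by (rule euler_product_tendsto[OF r(1,3) u])
    moreover have "(\<lambda>N. ?T N w) \<longlonglongrightarrow> dirichlet_sum f w (1 / 2 + u)"
      using growth_dseries_sums[OF r(2) u] unfolding sums_def dseries_def dirichlet_sum_def .
    ultimately have lim: "(\<lambda>N. ennreal ((?P N w - ?T N w)\<^sup>2)) \<longlonglongrightarrow>
        ennreal ((exp (euler_log (\<lambda>n. f n w) (1 / 2 + u)) - dirichlet_sum f w (1 / 2 + u))\<^sup>2)"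
      by (intro tendsto_ennrealI tendsto_power tendsto_diff)
    have "ennreal ((exp (euler_log (\<lambda>n. f n w) (1 / 2 + u)) - dirichlet_sum f w (1 / 2 + u))\<^sup>2) = 0"
      using lim_imp_Liminf[OF sequentially_bot lim] elim(1) by (rule trans[OF sym])
    then show ?case by simp
  qed
qed

text \<open>Both sides are continuous in \<open>u\<close>, so it suffices to exclude a null set for every positive rational \<open>u\<close>.\<close>

lemma AE_euler_product:
  "AE w in M. regular w \<and> (\<forall>u>0. dirichlet_sum f w (1 / 2 + u) = exp (euler_log (\<lambda>n. f n w) (1 / 2 + u)))"
proof -
  have "AE w in M. \<forall>q\<in>{q\<in>\<rat>. q > 0}. dirichlet_sum f w (1 / 2 + q) = exp (euler_log (\<lambda>n. f n w) (1 / 2 + q))"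
    by (subst AE_ball_countable) (auto intro!: AE_euler_product_at countable_subset[OF _ countable_rat])
  then show ?thesis
    using AE_regular
  proof eventually_elim
    case (elim w)
    then have r: "\<And>p. prime p \<Longrightarrow> f p w = 1 \<or> f p w = - 1" "subpolynomial_growth (\<lambda>n. f n w)"
      "subpolynomial_growth (prime_part (\<lambda>n. f n w))" by (auto simp: regular_def)
    define h where "h u = dirichlet_sum f w (1 / 2 + u) - exp (euler_log (\<lambda>n. f n w) (1 / 2 + u))" for u
    have "continuous_on {0<..} (\<lambda>u. dseries (\<lambda>n. f n w) (1 / 2 + u))" by (rule growth_dseries_continuous[OF r(2)])
    then have hc: "continuous_on {0<..} h"
      unfolding h_def dirichlet_sum_def dseries_def
      by (intro continuous_on_diff continuous_on_exp euler_log_continuous[OF r(1,3)])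
    have "h u = 0" if u: "u > 0" for u
    proof (rule ccontr)
      assume n: "h u \<noteq> 0"
      have "isCont h u" using hc u by (simp add: continuous_on_eq_continuous_at)
      then have "\<forall>\<^sub>F v in at u. h v \<noteq> 0" using n by (intro tendsto_imp_eventually_ne) (auto simp: isCont_def)
      then obtain d where d: "d > 0" "\<And>v. v \<noteq> u \<Longrightarrow> dist v u < d \<Longrightarrow> h v \<noteq> 0"
        by (auto simp: eventually_at)
      obtain q where q: "q \<in> \<rat>" "u < q" "q < u + d" using Rats_dense_in_real[of u "u + d"] d by auto
      then have "h q \<noteq> 0" by (intro d(2)) (auto simp: dist_real_def)
      moreover have "h q = 0" using elim(1) q u by (auto simp: h_def)
      ultimately show False by simp
    qed
    then show ?case using elim by (simp add: h_def)
  qed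
qed

end

section \<open>Moments and a central limit theorem for sums over primes\<close>

lemma cos_gaussian_approx: "\<bar>cos x - exp (- x\<^sup>2 / 2)\<bar> \<le> x ^ 4" for x :: real
proof -
  define y where "y = x\<^sup>2 / 2"
  have y: "y \<ge> 0" "y\<^sup>2 = x ^ 4 / 4" by (auto simp: y_def power_divide)
  have "(\<Sum>k\<le>3. (\<i> * complex_of_real x) ^ k / fact k) =
      1 + \<i> * x - x\<^sup>2 / 2 - \<i> * x ^ 3 / 6"
    by (simp add: numeral_3_eq_3 power2_eq_square fact_numeral field_simps power3_eq_cube)
  then have "Re (iexp x - (\<Sum>k\<le>3. (\<i> * complex_of_real x) ^ k / fact k)) = cos x - (1 - y)"
    by (simp add: y_def Re_exp power2_eq_square)
  then have "\<bar>cos x - (1 - y)\<bar> \<le> cmod (iexp x - (\<Sum>k\<le>3. (\<i> * complex_of_real x) ^ k / fact k))"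
    using abs_Re_le_cmod by metis
  also have "\<dots> \<le> \<bar>x\<bar> ^ Suc 3 / fact (Suc 3)" by (rule iexp_approx1)
  also have "\<dots> = x ^ 4 / 24" by (simp add: fact_numeral)
  finally have 1: "\<bar>cos x - (1 - y)\<bar> \<le> x ^ 4 / 24" .
  have "1 - y \<le> exp (- y)" using exp_ge_add_one_self[of "- y"] by simp
  moreover have "exp (- y) \<le> 1 - y + y\<^sup>2"
  proof -
    have "exp (- y) \<le> 1 / (1 + y)"
      using exp_ge_add_one_self[of y] y by (simp add: exp_minus field_simps)
    also have "1 / (1 + y) \<le> 1 - y + y\<^sup>2"
    proof -
      have "(1 - y + y\<^sup>2) * (1 + y) = 1 + y ^ 3" by (simp add: algebra_simps power2_eq_square power3_eq_cube)
      moreover have "0 \<le> y ^ 3" using y(1) by simp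
      ultimately have "1 \<le> (1 - y + y\<^sup>2) * (1 + y)" by linarith
      moreover have "0 < 1 + y" using y(1) by simp
      ultimately show ?thesis by (simp only: pos_divide_le_eq)
    qed
    finally show ?thesis .
  qed
  ultimately have 2: "\<bar>exp (- y) - (1 - y)\<bar> \<le> x ^ 4 / 4" using y by simp
  have "0 \<le> x ^ 4" by simp
  then have "\<bar>cos x - exp (- y)\<bar> \<le> x ^ 4" using 1 2 unfolding abs_le_iff by linarith
  then show ?thesis by (simp add: y_def)
qed

text \<open>Rescaling to the standard normal law.\<close>

lemma char_centered_normal:
  assumes N: "prob_space N" and V: "distributed N lborel V (normal_density 0 \<sigma>)" and \<sigma>: "\<sigma> > 0"
  shows "char (distr N borel V) t = complex_of_real (exp (- ((t * \<sigma>)\<^sup>2 / 2)))"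
proof -
  interpret prob_space N by fact
  have d: "distributed N lborel (\<lambda>x. V x / \<sigma>) std_normal_density"
    using V normal_standard_normal_convert[OF \<sigma>, of V 0] by simp
  have Vm [measurable]: "V \<in> borel_measurable N" using V by (simp add: distributed_def)
  have "distr N borel (\<lambda>x. V x / \<sigma>) = distr N lborel (\<lambda>x. V x / \<sigma>)" by (rule distr_cong) auto
  also have "\<dots> = std_normal_distribution" using d by (simp add: distributed_def)
  finally have std: "distr N borel (\<lambda>x. V x / \<sigma>) = std_normal_distribution" .
  have "char (distr N borel V) t = (\<integral>x. iexp (t * V x) \<partial>N)"
    unfolding char_def by (rule integral_distr) measurable
  also have "\<dots> = (\<integral>x. iexp ((t * \<sigma>) * (V x / \<sigma>)) \<partial>N)" using \<sigma> by simp
  also have "\<dots> = char (distr N borel (\<lambda>x. V x / \<sigma>)) (t * \<sigma>)"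
    unfolding char_def by (rule integral_distr[symmetric]) measurable
  also have "\<dots> = complex_of_real (exp (- ((t * \<sigma>)\<^sup>2 / 2)))"
    unfolding std char_std_normal_distribution by simp
  finally show ?thesis .
qed

lemma ennreal_abs_le_square: "ennreal \<bar>x\<bar> \<le> 1 + ennreal (x\<^sup>2)" for x :: real
proof -
  have "\<bar>x\<bar> \<le> 1 + x\<^sup>2"
  proof (cases "\<bar>x\<bar> \<le> 1")
    case False
    then have "\<bar>x\<bar> * 1 \<le> \<bar>x\<bar> * \<bar>x\<bar>" by (intro mult_left_mono) auto
    then show ?thesis by (simp add: power2_eq_square)
  qed (simp add: add_increasing2)
  then have "ennreal \<bar>x\<bar> \<le> ennreal (1 + x\<^sup>2)" by (rule ennreal_leI)
  then show ?thesis by simp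
qed

context rademacher_rmf
begin

text \<open>Adding a term \<open>e = c f(q)\<close> independent of the sum \<open>S\<close>, the odd powers of \<open>e\<close> drop out and \<open>E (S + e)\<^sup>4 = E S\<^sup>4 + 6 c\<^sup>2 E S\<^sup>2 + c\<^sup>4\<close>.
  This preserves the bound by three times the square of the variance.\<close>

lemma prime_sum_fourth_moment:
  assumes "finite I" "\<And>p. p \<in> I \<Longrightarrow> prime p"
  shows "integrable M (\<lambda>w. (\<Sum>p\<in>I. c p * f p w) ^ 4) \<and>
    expectation (\<lambda>w. (\<Sum>p\<in>I. c p * f p w) ^ 4) \<le> 3 * (\<Sum>p\<in>I. (c p)\<^sup>2)\<^sup>2"
  using assms
proof (induction rule: finite_induct)
  case empty
  then show ?case by simp
next
  case (insert q I)
  define S where "S w = (\<Sum>p\<in>I. c p * f p w)" for w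
  define e where "e w = c q * f q w" for w
  define V where "V = (\<Sum>p\<in>I. (c p)\<^sup>2)"
  have q: "prime q" using insert by simp
  have pI: "prime p" if "p \<in> I" for p using insert that by simp
  have zI: "0 \<notin> I" using pI not_prime_0 by blast
  have Sm [measurable]: "S \<in> borel_measurable M" unfolding S_def
    by (intro borel_measurable_sum borel_measurable_times borel_measurable_const rv_prime pI)
  have em [measurable]: "e \<in> borel_measurable M" unfolding e_def using rv_prime[OF q] by measurable
  have Sb: "AE w in M. \<bar>S w\<bar> \<le> (\<Sum>p\<in>I. \<bar>c p\<bar>)"
    using AE_all_signs
  proof eventually_elim
    case (elim w)
    have "\<bar>S w\<bar> \<le> (\<Sum>p\<in>I. \<bar>c p * f p w\<bar>)" unfolding S_def by (rule sum_abs)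
    also have "\<dots> \<le> (\<Sum>p\<in>I. \<bar>c p\<bar>)"
    proof (rule sum_mono)
      fix p assume "p \<in> I"
      then have "f p w = 1 \<or> f p w = - 1" using elim pI by blast
      then show "\<bar>c p * f p w\<bar> \<le> \<bar>c p\<bar>" by auto
    qed
    finally show ?case .
  qed
  have Si: "integrable M (\<lambda>w. S w ^ k)" for k
  proof (rule integrable_AE_bounded[where C = "(\<Sum>p\<in>I. \<bar>c p\<bar>) ^ k"])
    show "AE w in M. \<bar>S w ^ k\<bar> \<le> (\<Sum>p\<in>I. \<bar>c p\<bar>) ^ k"
      using Sb by eventually_elim (simp add: power_abs power_mono)
  qed measurable
  have ei: "integrable M e" unfolding e_def by (intro integrable_mult_right integrable_prime q)
  have ee: "expectation e = 0" unfolding e_def using expectation_prime[OF q] by simp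
  have ind: "indep_var borel e borel S"
    unfolding e_def S_def
  proof (rule indep_vars_sum)
    show "indep_vars (\<lambda>_. borel) (\<lambda>p w. c p * f p w) (insert q I)"
      by (rule indep_vars_compose2[OF indep_vars_subset[OF indep_primes]]) (use pI q in auto)
  qed (use insert in auto)
  have cross: "integrable M (\<lambda>w. e w * S w ^ k)" "expectation (\<lambda>w. e w * S w ^ k) = 0" for k
  proof -
    have i: "indep_var borel e borel (\<lambda>w. S w ^ k)"
      using indep_var_compose[OF ind, of "\<lambda>x. x" borel "\<lambda>x. x ^ k" borel] by (simp add: comp_def)
    show "integrable M (\<lambda>w. e w * S w ^ k)" by (rule indep_var_integrable[OF i ei Si])
    show "expectation (\<lambda>w. e w * S w ^ k) = 0" using indep_var_lebesgue_integral[OF i ei Si] ee by simp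
  qed
  \<comment> \<open>the expansion of \<open>(S + e)\<^sup>4\<close> with \<open>e\<^sup>2 = c\<^sup>2\<close> substituted\<close>
  let ?T = "\<lambda>w. S w ^ 4 + 4 * (e w * S w ^ 3) + 6 * (c q)\<^sup>2 * S w ^ 2 + 4 * (c q)\<^sup>2 * (e w * S w ^ 1) + (c q) ^ 4"
  have AEeq: "AE w in M. (\<Sum>p\<in>insert q I. c p * f p w) ^ 4 = ?T w"
    using AE_prime_sign[OF q]
  proof eventually_elim
    case (elim w)
    have e2: "e w * e w = (c q)\<^sup>2" using elim by (auto simp: e_def power2_eq_square)
    have "(\<Sum>p\<in>insert q I. c p * f p w) ^ 4 = (S w + e w) ^ 4"
      using insert by (simp add: S_def e_def add.commute)
    also have "\<dots> = S w ^ 4 + 4 * (e w * S w ^ 3) + 6 * (e w * e w) * S w ^ 2 + 4 * (e w * e w) * (e w * S w ^ 1) + (e w * e w) * (e w * e w)"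
      by (simp add: algebra_simps power4_eq_xxxx power3_eq_cube power2_eq_square)
    also have "\<dots> = ?T w" unfolding e2 by (simp add: power4_eq_xxxx power2_eq_square mult.assoc)
    finally show ?case .
  qed
  have Ti: "integrable M ?T"
    by (intro Bochner_Integration.integrable_add integrable_mult_right Si cross integrable_const)
  have m: "(\<lambda>w. (\<Sum>p\<in>insert q I. c p * f p w) ^ 4) \<in> borel_measurable M"
    using q pI by (intro borel_measurable_power borel_measurable_sum borel_measurable_times borel_measurable_const rv_prime) auto
  have "expectation (\<lambda>w. (\<Sum>p\<in>insert q I. c p * f p w) ^ 4) = expectation ?T"
    by (rule integral_cong_AE[OF m _ AEeq]) measurable
  also have "\<dots> = expectation (\<lambda>w. S w ^ 4) + 6 * (c q)\<^sup>2 * expectation (\<lambda>w. S w ^ 2) + (c q) ^ 4"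
    using Si cross[of 3] cross[of 1] by (simp add: prob_space)
  also have "\<dots> \<le> 3 * V\<^sup>2 + 6 * (c q)\<^sup>2 * V + (c q) ^ 4"
    using insert.IH pI rmf_sum_second_moment(2)[OF insert.hyps(1) zI, of c]
    by (intro add_mono mult_left_mono) (auto simp: S_def V_def)
  also have "\<dots> \<le> 3 * (V + (c q)\<^sup>2)\<^sup>2"
  proof -
    have "3 * V\<^sup>2 + 6 * d * V + d\<^sup>2 \<le> 3 * (V + d)\<^sup>2" for d :: real
      using zero_le_power2[of d] by (simp add: power2_sum algebra_simps)
    from this[of "(c q)\<^sup>2"] show ?thesis by (simp flip: power_mult)
  qed
  finally have "expectation (\<lambda>w. (\<Sum>p\<in>insert q I. c p * f p w) ^ 4) \<le> 3 * (\<Sum>p\<in>insert q I. (c p)\<^sup>2)\<^sup>2"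
    using insert by (simp add: V_def add.commute)
  moreover have "integrable M (\<lambda>w. (\<Sum>p\<in>insert q I. c p * f p w) ^ 4)"
    using integrable_cong_AE[OF m _ AEeq] Ti by simp
  ultimately show ?case by blast
qed

text \<open>Fatou's lemma transfers the upper bounds from the finite sums.\<close>

lemma prime_series_moments:
  assumes c: "\<And>n. \<not> prime n \<Longrightarrow> c n = 0" "summable (\<lambda>n. (c (Suc n))\<^sup>2)"
    and L: "AE w in M. (\<lambda>n. c (Suc n) * f (Suc n) w) sums L w"
  shows "(\<integral>\<^sup>+w. ennreal ((L w)\<^sup>2) \<partial>M) \<le> ennreal (\<Sum>n. (c (Suc n))\<^sup>2)"
    and "(\<integral>\<^sup>+w. ennreal ((L w) ^ 4) \<partial>M) \<le> ennreal (3 * (\<Sum>n. (c (Suc n))\<^sup>2)\<^sup>2)"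
proof -
  let ?S = "\<lambda>N w. \<Sum>p\<in>primes_upto N. c p * f p w"
  have eqS: "(\<Sum>n<N. c (Suc n) * f (Suc n) w) = ?S N w" for N w
  proof -
    have "(\<Sum>n<N. c (Suc n) * f (Suc n) w) = (\<Sum>n<N. of_bool (prime (Suc n)) * (c (Suc n) * f (Suc n) w))"
      by (intro sum.cong) (auto simp: c(1))
    then show ?thesis by (simp only: sum_primes_upto[where g = "\<lambda>p. c p * f p w"])
  qed
  have var: "(\<Sum>p\<in>primes_upto N. (c p)\<^sup>2) \<le> (\<Sum>n. (c (Suc n))\<^sup>2)" for N
  proof -
    have "(\<Sum>p\<in>primes_upto N. (c p)\<^sup>2) = (\<Sum>n<N. of_bool (prime (Suc n)) * (c (Suc n))\<^sup>2)"
      by (rule sum_primes_upto[symmetric])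
    also have "\<dots> = (\<Sum>n<N. (c (Suc n))\<^sup>2)" by (intro sum.cong) (auto simp: c(1))
    also have "\<dots> \<le> (\<Sum>n. (c (Suc n))\<^sup>2)" by (intro sum_le_suminf c(2)) auto
    finally show ?thesis .
  qed
  have P: "prime p" if "p \<in> primes_upto N" for p N using that by (simp add: primes_upto_def)
  have z: "0 \<notin> primes_upto N" for N by (simp add: primes_upto_def)
  have m [measurable]: "?S N \<in> borel_measurable M" for N
    by (intro borel_measurable_sum borel_measurable_times borel_measurable_const rv_prime P)
  have fatou: "(\<integral>\<^sup>+w. ennreal ((L w) ^ k) \<partial>M) \<le> ennreal b"
    if i: "\<And>N. integrable M (\<lambda>w. (?S N w) ^ k)" and b: "\<And>N. expectation (\<lambda>w. (?S N w) ^ k) \<le> b"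
      and k: "even k" for k b
  proof -
    have "(\<integral>\<^sup>+w. ennreal ((L w) ^ k) \<partial>M) = (\<integral>\<^sup>+w. liminf (\<lambda>N. ennreal ((?S N w) ^ k)) \<partial>M)"
    proof (rule nn_integral_cong_AE)
      show "AE w in M. ennreal ((L w) ^ k) = liminf (\<lambda>N. ennreal ((?S N w) ^ k))"
        using L
      proof eventually_elim
        case (elim w)
        then have "(\<lambda>N. ennreal ((?S N w) ^ k)) \<longlonglongrightarrow> ennreal ((L w) ^ k)"
          unfolding sums_def eqS by (intro tendsto_ennrealI tendsto_power)
        from lim_imp_Liminf[OF sequentially_bot this] show ?case by (rule sym)
      qed
    qed
    also have "\<dots> \<le> liminf (\<lambda>N. \<integral>\<^sup>+w. ennreal ((?S N w) ^ k) \<partial>M)"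
      by (rule nn_integral_liminf) measurable
    also have "\<dots> \<le> liminf (\<lambda>N::nat. ennreal b)"
    proof (rule Liminf_mono, rule always_eventually, rule allI)
      fix N
      have "(\<integral>\<^sup>+w. ennreal ((?S N w) ^ k) \<partial>M) = ennreal (expectation (\<lambda>w. (?S N w) ^ k))"
        by (rule nn_integral_eq_integral[OF i]) (simp add: k zero_le_even_power)
      also have "\<dots> \<le> ennreal b" by (intro ennreal_leI b)
      finally show "(\<integral>\<^sup>+w. ennreal ((?S N w) ^ k) \<partial>M) \<le> ennreal b" .
    qed
    also have "\<dots> = ennreal b" by (simp add: Liminf_const)
    finally show ?thesis .
  qed
  show "(\<integral>\<^sup>+w. ennreal ((L w)\<^sup>2) \<partial>M) \<le> ennreal (\<Sum>n. (c (Suc n))\<^sup>2)"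
    by (rule fatou) (auto intro: rmf_sum_second_moment[OF finite_primes_upto z] order_trans[OF _ var])
  show "(\<integral>\<^sup>+w. ennreal ((L w) ^ 4) \<partial>M) \<le> ennreal (3 * (\<Sum>n. (c (Suc n))\<^sup>2)\<^sup>2)"
  proof (rule fatou)
    fix N
    have fm: "integrable M (\<lambda>w. (?S N w) ^ 4) \<and> expectation (\<lambda>w. (?S N w) ^ 4) \<le> 3 * (\<Sum>p\<in>primes_upto N. (c p)\<^sup>2)\<^sup>2"
      by (rule prime_sum_fourth_moment[OF finite_primes_upto P])
    show "integrable M (\<lambda>w. (?S N w) ^ 4)" by (rule conjunct1[OF fm])
    have "(\<Sum>p\<in>primes_upto N. (c p)\<^sup>2)\<^sup>2 \<le> (\<Sum>n. (c (Suc n))\<^sup>2)\<^sup>2"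
      by (intro power_mono var sum_nonneg) auto
    then show "expectation (\<lambda>w. (?S N w) ^ 4) \<le> 3 * (\<Sum>n. (c (Suc n))\<^sup>2)\<^sup>2" using conjunct2[OF fm] by linarith
  qed simp
qed

text \<open>This is \<open>Y(u) = \<Sum>\<^sub>p f(p) p\<^sup>-\<^sup>1\<^sup>/\<^sup>2\<^sup>-\<^sup>u\<close>, summed in the order of the primes since it may converge only conditionally.\<close>

definition prime_series :: "real \<Rightarrow> 'a \<Rightarrow> real" where
  "prime_series u w = dseries (prime_part (\<lambda>n. f n w)) (1 / 2 + u)"

lemma prime_series_measurable [measurable]: "prime_series u \<in> borel_measurable M"
  unfolding prime_series_def[abs_def] dseries_def prime_part_def
  by (intro borel_measurable_suminf borel_measurable_divide borel_measurable_times borel_measurable_const rv_f) auto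

lemma prime_series_continuous: "regular w \<Longrightarrow> continuous_on {0<..} (\<lambda>u. prime_series u w)"
  unfolding prime_series_def regular_def by (intro growth_dseries_continuous) auto

lemma prime_series_sums:
  assumes "regular w" "u > 0"
  shows "(\<lambda>n. of_bool (prime (Suc n)) * (1 / real (Suc n) powr (1 / 2 + u)) * f (Suc n) w) sums prime_series u w"
  using growth_dseries_sums[of "prime_part (\<lambda>n. f n w)" u] assms
  unfolding prime_series_def regular_def by (simp add: prime_part_def)

lemma prime_series_increment_sums:
  assumes "regular w" "u > 0" "v > 0"
  shows "(\<lambda>n. prime_weight u v (Suc n) * f (Suc n) w) sums (prime_series u w - prime_series v w)"
proof -
  have "(\<lambda>n. of_bool (prime (Suc n)) * (1 / real (Suc n) powr (1 / 2 + u)) * f (Suc n) w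
     - of_bool (prime (Suc n)) * (1 / real (Suc n) powr (1 / 2 + v)) * f (Suc n) w) sums (prime_series u w - prime_series v w)"
    by (intro sums_diff prime_series_sums assms)
  then show ?thesis by (simp only: prime_weight_def left_diff_distrib right_diff_distrib)
qed

lemma prime_series_increment_fourth_moment:
  assumes "0 < u" "u \<le> v" "v \<le> 1"
  shows "(\<integral>\<^sup>+w. ennreal ((prime_series u w - prime_series v w) ^ 4) \<partial>M) \<le> ennreal (3 * (block_const * ln (v / u))\<^sup>2)"
proof -
  have s: "summable (\<lambda>n. (prime_weight u v (Suc n))\<^sup>2)"
    using assms by (intro prime_weight_summable) auto
  have "(\<integral>\<^sup>+w. ennreal ((prime_series u w - prime_series v w) ^ 4) \<partial>M) \<le> ennreal (3 * (\<Sum>n. (prime_weight u v (Suc n))\<^sup>2)\<^sup>2)"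
  proof (rule prime_series_moments(2))
    show "AE w in M. (\<lambda>n. prime_weight u v (Suc n) * f (Suc n) w) sums (prime_series u w - prime_series v w)"
      using AE_regular by eventually_elim (use assms in \<open>auto intro!: prime_series_increment_sums\<close>)
  qed (use s in \<open>auto simp: prime_weight_def\<close>)
  also have "\<dots> \<le> ennreal (3 * (block_const * ln (v / u))\<^sup>2)"
    by (intro ennreal_leI mult_left_mono power_mono prime_weight_total_le assms suminf_nonneg s) auto
  finally show ?thesis .
qed

lemma prime_series_block_approximation:
  assumes "0 < u" "u \<le> v" "v \<le> 1"
  shows "(\<integral>\<^sup>+w. ennreal ((prime_series u w - prime_series v w - (\<Sum>p\<in>prime_block u v. prime_weight u v p * f p w))\<^sup>2) \<partial>M)
    \<le> ennreal block_const"
proof -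
  \<comment> \<open>removing the block from the series leaves the weights outside it\<close>
  let ?c = "\<lambda>n. of_bool (n \<notin> prime_block u v) * prime_weight u v n"
  have s: "summable (\<lambda>n. (prime_weight u v (Suc n))\<^sup>2)"
    using assms by (intro prime_weight_summable) auto
  have sq: "(?c n)\<^sup>2 = of_bool (n \<notin> prime_block u v) * (prime_weight u v n)\<^sup>2" for n by simp
  have sc: "summable (\<lambda>n. (?c (Suc n))\<^sup>2)"
    by (rule summable_comparison_test'[OF s, of 0]) auto
  have "(\<integral>\<^sup>+w. ennreal ((prime_series u w - prime_series v w - (\<Sum>p\<in>prime_block u v. prime_weight u v p * f p w))\<^sup>2) \<partial>M)
    \<le> ennreal (\<Sum>n. (?c (Suc n))\<^sup>2)"
  proof (rule prime_series_moments(1)[OF _ sc])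
    show "AE w in M. (\<lambda>n. ?c (Suc n) * f (Suc n) w) sums
      (prime_series u w - prime_series v w - (\<Sum>p\<in>prime_block u v. prime_weight u v p * f p w))"
      using AE_regular
    proof eventually_elim
      case (elim w)
      have "(\<lambda>n. prime_weight u v (Suc n) * f (Suc n) w - of_bool (Suc n \<in> prime_block u v) * (prime_weight u v (Suc n) * f (Suc n) w))
        sums (prime_series u w - prime_series v w - (\<Sum>p\<in>prime_block u v. prime_weight u v p * f p w))"
        using assms elim by (intro sums_diff prime_series_increment_sums sums_prime_block[where g = "\<lambda>p. prime_weight u v p * f p w"]) auto
      moreover have "prime_weight u v n * f n w - of_bool (n \<in> prime_block u v) * (prime_weight u v n * f n w) = ?c n * f n w" for n
        by simp
      ultimately show ?case by (simp only:)
    qed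
  qed (auto simp: prime_weight_def)
  also have "\<dots> \<le> ennreal block_const"
    unfolding sq by (intro ennreal_leI outside_block_sum_le assms)
  finally show ?thesis .
qed

text \<open>Controls \<open>Y(1)\<close>, which is subtracted below so that the approximating paths start at zero.\<close>

lemma prime_series_one_integrable:
  obtains C where "C \<ge> 0" "(\<integral>\<^sup>+w. ennreal \<bar>prime_series 1 w\<bar> \<partial>M) \<le> ennreal C"
proof -
  let ?c = "\<lambda>n. of_bool (prime n) * (1 / real n powr (1 / 2 + 1))"
  have sq: "(?c n)\<^sup>2 = of_bool (prime n) * (1 / real n powr 3)" for n
    by (simp add: power2_eq_square flip: powr_add)
  have s: "summable (\<lambda>n. (?c (Suc n))\<^sup>2)"
    unfolding sq by (rule summable_comparison_test'[OF summable_powr_Suc[of 3], of 0]) auto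
  have "(\<integral>\<^sup>+w. ennreal \<bar>prime_series 1 w\<bar> \<partial>M) \<le> (\<integral>\<^sup>+w. 1 + ennreal ((prime_series 1 w)\<^sup>2) \<partial>M)"
    by (intro nn_integral_mono ennreal_abs_le_square)
  also have "\<dots> = 1 + (\<integral>\<^sup>+w. ennreal ((prime_series 1 w)\<^sup>2) \<partial>M)"
    by (subst nn_integral_add) (auto simp: emeasure_space_1)
  also have "\<dots> \<le> 1 + ennreal (\<Sum>n. (?c (Suc n))\<^sup>2)"
  proof (intro add_left_mono prime_series_moments(1)[OF _ s])
    show "AE w in M. (\<lambda>n. ?c (Suc n) * f (Suc n) w) sums prime_series 1 w"
      using AE_regular by eventually_elim (rule prime_series_sums, auto)
  qed auto
  also have "\<dots> = ennreal (1 + (\<Sum>n. (?c (Suc n))\<^sup>2))" using suminf_nonneg[OF s] by simp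
  finally show ?thesis using that[of "1 + (\<Sum>n. (?c (Suc n))\<^sup>2)"] suminf_nonneg[OF s] by simp
qed

lemma char_prime_term:
  assumes "prime p"
  shows "char (distr M borel (\<lambda>w. c * f p w)) t = complex_of_real (cos (t * c))"
proof -
  note [measurable] = rv_prime[OF assms]
  have "char (distr M borel (\<lambda>w. c * f p w)) t = (\<integral>w. iexp (t * (c * f p w)) \<partial>M)"
    unfolding char_def by (rule integral_distr) measurable
  also have "\<dots> = (1 / 2) *\<^sub>R (iexp (t * (c * 1)) + iexp (t * (c * (- 1))))"
    by (rule integral_sign_function[OF assms, of "\<lambda>x. iexp (t * (c * x))"]) measurable
  also have "\<dots> = complex_of_real (cos (t * c))"
    by (simp add: complex_eq_iff Re_exp Im_exp)
  finally show ?thesis .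
qed

text \<open>The characteristic function is a product of cosines. Replacing each \<open>cos x\<close> by \<open>exp (- x\<^sup>2 / 2)\<close> costs at most \<open>x\<^sup>4\<close>, in total at most
  \<open>t\<^sup>4\<close> times the largest squared weight times the variance, which tends to zero.\<close>

lemma prime_sum_clt:
  fixes c :: "nat \<Rightarrow> nat \<Rightarrow> real" and I :: "nat \<Rightarrow> nat set"
  assumes N: "prob_space N" and V: "distributed N lborel V (normal_density 0 (sqrt \<tau>))" and \<tau>: "\<tau> > 0"
    and I: "\<And>i. finite (I i)" "\<And>i p. p \<in> I i \<Longrightarrow> prime p"
    and var: "(\<lambda>i. \<Sum>p\<in>I i. (c i p)\<^sup>2) \<longlonglongrightarrow> \<tau>"
    and small: "\<And>i p. p \<in> I i \<Longrightarrow> \<bar>c i p\<bar> \<le> b i" "b \<longlonglongrightarrow> 0"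
  shows "weak_conv_m (\<lambda>i. distr M borel (\<lambda>w. \<Sum>p\<in>I i. c i p * f p w)) (distr N borel V)"
proof -
  interpret N: prob_space N by fact
  have m: "(\<lambda>w. \<Sum>p\<in>I i. c i p * f p w) \<in> borel_measurable M" for i
    by (intro borel_measurable_sum borel_measurable_times borel_measurable_const rv_prime I(2))
  have Vm: "V \<in> borel_measurable N" using V by (simp add: distributed_def)
  show ?thesis
  proof (rule levy_continuity)
    show "real_distribution (distr M borel (\<lambda>w. \<Sum>p\<in>I i. c i p * f p w))" for i
      by (rule real_distribution_distr[OF m])
    show "real_distribution (distr N borel V)" by (rule N.real_distribution_distr[OF Vm])
    fix t :: real
    let ?C = "\<lambda>i. \<Prod>p\<in>I i. complex_of_real (cos (t * c i p))"
    let ?G = "\<lambda>i. \<Prod>p\<in>I i. complex_of_real (exp (- (t * c i p)\<^sup>2 / 2))"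
    have char: "char (distr M borel (\<lambda>w. \<Sum>p\<in>I i. c i p * f p w)) t = ?C i" for i
    proof -
      have "indep_vars (\<lambda>_. borel) (\<lambda>p w. c i p * f p w) (I i)"
        by (rule indep_vars_compose2[OF indep_vars_subset[OF indep_primes]]) (use I(2) in auto)
      then have "char (distr M borel (\<lambda>w. \<Sum>p\<in>I i. c i p * f p w)) t = (\<Prod>p\<in>I i. char (distr M borel (\<lambda>w. c i p * f p w)) t)"
        by (rule char_distr_sum)
      also have "\<dots> = ?C i" by (intro prod.cong refl char_prime_term I(2))
      finally show ?thesis .
    qed
    have bound: "norm (?C i - ?G i) \<le> t ^ 4 * (b i)\<^sup>2 * (\<Sum>p\<in>I i. (c i p)\<^sup>2)" for i
    proof -
      have "norm (?C i - ?G i) \<le> (\<Sum>p\<in>I i. norm (complex_of_real (cos (t * c i p)) - complex_of_real (exp (- (t * c i p)\<^sup>2 / 2))))"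
        by (rule norm_prod_diff) (auto simp: norm_of_real)
      also have "\<dots> \<le> (\<Sum>p\<in>I i. t ^ 4 * (b i)\<^sup>2 * (c i p)\<^sup>2)"
      proof (rule sum_mono)
        fix p assume p: "p \<in> I i"
        have "norm (complex_of_real (cos (t * c i p)) - complex_of_real (exp (- (t * c i p)\<^sup>2 / 2))) \<le> (t * c i p) ^ 4"
          unfolding of_real_diff[symmetric] norm_of_real by (rule cos_gaussian_approx)
        also have "\<dots> = t ^ 4 * (c i p)\<^sup>2 * (c i p)\<^sup>2"
          by (simp add: power_mult_distrib power4_eq_xxxx power2_eq_square)
        also have "\<dots> \<le> t ^ 4 * (b i)\<^sup>2 * (c i p)\<^sup>2"
          using power_mono[OF small(1)[OF p], of 2] by (intro mult_right_mono mult_left_mono) auto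
        finally show "norm (complex_of_real (cos (t * c i p)) - complex_of_real (exp (- (t * c i p)\<^sup>2 / 2))) \<le> t ^ 4 * (b i)\<^sup>2 * (c i p)\<^sup>2" .
      qed
      finally show ?thesis by (simp add: sum_distrib_left)
    qed
    have "(\<lambda>i. t ^ 4 * (b i)\<^sup>2 * (\<Sum>p\<in>I i. (c i p)\<^sup>2)) \<longlonglongrightarrow> t ^ 4 * 0\<^sup>2 * \<tau>"
      by (intro tendsto_intros small(2) var)
    then have d: "(\<lambda>i. ?C i - ?G i) \<longlonglongrightarrow> 0"
      by (intro Lim_null_comparison[OF always_eventually[OF allI[OF bound]]]) simp
    have G: "?G i = complex_of_real (exp (- (t\<^sup>2 * (\<Sum>p\<in>I i. (c i p)\<^sup>2) / 2)))" for i
    proof -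
      have "(\<Sum>p\<in>I i. - (t * c i p)\<^sup>2 / 2) = - (t\<^sup>2 * (\<Sum>p\<in>I i. (c i p)\<^sup>2) / 2)"
        by (simp add: power_mult_distrib sum_negf sum_divide_distrib sum_distrib_left)
      then show ?thesis by (simp only: of_real_prod[symmetric] exp_sum[OF I(1), symmetric])
    qed
    have "?G \<longlonglongrightarrow> complex_of_real (exp (- (t\<^sup>2 * \<tau> / 2)))"
      unfolding G by (intro tendsto_intros var) auto
    from tendsto_add[OF d this]
    have "?C \<longlonglongrightarrow> complex_of_real (exp (- (t\<^sup>2 * \<tau> / 2)))" by simp
    moreover have "char (distr N borel V) t = complex_of_real (exp (- (t\<^sup>2 * \<tau> / 2)))"
      using char_centered_normal[OF N V] \<tau> by (simp add: power_mult_distrib)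
    ultimately show "(\<lambda>i. char (distr M borel (\<lambda>w. \<Sum>p\<in>I i. c i p * f p w)) t) \<longlonglongrightarrow> char (distr N borel V) t"
      by (simp add: char)
  qed
qed

end

section \<open>The functional limit theorem\<close>

lemma (in prob_space) indep_vars_prefixes:
  assumes "\<And>k :: nat. indep_vars M' X {..<k}"
  shows "indep_vars M' X UNIV"
proof -
  have "indep_sets (\<lambda>i. {X i -` A \<inter> space M | A. A \<in> sets (M' i)}) UNIV"
    unfolding indep_sets_finite_index_sets[of _ UNIV]
  proof (intro allI impI)
    fix J :: "nat set" assume "finite J" 
    then obtain k where "J \<subseteq> {..<k}" by (metis finite_nat_iff_bounded)
    then show "indep_sets (\<lambda>i. {X i -` A \<inter> space M | A. A \<in> sets (M' i)}) J"
      using assms[of k] unfolding indep_vars_def2 by (blast intro: indep_sets_mono_index)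
  qed
  moreover have "random_variable (M' i) (X i)" for i
    using assms[of "Suc i"] unfolding indep_vars_def2 by auto
  ultimately show ?thesis unfolding indep_vars_def2 by blast
qed

text \<open>The paths are controlled off a null set only, so measurability is available only in the completed space.\<close>

lemma measurable_completion_off_null_set:
  assumes h: "h \<in> measurable M L" and N: "N \<in> null_sets M"
    and eq: "\<And>w. w \<in> space M - N \<Longrightarrow> X w = h w" and X: "\<And>w. w \<in> N \<Longrightarrow> X w \<in> space L"
  shows "X \<in> measurable (completion M) L"
proof (rule measurableI)
  fix A assume A: "A \<in> sets L"
  have split: "X -` A \<inter> space M = (h -` A \<inter> space M - N) \<union> (X -` A \<inter> space M \<inter> N)"
    using eq by auto
  have good: "h -` A \<inter> space M - N \<in> sets (completion M)"
    using measurable_sets[OF h A] N by auto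
  have bad: "X -` A \<inter> space M \<inter> N \<in> null_sets (completion M)"
    by (rule null_sets_completion_subset[OF _ null_sets_completionI[OF N]]) auto
  show "X -` A \<inter> space (completion M) \<in> sets (completion M)"
    unfolding space_completion by (subst split) (rule sets.Un[OF good null_setsD2[OF bad]])
next
  fix w assume "w \<in> space (completion M)"
  then show "X w \<in> space L" using X[of w] eq[of w] measurable_space[OF h, of w] by (cases "w \<in> N") auto
qed

text \<open>What is used about Brownian motion: independence and normality of the increments along a dyadic grid, and the start at zero,
  by which these increments determine the values at the grid points.\<close>

lemma brownian_grid_increments:
  assumes B: "standard_brownian_motion N B"
  defines "V \<equiv> \<lambda>n j w. path_at (B w) (real (Suc j) / 2 ^ n) - path_at (B w) (real j / 2 ^ n)"
  shows "prob_space.indep_vars N (\<lambda>_. borel) (V n) UNIV"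
    and "distributed N lborel (V n j) (normal_density 0 (sqrt (1 / 2 ^ n)))"
    and "AE w in N. grid n (B w) = (\<lambda>j. \<Sum>l<j. V n l w)"
proof -
  interpret prob_space N using B by (simp add: standard_brownian_motion_def)
  have incr: "\<forall>(n :: nat) (\<tau> :: nat \<Rightarrow> real). 0 \<le> \<tau> 0 \<and> (\<forall>i<n. \<tau> i < \<tau> (Suc i)) \<longrightarrow>
      indep_vars (\<lambda>_. borel) (\<lambda>i \<omega>. path_at (B \<omega>) (\<tau> (Suc i)) - path_at (B \<omega>) (\<tau> i)) {..<n}"
    using B unfolding standard_brownian_motion_def by (elim conjE)
  have normal: "\<forall>s t. 0 \<le> s \<and> s < t \<longrightarrow>
      distributed N lborel (\<lambda>\<omega>. path_at (B \<omega>) t - path_at (B \<omega>) s) (normal_density 0 (sqrt (t - s)))"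
    using B unfolding standard_brownian_motion_def by (elim conjE)
  show "indep_vars (\<lambda>_. borel) (V n) UNIV"
  proof (rule indep_vars_prefixes)
    fix k
    have pre: "0 \<le> real 0 / 2 ^ n \<and> (\<forall>i<k. real i / 2 ^ n < real (Suc i) / 2 ^ n)"
      by (auto intro: divide_strict_right_mono)
    show "indep_vars (\<lambda>_. borel) (V n) {..<k}"
      unfolding V_def by (rule mp[OF spec[OF spec[OF incr, of k], of "\<lambda>i. real i / 2 ^ n"] pre])
  qed
  have "real j / 2 ^ n < real (Suc j) / 2 ^ n" by (intro divide_strict_right_mono) auto
  then have "distributed N lborel (V n j) (normal_density 0 (sqrt (real (Suc j) / 2 ^ n - real j / 2 ^ n)))"
    using spec[OF spec[OF normal, of "real j / 2 ^ n"], of "real (Suc j) / 2 ^ n"] unfolding V_def by simp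
  moreover have "real (Suc j) / 2 ^ n - real j / 2 ^ n = 1 / 2 ^ n" by (simp add: add_divide_distrib)
  ultimately show "distributed N lborel (V n j) (normal_density 0 (sqrt (1 / 2 ^ n)))" by (simp only:)
  have "AE w in N. path_at (B w) 0 = 0" using B by (simp add: standard_brownian_motion_def)
  then show "AE w in N. grid n (B w) = (\<lambda>j. \<Sum>l<j. V n l w)"
  proof eventually_elim
    case (elim w)
    show ?case
    proof
      fix j
      have "(\<Sum>l<j. V n l w) = path_at (B w) (real j / 2 ^ n) - path_at (B w) (real 0 / 2 ^ n)"
        unfolding V_def by (rule sum_lessThan_telescope)
      then show "grid n (B w) j = (\<Sum>l<j. V n l w)" using elim by (simp add: grid_def)
    qed
  qed
qed

lemma powr_antimono_exponent:
  fixes s :: real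
  assumes "0 < s" "s < 1" "a \<le> b"
  shows "s powr b \<le> s powr a"
  using assms by (intro powr_mono') auto

lemma ln_powr_quotient:
  fixes s :: real
  assumes "0 < s"
  shows "ln (s powr a / s powr b) = (b - a) * ln (1 / s)"
  using assms by (simp add: ln_div algebra_simps)

lemma ln_inverse_at_top:
  fixes s :: "nat \<Rightarrow> real"
  assumes "\<And>i. 0 < s i" "s \<longlonglongrightarrow> 0"
  shows "filterlim (\<lambda>i. ln (1 / s i)) at_top sequentially"
proof -
  have "\<forall>i. s i \<in> {0<..} \<and> s i \<noteq> 0" using assms(1) by (metis greaterThan_iff less_irrefl)
  then have "filterlim s (at_right 0) sequentially"
    using assms(2) unfolding filterlim_at by (auto intro: always_eventually)
  moreover have "filterlim (\<lambda>x::real. ln (1 / x)) at_top (at_right 0)" by real_asymp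
  ultimately show ?thesis by (rule filterlim_compose[rotated])
qed

lemma continuous_on_powr_exponent: "0 < s \<Longrightarrow> continuous_on {0..} (\<lambda>t. s powr t)" for s :: real
  by (intro continuous_intros) auto

lemma exponent_facts:
  fixes s r t :: real
  assumes "0 < s" "s < 1" "0 \<le> r" "r \<le> t"
  shows "0 < s powr t" "s powr t \<le> s powr r" "s powr r \<le> 1" "ln (s powr r / s powr t) = (t - r) * ln (1 / s)"
proof -
  show "0 < s powr t" using assms by simp
  show "s powr t \<le> s powr r" by (rule powr_antimono_exponent) (use assms in auto)
  show "s powr r \<le> 1" using powr_antimono_exponent[of s 0 r] assms by simp
  show "ln (s powr r / s powr t) = (t - r) * ln (1 / s)" using assms by (intro ln_powr_quotient)
qed

context rademacher_rmf
begin

text \<open>The part of the normalised increment over the \<open>j\<close>-th dyadic interval of level \<open>n\<close> that comes from its own block of primes.\<close>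

definition block_sum :: "real \<Rightarrow> nat \<Rightarrow> nat \<Rightarrow> 'a \<Rightarrow> real" where
  "block_sum s n j w =
    (\<Sum>p\<in>prime_block (s powr (real (Suc j) / 2 ^ n)) (s powr (real j / 2 ^ n)).
      prime_weight (s powr (real (Suc j) / 2 ^ n)) (s powr (real j / 2 ^ n)) p / sqrt (ln (1 / s)) * f p w)"

text \<open>The blocks of different intervals are disjoint sets of primes.\<close>

lemma indep_block_sums:
  assumes s: "0 < s" "s < 1"
  shows "indep_vars (\<lambda>_. borel) (block_sum s n) UNIV"
proof -
  let ?K = "\<lambda>j. prime_block (s powr (real (Suc j) / 2 ^ n)) (s powr (real j / 2 ^ n))"
  let ?c = "\<lambda>j p. prime_weight (s powr (real (Suc j) / 2 ^ n)) (s powr (real j / 2 ^ n)) p / sqrt (ln (1 / s))"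
  have disj: "?K i \<inter> ?K j = {}" if ij: "i < j" for i j
  proof -
    have "s powr (real j / 2 ^ n) \<le> s powr (real (Suc i) / 2 ^ n)"
      using ij by (intro powr_antimono_exponent s divide_right_mono) auto
    then have "1 / s powr (real (Suc i) / 2 ^ n) \<le> 1 / s powr (real j / 2 ^ n)"
      using s by (intro divide_left_mono) auto
    then show ?thesis by (auto simp: prime_block_def)
  qed
  have "disjoint_family_on ?K UNIV"
    unfolding disjoint_family_on_def by (metis disj inf_commute nat_neq_iff)
  then have "indep_vars (\<lambda>j. PiM (?K j) (\<lambda>_. borel)) (\<lambda>j w. restrict (\<lambda>p. f p w) (?K j)) UNIV"
    by (intro indep_vars_restrict[OF indep_primes]) (auto simp: prime_block_def)
  then have "indep_vars (\<lambda>_. borel) (\<lambda>j w. \<Sum>p\<in>?K j. ?c j p * restrict (\<lambda>p. f p w) (?K j) p) UNIV"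
    by (rule indep_vars_compose2[where Y = "\<lambda>j x. \<Sum>p\<in>?K j. ?c j p * x p"])
      (intro borel_measurable_sum borel_measurable_times borel_measurable_const measurable_component_singleton)
  moreover have "(\<Sum>p\<in>?K j. ?c j p * restrict (\<lambda>p. f p w) (?K j) p) = block_sum s n j w" for j w
    unfolding block_sum_def by (intro sum.cong) auto
  ultimately show ?thesis by (simp only:)
qed

lemma abs_prime_weight_le_1:
  assumes "u > 0" "v > 0"
  shows "\<bar>prime_weight u v p\<bar> \<le> 1"
proof (cases "prime p")
  case True
  have "0 \<le> 1 / real p powr (1 / 2 + a) \<and> 1 / real p powr (1 / 2 + a) \<le> 1" if "a > 0" for a
    using that prime_gt_0_nat[OF True] by (auto intro!: ge_one_powr_ge_zero)
  from this[OF assms(1)] this[OF assms(2)]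
  have "\<bar>1 / real p powr (1 / 2 + u) - 1 / real p powr (1 / 2 + v)\<bar> \<le> 1" by linarith
  then show ?thesis using True by (simp add: prime_weight_def)
qed (simp add: prime_weight_def)

text \<open>The variance of the unnormalised block sum is \<open>2\<^sup>-\<^sup>n log (1/s) + O(1)\<close> and its weights are at most \<open>1\<close>.\<close>

lemma block_sum_clt:
  fixes s :: "nat \<Rightarrow> real"
  assumes N: "prob_space N" and V: "distributed N lborel V (normal_density 0 (sqrt (1 / 2 ^ n)))"
    and s: "\<And>i. 0 < s i" "\<And>i. s i < 1" "s \<longlonglongrightarrow> 0"
  shows "weak_conv_m (\<lambda>i. distr M borel (block_sum (s i) n j)) (distr N borel V)"
proof -
  define u where "u i = s i powr (real (Suc j) / 2 ^ n)" for i
  define v where "v i = s i powr (real j / 2 ^ n)" for i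
  define L where "L i = ln (1 / s i)" for i
  have Lpos: "L i > 0" for i using s(1,2)[of i] by (simp add: L_def ln_div)
  have L: "filterlim L at_top sequentially" unfolding L_def by (rule ln_inverse_at_top[OF s(1,3)])
  have sqrtL: "(\<lambda>i. 1 / sqrt (L i)) \<longlonglongrightarrow> 0"
    by (intro real_tendsto_divide_at_top[OF tendsto_const] filterlim_compose[OF sqrt_at_top L])
  have uv: "0 < u i" "u i \<le> v i" "v i \<le> 1" for i
  proof -
    show "0 < u i" using s(1)[of i] by (simp add: u_def)
    show "u i \<le> v i" unfolding u_def v_def by (intro powr_antimono_exponent s divide_right_mono) auto
    have "v i \<le> s i powr 0" unfolding v_def by (intro powr_antimono_exponent s) auto
    then show "v i \<le> 1" using s(1)[of i] by simp
  qed
  have lnvu: "ln (v i / u i) = 1 / 2 ^ n * L i" for i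
  proof -
    have "ln (v i / u i) = (real (Suc j) / 2 ^ n - real j / 2 ^ n) * L i"
      unfolding u_def v_def L_def by (rule ln_powr_quotient[OF s(1)])
    then show ?thesis by (simp add: add_divide_distrib)
  qed
  let ?c = "\<lambda>i p. prime_weight (u i) (v i) p / sqrt (L i)"
  have "weak_conv_m (\<lambda>i. distr M borel (\<lambda>w. \<Sum>p\<in>prime_block (u i) (v i). ?c i p * f p w)) (distr N borel V)"
  proof (rule prime_sum_clt[OF N V])
    show "\<bar>?c i p\<bar> \<le> 1 / sqrt (L i)" for i p
      using abs_prime_weight_le_1[of "u i" "v i" p] uv[of i] Lpos[of i] by (auto simp: abs_divide intro!: divide_right_mono)
    have sum: "(\<Sum>p\<in>prime_block (u i) (v i). (?c i p)\<^sup>2) = (\<Sum>p\<in>prime_block (u i) (v i). (prime_weight (u i) (v i) p)\<^sup>2) / L i" for i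
      using Lpos[of i] by (simp add: power_divide sum_divide_distrib)
    have close: "norm ((\<Sum>p\<in>prime_block (u i) (v i). (?c i p)\<^sup>2) - 1 / 2 ^ n) \<le> 2 * block_const / L i" for i
    proof -
      let ?S = "\<Sum>p\<in>prime_block (u i) (v i). (prime_weight (u i) (v i) p)\<^sup>2"
      have "?S / L i - 1 / 2 ^ n = (?S - ln (v i / u i)) / L i"
        using Lpos[of i] by (simp add: lnvu diff_divide_distrib)
      then have "norm (?S / L i - 1 / 2 ^ n) = \<bar>?S - ln (v i / u i)\<bar> / L i"
        using Lpos[of i] by (simp add: abs_divide)
      also have "\<dots> \<le> 2 * block_const / L i"
        using Lpos[of i] by (intro divide_right_mono block_sum_asymptotics uv) auto
      finally show ?thesis unfolding sum .
    qed
    have "(\<lambda>i. 2 * block_const / L i) \<longlonglongrightarrow> 0"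
      by (intro real_tendsto_divide_at_top[OF tendsto_const] L)
    then have "(\<lambda>i. (\<Sum>p\<in>prime_block (u i) (v i). (?c i p)\<^sup>2) - 1 / 2 ^ n) \<longlonglongrightarrow> 0"
      by (rule Lim_null_comparison[OF always_eventually[OF allI[OF close]]])
    then show "(\<lambda>i. \<Sum>p\<in>prime_block (u i) (v i). (?c i p)\<^sup>2) \<longlonglongrightarrow> 1 / 2 ^ n" by (rule LIM_zero_cancel)
    show "prime p" if "p \<in> prime_block (u i) (v i)" for i p using that by (simp add: prime_block_def)
    show "(\<lambda>i. 1 / sqrt (L i)) \<longlonglongrightarrow> 0" by (rule sqrtL)
  qed simp_all
  then show ?thesis unfolding block_sum_def[abs_def] u_def v_def L_def .
qed

definition log_remainder_bound :: real where
  "log_remainder_bound = 4 * zeta_sum (3 / 2) + zeta_sum 2 / 2"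

text \<open>The term \<open>- \<Sum>\<^sub>p p\<^sup>-\<^sup>1\<^sup>-\<^sup>2\<^sup>u / 2\<close> in the expansion of the Euler product cancels against half the logarithm of the zeta function.\<close>

lemma log_remainder:
  assumes w: "regular w" and u: "u > 0"
  shows "\<bar>euler_log (\<lambda>n. f n w) (1 / 2 + u) + ln (zeta_sum (1 + 2 * u)) / 2 - prime_series u w\<bar> \<le> log_remainder_bound"
proof -
  have r: "\<And>p. prime p \<Longrightarrow> f p w = 1 \<or> f p w = - 1" "subpolynomial_growth (prime_part (\<lambda>n. f n w))"
    using w by (auto simp: regular_def)
  have "\<bar>euler_log (\<lambda>n. f n w) (1 / 2 + u) - prime_series u w + prime_zeta (1 + 2 * u) / 2\<bar> \<le> 4 * zeta_sum (3 / 2)"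
    unfolding prime_series_def by (rule euler_log_expansion[OF r u])
  moreover have "\<bar>ln (zeta_sum (1 + 2 * u)) - prime_zeta (1 + 2 * u)\<bar> \<le> zeta_sum 2"
    using u by (intro prime_zeta_log_zeta) auto
  ultimately show ?thesis unfolding log_remainder_bound_def abs_le_iff by (auto simp: field_simps)
qed

context
  fixes G :: "'a set"
  assumes G_sets: "G \<in> sets M" and G_AE: "AE w in M. w \<in> G"
    and G_regular: "\<And>w. w \<in> G \<Longrightarrow> regular w"
    and G_euler: "\<And>w u. w \<in> G \<Longrightarrow> u > 0 \<Longrightarrow> dirichlet_sum f w (1 / 2 + u) = exp (euler_log (\<lambda>n. f n w) (1 / 2 + u))"
begin

text \<open>The process with the bounded remainder dropped and shifted to start at zero; both changes vanish under the normalisation.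
  On the exceptional set it is the zero path, which makes it Borel measurable without completion.\<close>

definition prime_path :: "real \<Rightarrow> 'a \<Rightarrow> cpath" where
  "prime_path s w = cpath_of (\<lambda>t. if w \<in> G then (prime_series (s powr t) w - prime_series 1 w) / sqrt (ln (1 / s)) else 0)"

text \<open>A Borel measurable modification of the logarithmic process.\<close>

definition log_path :: "real \<Rightarrow> 'a \<Rightarrow> cpath" where
  "log_path s w = (if w \<in> G then log_process f s w else cpath_of (\<lambda>_. 0))"

lemma prime_path_at:
  assumes s: "0 < s" and t: "t \<ge> 0"
  shows "path_at (prime_path s w) t = (if w \<in> G then (prime_series (s powr t) w - prime_series 1 w) / sqrt (ln (1 / s)) else 0)"
  unfolding prime_path_def
proof (rule path_at_cpath_of[OF _ t])
  show "continuous_on {0..} (\<lambda>t. if w \<in> G then (prime_series (s powr t) w - prime_series 1 w) / sqrt (ln (1 / s)) else 0)"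
  proof (cases "w \<in> G")
    case True
    have "continuous_on {0..} (\<lambda>t. prime_series (s powr t) w)"
      by (rule continuous_on_compose2[OF prime_series_continuous[OF G_regular[OF True]] continuous_on_powr_exponent[OF s]])
        (use s in auto)
    then show ?thesis using True by (simp add: divide_inverse) (intro continuous_intros)
  qed simp
qed

lemma prime_path_measurable:
  assumes s: "0 < s"
  shows "prime_path s \<in> borel_measurable M"
proof (rule borel_measurable_cpath)
  fix t :: real assume t: "t \<ge> 0"
  show "(\<lambda>w. path_at (prime_path s w) t) \<in> borel_measurable M"
    unfolding prime_path_at[OF s t] by (intro measurable_If_set) (use G_sets in auto)
qed

lemma log_process_at:
  assumes s: "0 < s" and t: "t \<ge> 0" and w: "w \<in> G"
  shows "path_at (log_process f s w) t = 1 / sqrt (ln (1 / s)) *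
     (ln (dirichlet_sum f w (1 / 2 + s powr t)) + ln (zeta_real (1 + 2 * s powr t)) / 2)"
    and "path_at (log_process f s w) t = 1 / sqrt (ln (1 / s)) *
     (euler_log (\<lambda>n. f n w) (1 / 2 + s powr t) + ln (zeta_sum (1 + 2 * s powr t)) / 2)"
proof -
  let ?F = "\<lambda>t. 1 / sqrt (ln (1 / s)) * (ln (dirichlet_sum f w (1 / 2 + s powr t)) + ln (zeta_real (1 + 2 * s powr t)) / 2)"
  let ?E = "\<lambda>t. 1 / sqrt (ln (1 / s)) * (euler_log (\<lambda>n. f n w) (1 / 2 + s powr t) + ln (zeta_sum (1 + 2 * s powr t)) / 2)"
  have z: "zeta_real r = zeta_sum r" for r
    unfolding zeta_real_def dseries_def by (simp only: powr_minus_divide)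
  have eq: "?F = ?E"
    using G_euler[OF w] s by (simp add: z fun_eq_iff)
  have r: "\<And>p. prime p \<Longrightarrow> f p w = 1 \<or> f p w = - 1" "subpolynomial_growth (prime_part (\<lambda>n. f n w))"
    using G_regular[OF w] by (auto simp: regular_def)
  note powr = continuous_on_powr_exponent[OF s]
  have c1: "continuous_on {0..} (\<lambda>t. euler_log (\<lambda>n. f n w) (1 / 2 + s powr t))"
    by (rule continuous_on_compose2[OF euler_log_continuous[OF r] powr]) (use s in auto)
  have c2: "continuous_on {0..} (\<lambda>t. zeta_sum (1 + 2 * s powr t))"
    by (rule continuous_on_compose2[OF zeta_sum_continuous]) (use s in \<open>auto intro!: continuous_intros powr\<close>)
  have c3: "zeta_sum (1 + 2 * s powr t) \<noteq> 0" for t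
    using zeta_sum_ge_1[of "1 + 2 * s powr t"] s by auto
  have cE: "continuous_on {0..} ?E"
    by (intro continuous_on_mult continuous_on_const continuous_on_add c1 continuous_on_divide continuous_on_ln c2 ballI c3) simp
  show 1: "path_at (log_process f s w) t = ?F t"
    unfolding log_process_def by (rule path_at_cpath_of[OF cE[folded eq] t])
  show "path_at (log_process f s w) t = ?E t" unfolding 1 using fun_cong[OF eq, of t] .
qed

lemma log_path_measurable:
  assumes s: "0 < s"
  shows "log_path s \<in> borel_measurable M"
proof (rule borel_measurable_cpath)
  fix t :: real assume t: "t \<ge> 0"
  have d: "(\<lambda>w. dirichlet_sum f w r) \<in> borel_measurable M" for r
    unfolding dirichlet_sum_def
    by (intro borel_measurable_suminf borel_measurable_divide borel_measurable_const rv_f) auto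
  have "(\<lambda>w. path_at (log_path s w) t) = (\<lambda>w. if w \<in> G then 1 / sqrt (ln (1 / s)) *
     (ln (dirichlet_sum f w (1 / 2 + s powr t)) + ln (zeta_real (1 + 2 * s powr t)) / 2) else 0)"
  proof
    fix w
    have "path_at (cpath_of (\<lambda>_. 0)) t = 0" by (rule path_at_cpath_of) (use t in auto)
    then show "path_at (log_path s w) t = (if w \<in> G then 1 / sqrt (ln (1 / s)) *
     (ln (dirichlet_sum f w (1 / 2 + s powr t)) + ln (zeta_real (1 + 2 * s powr t)) / 2) else 0)"
      using log_process_at(1)[OF s t, of w] by (simp add: log_path_def)
  qed
  moreover have "\<dots> \<in> borel_measurable M"
    by (intro measurable_If_set borel_measurable_times borel_measurable_add borel_measurable_ln d borel_measurable_const)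
      (use G_sets in auto)
  ultimately show "(\<lambda>w. path_at (log_path s w) t) \<in> borel_measurable M" by (simp only:)
qed

lemma log_path_prime_path:
  assumes s: "0 < s" "s < 1" and w: "w \<in> G"
  shows "cdist (log_path s w) (prime_path s w) \<le> (log_remainder_bound + \<bar>prime_series 1 w\<bar>) / sqrt (ln (1 / s))"
proof (rule cdist_le_uniform)
  fix t :: real assume t: "0 \<le> t"
  let ?u = "s powr t"
  have L: "0 \<le> sqrt (ln (1 / s))" using s by (simp add: ln_div)
  let ?E = "euler_log (\<lambda>n. f n w) (1 / 2 + ?u) + ln (zeta_sum (1 + 2 * ?u)) / 2"
  have "path_at (log_path s w) t - path_at (prime_path s w) t = (?E - (prime_series ?u w - prime_series 1 w)) / sqrt (ln (1 / s))"
    using w log_process_at(2)[OF s(1) t w] prime_path_at[OF s(1) t] by (simp add: log_path_def diff_divide_distrib)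
  also have "\<bar>\<dots>\<bar> = \<bar>(?E - prime_series ?u w) + prime_series 1 w\<bar> / sqrt (ln (1 / s))"
    by (simp only: abs_divide abs_of_nonneg[OF L] diff_diff_eq2 diff_add_eq)
  also have "\<dots> \<le> (log_remainder_bound + \<bar>prime_series 1 w\<bar>) / sqrt (ln (1 / s))"
    using log_remainder[OF G_regular[OF w], of ?u] s
    by (intro divide_right_mono L order_trans[OF abs_triangle_ineq] add_right_mono) auto
  finally show "\<bar>path_at (log_path s w) t - path_at (prime_path s w) t\<bar> \<le> (log_remainder_bound + \<bar>prime_series 1 w\<bar>) / sqrt (ln (1 / s))" .
qed

text \<open>The logarithmic time change turns \<open>log (v / u)\<close> into \<open>(t - r) log (1/s)\<close>, and the normalisation cancels \<open>log (1/s)\<close>; the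
  bound is uniform in \<open>s\<close>.\<close>

lemma prime_path_fourth_moment:
  assumes s: "0 < s" "s < 1" and rt: "0 \<le> r" "r \<le> t"
  shows "(\<integral>\<^sup>+w. ennreal ((path_at (prime_path s w) t - path_at (prime_path s w) r) ^ 4) \<partial>M)
    \<le> ennreal (3 * block_const\<^sup>2 * (t - r)\<^sup>2)"
proof -
  let ?L = "ln (1 / s)"
  let ?u = "s powr t" and ?v = "s powr r"
  have L: "?L > 0" using s by (simp add: ln_div)
  have t: "t \<ge> 0" using rt by simp
  note e = exponent_facts[OF s rt]
  have pt: "(path_at (prime_path s w) t - path_at (prime_path s w) r) ^ 4 \<le> 1 / ?L\<^sup>2 * (prime_series ?u w - prime_series ?v w) ^ 4" for w
  proof (cases "w \<in> G")
    case True
    then have "path_at (prime_path s w) t - path_at (prime_path s w) r = (prime_series ?u w - prime_series ?v w) / sqrt ?L"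
      using prime_path_at[OF s(1) t, of w] prime_path_at[OF s(1) rt(1), of w] by (simp add: diff_divide_distrib)
    moreover have "sqrt ?L ^ 4 = ?L\<^sup>2"
      using L by (simp add: power4_eq_xxxx power2_eq_square)
    ultimately show ?thesis by (simp add: power_divide)
  next
    case False
    then show ?thesis using prime_path_at[OF s(1) t, of w] prime_path_at[OF s(1) rt(1), of w] by simp
  qed
  have "(\<integral>\<^sup>+w. ennreal ((path_at (prime_path s w) t - path_at (prime_path s w) r) ^ 4) \<partial>M)
     \<le> (\<integral>\<^sup>+w. ennreal (1 / ?L\<^sup>2) * ennreal ((prime_series ?u w - prime_series ?v w) ^ 4) \<partial>M)"
  proof (rule nn_integral_mono)
    fix w
    have "ennreal ((path_at (prime_path s w) t - path_at (prime_path s w) r) ^ 4)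
        \<le> ennreal (1 / ?L\<^sup>2 * (prime_series ?u w - prime_series ?v w) ^ 4)"
      by (rule ennreal_leI[OF pt])
    also have "\<dots> = ennreal (1 / ?L\<^sup>2) * ennreal ((prime_series ?u w - prime_series ?v w) ^ 4)"
      by (rule ennreal_mult') simp
    finally show "ennreal ((path_at (prime_path s w) t - path_at (prime_path s w) r) ^ 4)
        \<le> ennreal (1 / ?L\<^sup>2) * ennreal ((prime_series ?u w - prime_series ?v w) ^ 4)" .
  qed
  also have "\<dots> = ennreal (1 / ?L\<^sup>2) * (\<integral>\<^sup>+w. ennreal ((prime_series ?u w - prime_series ?v w) ^ 4) \<partial>M)"
    by (rule nn_integral_cmult) measurable
  also have "\<dots> \<le> ennreal (1 / ?L\<^sup>2) * ennreal (3 * (block_const * ln (?v / ?u))\<^sup>2)"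
    by (intro mult_left_mono prime_series_increment_fourth_moment e) auto
  also have "\<dots> = ennreal (1 / ?L\<^sup>2 * (3 * (block_const * ln (?v / ?u))\<^sup>2))"
    by (rule ennreal_mult'[symmetric]) simp
  also have "1 / ?L\<^sup>2 * (3 * (block_const * ln (?v / ?u))\<^sup>2) = 3 * block_const\<^sup>2 * (t - r)\<^sup>2"
    unfolding e(4) using L by (simp add: power_mult_distrib)
  finally show ?thesis .
qed

text \<open>In mean square, each unnormalised increment differs from its block sum by a bounded amount, and the normalisation tends to infinity.\<close>

lemma prime_path_block_error:
  assumes s: "0 < s" "s < 1"
  shows "(\<integral>\<^sup>+w. ennreal \<bar>grid n (prime_path s w) j - (\<Sum>l<j. block_sum s n l w)\<bar> \<partial>M)
    \<le> ennreal (real j * (1 + block_const) / sqrt (ln (1 / s)))"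
proof -
  let ?L = "ln (1 / s)"
  let ?u = "\<lambda>l. s powr (real (Suc l) / 2 ^ n)" and ?v = "\<lambda>l. s powr (real l / 2 ^ n)"
  let ?D = "\<lambda>l w. prime_series (?u l) w - prime_series (?v l) w - (\<Sum>p\<in>prime_block (?u l) (?v l). prime_weight (?u l) (?v l) p * f p w)"
  have L: "sqrt ?L > 0" using s by (simp add: ln_div)
  have bc: "block_const \<ge> 0" by (rule block_const_nonneg)
  have Dm [measurable]: "?D l \<in> borel_measurable M" for l
    by (intro borel_measurable_diff prime_series_measurable borel_measurable_sum borel_measurable_times borel_measurable_const rv_prime)
      (auto simp: prime_block_def)
  have pt: "\<bar>grid n (prime_path s w) j - (\<Sum>l<j. block_sum s n l w)\<bar> \<le> 1 / sqrt ?L * (\<Sum>l<j. \<bar>?D l w\<bar>)" if w: "w \<in> G" for w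
  proof -
    have at: "path_at (prime_path s w) (real k / 2 ^ n) = (prime_series (s powr (real k / 2 ^ n)) w - prime_series 1 w) / sqrt ?L" for k
      using prime_path_at[OF s(1), of "real k / 2 ^ n" w] w by simp
    have "(\<Sum>l<j. path_at (prime_path s w) (real (Suc l) / 2 ^ n) - path_at (prime_path s w) (real l / 2 ^ n))
        = path_at (prime_path s w) (real j / 2 ^ n) - path_at (prime_path s w) (real 0 / 2 ^ n)"
      by (rule sum_lessThan_telescope)
    then have "grid n (prime_path s w) j = (\<Sum>l<j. path_at (prime_path s w) (real (Suc l) / 2 ^ n) - path_at (prime_path s w) (real l / 2 ^ n))"
      using at[of 0] s by (simp add: grid_def)
    also have "\<dots> = (\<Sum>l<j. (prime_series (?u l) w - prime_series (?v l) w) / sqrt ?L)"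
      unfolding at by (intro sum.cong refl) (simp add: diff_divide_distrib)
    finally have diff: "grid n (prime_path s w) j - (\<Sum>l<j. block_sum s n l w) = (\<Sum>l<j. 1 / sqrt ?L * ?D l w)"
      unfolding block_sum_def by (simp add: sum_subtractf sum_divide_distrib diff_divide_distrib)
    have "\<bar>grid n (prime_path s w) j - (\<Sum>l<j. block_sum s n l w)\<bar> \<le> (\<Sum>l<j. \<bar>1 / sqrt ?L * ?D l w\<bar>)"
      unfolding diff by (rule sum_abs)
    also have "\<dots> = (\<Sum>l<j. 1 / sqrt ?L * \<bar>?D l w\<bar>)"
    proof -
      have "\<bar>1 / sqrt ?L\<bar> = 1 / sqrt ?L" using L by simp
      then show ?thesis by (simp only: abs_mult)
    qed
    finally show ?thesis by (simp only: sum_distrib_left)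
  qed
  have Dl: "(\<integral>\<^sup>+w. ennreal \<bar>?D l w\<bar> \<partial>M) \<le> ennreal (1 + block_const)" for l
  proof -
    have "(\<integral>\<^sup>+w. ennreal \<bar>?D l w\<bar> \<partial>M) \<le> (\<integral>\<^sup>+w. 1 + ennreal ((?D l w)\<^sup>2) \<partial>M)"
      by (intro nn_integral_mono ennreal_abs_le_square)
    also have "\<dots> = (\<integral>\<^sup>+w. 1 \<partial>M) + (\<integral>\<^sup>+w. ennreal ((?D l w)\<^sup>2) \<partial>M)"
      by (rule nn_integral_add) measurable
    also have "(\<integral>\<^sup>+w. 1 \<partial>M) = 1" by (simp add: emeasure_space_1)
    also have "1 + (\<integral>\<^sup>+w. ennreal ((?D l w)\<^sup>2) \<partial>M) \<le> 1 + ennreal block_const"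
    proof -
      have "0 \<le> real l / 2 ^ n" "real l / 2 ^ n \<le> real (Suc l) / 2 ^ n" by (auto intro: divide_right_mono)
      from exponent_facts[OF s this] show ?thesis
        by (intro add_left_mono prime_series_block_approximation)
    qed
    finally show ?thesis using bc by simp
  qed
  have "(\<integral>\<^sup>+w. ennreal \<bar>grid n (prime_path s w) j - (\<Sum>l<j. block_sum s n l w)\<bar> \<partial>M)
     \<le> (\<integral>\<^sup>+w. ennreal (1 / sqrt ?L) * (\<Sum>l<j. ennreal \<bar>?D l w\<bar>) \<partial>M)"
  proof (rule nn_integral_mono_AE)
    show "AE w in M. ennreal \<bar>grid n (prime_path s w) j - (\<Sum>l<j. block_sum s n l w)\<bar> \<le> ennreal (1 / sqrt ?L) * (\<Sum>l<j. ennreal \<bar>?D l w\<bar>)"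
      using G_AE
    proof eventually_elim
      case (elim w)
      have "ennreal \<bar>grid n (prime_path s w) j - (\<Sum>l<j. block_sum s n l w)\<bar> \<le> ennreal (1 / sqrt ?L * (\<Sum>l<j. \<bar>?D l w\<bar>))"
        by (rule ennreal_leI[OF pt[OF elim]])
      also have "\<dots> = ennreal (1 / sqrt ?L) * ennreal (\<Sum>l<j. \<bar>?D l w\<bar>)"
        using L by (intro ennreal_mult') simp
      also have "ennreal (\<Sum>l<j. \<bar>?D l w\<bar>) = (\<Sum>l<j. ennreal \<bar>?D l w\<bar>)" by (rule sum_ennreal[symmetric]) simp
      finally show ?case .
    qed
  qed
  also have "\<dots> = ennreal (1 / sqrt ?L) * (\<integral>\<^sup>+w. (\<Sum>l<j. ennreal \<bar>?D l w\<bar>) \<partial>M)"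
    by (rule nn_integral_cmult) measurable
  also have "(\<integral>\<^sup>+w. (\<Sum>l<j. ennreal \<bar>?D l w\<bar>) \<partial>M) = (\<Sum>l<j. \<integral>\<^sup>+w. ennreal \<bar>?D l w\<bar> \<partial>M)"
    by (rule nn_integral_sum) measurable
  also have "ennreal (1 / sqrt ?L) * (\<Sum>l<j. \<integral>\<^sup>+w. ennreal \<bar>?D l w\<bar> \<partial>M) \<le> ennreal (1 / sqrt ?L) * (\<Sum>l<j. ennreal (1 + block_const))"
    by (intro mult_left_mono sum_mono Dl) auto
  also have "(\<Sum>l<j. ennreal (1 + block_const)) = ennreal (real j * (1 + block_const))"
  proof -
    have "(\<Sum>l<j. ennreal (1 + block_const)) = ennreal (\<Sum>l<j. 1 + block_const)"
      by (rule sum_ennreal) (use bc in simp)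
    also have "(\<Sum>l<j. 1 + block_const) = real j * (1 + block_const)" by simp
    finally show ?thesis .
  qed
  also have "ennreal (1 / sqrt ?L) * ennreal (real j * (1 + block_const)) = ennreal (1 / sqrt ?L * (real j * (1 + block_const)))"
    using L by (intro ennreal_mult'[symmetric]) simp
  also have "1 / sqrt ?L * (real j * (1 + block_const)) = real j * (1 + block_const) / sqrt ?L" by simp
  finally show ?thesis .
qed

text \<open>A functional of the polygon is a continuous function of the increments along the grid. For the prime paths these increments may
  be replaced by the block sums, which are exactly independent, so that convergence of each of them is enough.\<close>

lemma prime_path_fdd:
  fixes s :: "nat \<Rightarrow> real"
  assumes B: "standard_brownian_motion N B"
    and s: "\<And>i. 0 < s i" "\<And>i. s i < 1" "s \<longlonglongrightarrow> 0"
    and \<Psi>: "cdist_lipschitz m \<Psi>" "\<And>x. \<bar>\<Psi> x\<bar> \<le> D"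
  shows "(\<lambda>i. \<integral>w. \<Psi> (polygon n (grid n (prime_path (s i) w))) \<partial>M) \<longlonglongrightarrow> (\<integral>w. \<Psi> (polygon n (grid n (B w))) \<partial>N)"
proof -
  interpret N: prob_space N using B by (simp add: standard_brownian_motion_def)
  have Bm: "B \<in> borel_measurable N" using B by (simp add: standard_brownian_motion_def)
  have m: "m \<ge> 0" using \<Psi>(1) by (simp add: cdist_lipschitz_def)
  note cont = cdist_lipschitz_continuous[OF \<Psi>(1)]
  have bc: "block_const \<ge> 0" by (rule block_const_nonneg)
  define V where "V = (\<lambda>j w. path_at (B w) (real (Suc j) / 2 ^ n) - path_at (B w) (real j / 2 ^ n))"
  have V: "N.indep_vars (\<lambda>_. borel) V UNIV"
    "\<And>j. distributed N lborel (V j) (normal_density 0 (sqrt (1 / 2 ^ n)))"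
    "AE w in N. grid n (B w) = (\<lambda>j. \<Sum>l<j. V l w)"
    unfolding V_def by (rule brownian_grid_increments[OF B])+
  \<comment> \<open>the functional as a function of the increments instead of the values\<close>
  define g where "g d = \<Psi> (polygon n (\<lambda>j. \<Sum>l<j. d l))" for d :: "nat \<Rightarrow> real"
  have gc: "continuous_on UNIV g"
  proof -
    have "continuous_on UNIV (\<lambda>d :: nat \<Rightarrow> real. \<lambda>j. \<Sum>l<j. d l)"
      by (intro continuous_on_coordinatewise_then_product continuous_on_sum continuous_on_product_coordinates)
    from continuous_on_compose2[OF continuous_on_polygon this]
    have "continuous_on UNIV (\<lambda>d :: nat \<Rightarrow> real. polygon n (\<lambda>j. \<Sum>l<j. d l))" by simp
    from continuous_on_compose2[OF cont this] show ?thesis unfolding g_def by simp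
  qed
  have gb: "\<bar>g d\<bar> \<le> D" for d unfolding g_def by (rule \<Psi>(2))
  have ind: "indep_vars (\<lambda>_. borel) (block_sum (s i) n) UNIV" for i by (intro indep_block_sums s)
  have Wm: "block_sum (s i) n j \<in> borel_measurable M" for i j using ind[of i] unfolding indep_vars_def by auto
  have "(\<lambda>i. \<integral>w. g (\<lambda>j. block_sum (s i) n j w) \<partial>M) \<longlonglongrightarrow> (\<integral>w. g (\<lambda>j. V j w) \<partial>N)"
    by (rule indep_weak_convergence_joint[OF prob_space_axioms N.prob_space_axioms ind V(1) block_sum_clt[OF N.prob_space_axioms V(2) s] gc gb])
  also have "(\<integral>w. g (\<lambda>j. V j w) \<partial>N) = (\<integral>w. \<Psi> (polygon n (grid n (B w))) \<partial>N)"
  proof (rule integral_cong_AE)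
    have "(\<lambda>w j. V j w) \<in> borel_measurable N"
      using V(1) unfolding N.indep_vars_def by (intro measurable_coordinatewise_then_product) auto
    then show "(\<lambda>w. g (\<lambda>j. V j w)) \<in> borel_measurable N"
      by (rule measurable_compose[OF _ borel_measurable_continuous_onI[OF gc]])
    show "(\<lambda>w. \<Psi> (polygon n (grid n (B w)))) \<in> borel_measurable N"
      by (intro borel_measurable_polygon_grid[OF cont] borel_measurable_path_at[OF Bm])
    show "AE w in N. g (\<lambda>j. V j w) = \<Psi> (polygon n (grid n (B w)))"
      using V(3) by eventually_elim (simp add: g_def)
  qed
  finally have lim: "(\<lambda>i. \<integral>w. g (\<lambda>j. block_sum (s i) n j w) \<partial>M) \<longlonglongrightarrow> (\<integral>w. \<Psi> (polygon n (grid n (B w))) \<partial>N)" .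
  have err: "\<bar>(\<integral>w. \<Psi> (polygon n (grid n (prime_path (s i) w))) \<partial>M) - (\<integral>w. g (\<lambda>j. block_sum (s i) n j w) \<partial>M)\<bar>
      \<le> m * ((\<Sum>j<Suc (K * 2 ^ n). real j * (1 + block_const)) * (1 / sqrt (ln (1 / s i))) + 1 / (1 + real K))" (is "_ \<le> ?b i K") for i K
    unfolding g_def
  proof (rule expectation_lipschitz_difference[OF \<Psi>])
    let ?L = "sqrt (ln (1 / s i))"
    let ?d = "\<lambda>j w. \<bar>grid n (prime_path (s i) w) j - (\<Sum>l<j. block_sum (s i) n l w)\<bar>"
    let ?c = "(\<Sum>j<Suc (K * 2 ^ n). real j * (1 + block_const)) * (1 / ?L) + 1 / (1 + real K)"
    have L: "?L > 0" using s(1,2)[of i] by (simp add: ln_div)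
    have pm: "prime_path (s i) \<in> borel_measurable M" by (rule prime_path_measurable[OF s(1)])
    have dm [measurable]: "?d j \<in> borel_measurable M" for j
      unfolding grid_def
      by (intro borel_measurable_abs borel_measurable_diff borel_measurable_sum borel_measurable_path_at[OF pm] Wm) simp
    show "(\<lambda>w. \<Psi> (polygon n (grid n (prime_path (s i) w)))) \<in> borel_measurable M"
      by (intro borel_measurable_polygon_grid[OF cont] borel_measurable_path_at[OF pm])
    have "(\<lambda>w j. block_sum (s i) n j w) \<in> borel_measurable M"
      by (intro measurable_coordinatewise_then_product Wm)
    from measurable_compose[OF this borel_measurable_continuous_onI[OF gc]]
    show "(\<lambda>w. \<Psi> (polygon n (\<lambda>j. \<Sum>l<j. block_sum (s i) n l w))) \<in> borel_measurable M"
      by (simp only: g_def)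
    show "0 \<le> ?c" using L bc by (intro mult_nonneg_nonneg add_nonneg_nonneg sum_nonneg) auto
    have "(\<integral>\<^sup>+w. ennreal (cdist (polygon n (grid n (prime_path (s i) w))) (polygon n (\<lambda>j. \<Sum>l<j. block_sum (s i) n l w))) \<partial>M)
       \<le> (\<integral>\<^sup>+w. (\<Sum>j<Suc (K * 2 ^ n). ennreal (?d j w)) + ennreal (1 / (1 + real K)) \<partial>M)"
    proof (rule nn_integral_mono)
      fix w
      have "ennreal (cdist (polygon n (grid n (prime_path (s i) w))) (polygon n (\<lambda>j. \<Sum>l<j. block_sum (s i) n l w)))
          \<le> ennreal ((\<Sum>j<Suc (K * 2 ^ n). ?d j w) + 1 / (1 + real K))"
        by (intro ennreal_leI cdist_polygon)
      also have "\<dots> = ennreal (\<Sum>j<Suc (K * 2 ^ n). ?d j w) + ennreal (1 / (1 + real K))"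
        by (rule ennreal_plus) (auto intro: sum_nonneg simp del: sum.lessThan_Suc)
      also have "ennreal (\<Sum>j<Suc (K * 2 ^ n). ?d j w) = (\<Sum>j<Suc (K * 2 ^ n). ennreal (?d j w))"
        by (rule sum_ennreal[symmetric]) simp
      finally show "ennreal (cdist (polygon n (grid n (prime_path (s i) w))) (polygon n (\<lambda>j. \<Sum>l<j. block_sum (s i) n l w)))
          \<le> (\<Sum>j<Suc (K * 2 ^ n). ennreal (?d j w)) + ennreal (1 / (1 + real K))" .
    qed
    also have "\<dots> = (\<integral>\<^sup>+w. (\<Sum>j<Suc (K * 2 ^ n). ennreal (?d j w)) \<partial>M) + (\<integral>\<^sup>+w. ennreal (1 / (1 + real K)) \<partial>M)"
      by (rule nn_integral_add) measurable
    also have "(\<integral>\<^sup>+w. ennreal (1 / (1 + real K)) \<partial>M) = ennreal (1 / (1 + real K))" by (simp add: emeasure_space_1)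
    also have "(\<integral>\<^sup>+w. (\<Sum>j<Suc (K * 2 ^ n). ennreal (?d j w)) \<partial>M) = (\<Sum>j<Suc (K * 2 ^ n). \<integral>\<^sup>+w. ennreal (?d j w) \<partial>M)"
      by (rule nn_integral_sum) measurable
    also have "(\<Sum>j<Suc (K * 2 ^ n). \<integral>\<^sup>+w. ennreal (?d j w) \<partial>M) + ennreal (1 / (1 + real K))
        \<le> (\<Sum>j<Suc (K * 2 ^ n). ennreal (real j * (1 + block_const) / ?L)) + ennreal (1 / (1 + real K))"
      by (intro add_right_mono sum_mono prime_path_block_error s)
    also have "(\<Sum>j<Suc (K * 2 ^ n). ennreal (real j * (1 + block_const) / ?L)) = ennreal (\<Sum>j<Suc (K * 2 ^ n). real j * (1 + block_const) / ?L)"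
      by (rule sum_ennreal) (use L bc in simp)
    also have "(\<Sum>j<Suc (K * 2 ^ n). real j * (1 + block_const) / ?L) = (\<Sum>j<Suc (K * 2 ^ n). real j * (1 + block_const)) * (1 / ?L)"
      by (simp only: sum_divide_distrib[symmetric] times_divide_eq_right mult_1_right)
    also have "ennreal ((\<Sum>j<Suc (K * 2 ^ n). real j * (1 + block_const)) * (1 / ?L)) + ennreal (1 / (1 + real K)) = ennreal ?c"
      using L bc by (intro ennreal_plus[symmetric] mult_nonneg_nonneg sum_nonneg) auto
    finally show "(\<integral>\<^sup>+w. ennreal (cdist (polygon n (grid n (prime_path (s i) w))) (polygon n (\<lambda>j. \<Sum>l<j. block_sum (s i) n l w))) \<partial>M)
       \<le> ennreal ?c" .
  qed
  show ?thesis
  proof (rule tendstoI)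
    fix e :: real assume e: "e > 0"
    obtain K :: nat where K: "real K > 2 * m / e" using reals_Archimedean2 by blast
    define A where "A = (\<Sum>j<Suc (K * 2 ^ n). real j * (1 + block_const))"
    have sL: "(\<lambda>i. 1 / sqrt (ln (1 / s i))) \<longlonglongrightarrow> 0"
      by (intro real_tendsto_divide_at_top[OF tendsto_const] filterlim_compose[OF sqrt_at_top] ln_inverse_at_top s)
    have "(\<lambda>i. m * (A * (1 / sqrt (ln (1 / s i))) + 1 / (1 + real K))) \<longlonglongrightarrow> m * (A * 0 + 1 / (1 + real K))"
      by (intro tendsto_intros sL)
    moreover have "m * (A * 0 + 1 / (1 + real K)) < e / 2"
      using K e by (simp add: field_simps)
    ultimately have "\<forall>\<^sub>F i in sequentially. m * (A * (1 / sqrt (ln (1 / s i))) + 1 / (1 + real K)) < e / 2"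
      by (rule order_tendstoD(2))
    moreover have "\<forall>\<^sub>F i in sequentially. dist (\<integral>w. g (\<lambda>j. block_sum (s i) n j w) \<partial>M) (\<integral>w. \<Psi> (polygon n (grid n (B w))) \<partial>N) < e / 2"
      using e by (intro tendstoD[OF lim]) auto
    ultimately show "\<forall>\<^sub>F i in sequentially. dist (\<integral>w. \<Psi> (polygon n (grid n (prime_path (s i) w))) \<partial>M) (\<integral>w. \<Psi> (polygon n (grid n (B w))) \<partial>N) < e"
    proof eventually_elim
      case (elim i)
      then show ?case using err[of i K] unfolding A_def dist_real_def by linarith
    qed
  qed
qed

text \<open>The distance between the logarithmic path and the prime path has mean of order \<open>(log 1/s)\<^sup>-\<^sup>1\<^sup>/\<^sup>2\<close>, so the fourth-moment criterion for
  the prime paths decides.\<close>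

lemma log_path_lipschitz_convergence:
  fixes s :: "nat \<Rightarrow> real"
  assumes B: "standard_brownian_motion N B"
    and s: "\<And>i. 0 < s i" "\<And>i. s i < 1" "s \<longlonglongrightarrow> 0"
    and \<Psi>: "cdist_lipschitz m \<Psi>" "\<And>x. \<bar>\<Psi> x\<bar> \<le> D"
  shows "(\<lambda>i. \<integral>w. \<Psi> (log_path (s i) w) \<partial>M) \<longlonglongrightarrow> (\<integral>w. \<Psi> (B w) \<partial>N)"
proof -
  interpret N: prob_space N using B by (simp add: standard_brownian_motion_def)
  have Bm: "B \<in> borel_measurable N" using B by (simp add: standard_brownian_motion_def)
  have m: "m \<ge> 0" using \<Psi>(1) by (simp add: cdist_lipschitz_def)
  note cont = cdist_lipschitz_continuous[OF \<Psi>(1)]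
  have lim: "(\<lambda>i. \<integral>w. \<Psi> (prime_path (s i) w) \<partial>M) \<longlonglongrightarrow> (\<integral>w. \<Psi> (B w) \<partial>N)"
  proof (rule kolmogorov_weak_convergence[where C = "3 * block_const\<^sup>2", OF prob_space_axioms N.prob_space_axioms])
    show "prime_path (s i) \<in> borel_measurable M" for i by (rule prime_path_measurable[OF s(1)])
    show "B \<in> borel_measurable N" by (rule Bm)
    show "0 \<le> 3 * block_const\<^sup>2" by simp
    show "(\<integral>\<^sup>+w. ennreal ((path_at (prime_path (s i) w) t - path_at (prime_path (s i) w) r) ^ 4) \<partial>M)
        \<le> ennreal (3 * block_const\<^sup>2 * (t - r)\<^sup>2)" if "0 \<le> r" "r \<le> t" for i r t
      by (rule prime_path_fourth_moment[OF s(1,2) that])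
    show "(\<lambda>i. \<integral>w. \<Psi>' (polygon n (grid n (prime_path (s i) w))) \<partial>M) \<longlonglongrightarrow> (\<integral>w. \<Psi>' (polygon n (grid n (B w))) \<partial>N)"
      if "cdist_lipschitz m' \<Psi>'" "\<And>x. \<bar>\<Psi>' x\<bar> \<le> D'" for n \<Psi>' m' D'
      by (rule prime_path_fdd[OF B s that])
  qed (rule \<Psi>)+
  obtain C where C: "C \<ge> 0" "(\<integral>\<^sup>+w. ennreal \<bar>prime_series 1 w\<bar> \<partial>M) \<le> ennreal C"
    by (rule prime_series_one_integrable)
  have R: "log_remainder_bound \<ge> 0"
    unfolding log_remainder_bound_def using zeta_sum_2_ge_1 zeta_sum_ge_1[of "3 / 2"] by simp
  have err: "norm ((\<integral>w. \<Psi> (log_path (s i) w) \<partial>M) - (\<integral>w. \<Psi> (prime_path (s i) w) \<partial>M))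
      \<le> m * (1 / sqrt (ln (1 / s i)) * (log_remainder_bound + C))" for i
    unfolding real_norm_def
  proof (rule expectation_lipschitz_difference[OF \<Psi>])
    let ?L = "sqrt (ln (1 / s i))"
    have L: "?L > 0" using s(1,2)[of i] by (simp add: ln_div)
    show "(\<lambda>w. \<Psi> (log_path (s i) w)) \<in> borel_measurable M"
      by (rule continuous_imp_borel[OF cont log_path_measurable[OF s(1)]])
    show "(\<lambda>w. \<Psi> (prime_path (s i) w)) \<in> borel_measurable M"
      by (rule continuous_imp_borel[OF cont prime_path_measurable[OF s(1)]])
    show "0 \<le> 1 / ?L * (log_remainder_bound + C)" using R C(1) L by simp
    have "(\<integral>\<^sup>+w. ennreal (cdist (log_path (s i) w) (prime_path (s i) w)) \<partial>M)
       \<le> (\<integral>\<^sup>+w. ennreal (1 / ?L) * (ennreal log_remainder_bound + ennreal \<bar>prime_series 1 w\<bar>) \<partial>M)"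
    proof (rule nn_integral_mono_AE)
      show "AE w in M. ennreal (cdist (log_path (s i) w) (prime_path (s i) w))
          \<le> ennreal (1 / ?L) * (ennreal log_remainder_bound + ennreal \<bar>prime_series 1 w\<bar>)"
        using G_AE
      proof eventually_elim
        case (elim w)
        have "cdist (log_path (s i) w) (prime_path (s i) w) \<le> 1 / ?L * (log_remainder_bound + \<bar>prime_series 1 w\<bar>)"
          using log_path_prime_path[OF s(1,2) elim] by simp
        then have "ennreal (cdist (log_path (s i) w) (prime_path (s i) w))
            \<le> ennreal (1 / ?L * (log_remainder_bound + \<bar>prime_series 1 w\<bar>))" by (rule ennreal_leI)
        also have "\<dots> = ennreal (1 / ?L) * ennreal (log_remainder_bound + \<bar>prime_series 1 w\<bar>)"
          using L by (intro ennreal_mult') simp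
        also have "ennreal (log_remainder_bound + \<bar>prime_series 1 w\<bar>) = ennreal log_remainder_bound + ennreal \<bar>prime_series 1 w\<bar>"
          using R by (intro ennreal_plus) auto
        finally show ?case .
      qed
    qed
    also have "\<dots> = ennreal (1 / ?L) * (\<integral>\<^sup>+w. ennreal log_remainder_bound + ennreal \<bar>prime_series 1 w\<bar> \<partial>M)"
      by (rule nn_integral_cmult) measurable
    also have "(\<integral>\<^sup>+w. ennreal log_remainder_bound + ennreal \<bar>prime_series 1 w\<bar> \<partial>M) =
        (\<integral>\<^sup>+w. ennreal log_remainder_bound \<partial>M) + (\<integral>\<^sup>+w. ennreal \<bar>prime_series 1 w\<bar> \<partial>M)"
      by (rule nn_integral_add) measurable
    also have "(\<integral>\<^sup>+w. ennreal log_remainder_bound \<partial>M) = ennreal log_remainder_bound" by (simp add: emeasure_space_1)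
    also have "ennreal (1 / ?L) * (ennreal log_remainder_bound + (\<integral>\<^sup>+w. ennreal \<bar>prime_series 1 w\<bar> \<partial>M))
        \<le> ennreal (1 / ?L) * (ennreal log_remainder_bound + ennreal C)"
      by (intro mult_left_mono add_left_mono C(2)) simp
    also have "ennreal log_remainder_bound + ennreal C = ennreal (log_remainder_bound + C)"
      by (rule ennreal_plus[symmetric]) (use R C in auto)
    also have "ennreal (1 / ?L) * ennreal (log_remainder_bound + C) = ennreal (1 / ?L * (log_remainder_bound + C))"
      using L by (intro ennreal_mult'[symmetric]) simp
    finally show "(\<integral>\<^sup>+w. ennreal (cdist (log_path (s i) w) (prime_path (s i) w)) \<partial>M)
        \<le> ennreal (1 / ?L * (log_remainder_bound + C))" .
  qed
  have "(\<lambda>i. m * (1 / sqrt (ln (1 / s i)) * (log_remainder_bound + C))) \<longlonglongrightarrow> m * (0 * (log_remainder_bound + C))"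
    by (intro tendsto_mult tendsto_const real_tendsto_divide_at_top[OF tendsto_const] filterlim_compose[OF sqrt_at_top] ln_inverse_at_top s)
  then have "(\<lambda>i. m * (1 / sqrt (ln (1 / s i)) * (log_remainder_bound + C))) \<longlonglongrightarrow> 0" by simp
  from tendsto_add[OF Lim_null_comparison[OF always_eventually[OF allI[OF err]] this] lim] show ?thesis by simp
qed

lemma log_process_completion:
  assumes s: "0 < s"
  shows "log_process f s \<in> borel_measurable (completion M)"
    and "continuous_on UNIV \<Phi> \<Longrightarrow> (\<integral>w. \<Phi> (log_process f s w) \<partial>completion M) = (\<integral>w. (\<Phi> (log_path s w) :: real) \<partial>M)"
proof -
  have null: "space M - G \<in> null_sets M"
    using G_AE G_sets by (subst AE_iff_null_sets) (auto elim: eventually_mono)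
  show meas: "log_process f s \<in> borel_measurable (completion M)"
    by (rule measurable_completion_off_null_set[OF log_path_measurable[OF s] null]) (auto simp: log_path_def)
  assume \<Phi>: "continuous_on UNIV \<Phi>"
  have pm: "(\<lambda>w. \<Phi> (log_path s w)) \<in> borel_measurable M"
    by (rule continuous_imp_borel[OF \<Phi> log_path_measurable[OF s]])
  have "(\<integral>w. \<Phi> (log_process f s w) \<partial>completion M) = (\<integral>w. \<Phi> (log_path s w) \<partial>completion M)"
  proof (rule integral_cong_AE)
    show "(\<lambda>w. \<Phi> (log_process f s w)) \<in> borel_measurable (completion M)"
      by (rule continuous_imp_borel[OF \<Phi> meas])
    show "(\<lambda>w. \<Phi> (log_path s w)) \<in> borel_measurable (completion M)"
      by (rule measurable_completion[OF pm])
    show "AE w in completion M. \<Phi> (log_process f s w) = \<Phi> (log_path s w)"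
      using AE_completion[OF G_AE] by eventually_elim (simp add: log_path_def)
  qed
  also have "\<dots> = (\<integral>w. \<Phi> (log_path s w) \<partial>M)" by (rule integral_completion[OF pm])
  finally show "(\<integral>w. \<Phi> (log_process f s w) \<partial>completion M) = (\<integral>w. \<Phi> (log_path s w) \<partial>M)" .
qed

lemma log_process_converges_weakly:
  assumes B: "standard_brownian_motion N B"
  shows "converges_weakly (completion M) (log_process f) N B (at_right 0)"
  unfolding converges_weakly_def
proof (intro conjI allI impI)
  interpret N: prob_space N using B by (simp add: standard_brownian_motion_def)
  show "prob_space (completion M)"
    by (rule prob_spaceI) (simp add: emeasure_space_1)
  show "prob_space N" by (rule N.prob_space_axioms)
  show Bm: "B \<in> borel_measurable N" using B by (simp add: standard_brownian_motion_def)
  show "\<forall>\<^sub>F s in at_right 0. log_process f s \<in> borel_measurable (completion M)"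
    by (rule eventually_mono[OF eventually_at_right_less]) (rule log_process_completion(1))
  fix \<Phi> :: "cpath \<Rightarrow> real" assume \<Phi>: "continuous_on UNIV \<Phi> \<and> bounded (range \<Phi>)"
  show "((\<lambda>s. \<integral>w. \<Phi> (log_process f s w) \<partial>completion M) \<longlongrightarrow> (\<integral>w. \<Phi> (B w) \<partial>N)) (at_right 0)"
  proof (rule tendsto_at_right_sequentially[of 0 1])
    fix s :: "nat \<Rightarrow> real" assume s: "\<And>i. 0 < s i" "\<And>i. s i < 1" "s \<longlonglongrightarrow> 0"
    have "(\<lambda>i. \<integral>w. \<Phi> (log_path (s i) w) \<partial>M) \<longlonglongrightarrow> (\<integral>w. \<Phi> (B w) \<partial>N)"
      by (rule weak_convergence_lipschitz[OF prob_space_axioms N.prob_space_axioms log_path_measurable[OF s(1)] Bm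
            log_path_lipschitz_convergence[OF B s]]) (use \<Phi> in auto)
    then show "(\<lambda>i. \<integral>w. \<Phi> (log_process f (s i) w) \<partial>completion M) \<longlonglongrightarrow> (\<integral>w. \<Phi> (B w) \<partial>N)"
      using log_process_completion(2)[OF s(1)] \<Phi> by simp
  qed simp
qed

end

end

theorem corollary1:
  fixes M :: "'a measure" and f :: "nat \<Rightarrow> 'a \<Rightarrow> real"
    and N :: "'b measure" and B :: "'b \<Rightarrow> cpath"
  assumes "rademacher_multiplicative M f"
    and "standard_brownian_motion N B"
  shows "converges_weakly (completion M) (log_process f) N B (at_right 0)"
proof -
  interpret prob_space M using assms(1) by (simp add: rademacher_multiplicative_def)
  interpret rademacher_rmf M f by unfold_locales (rule assms(1))
  obtain Z where Z: "{w \<in> space M. \<not> (regular w \<and> (\<forall>u>0. dirichlet_sum f w (1 / 2 + u) = exp (euler_log (\<lambda>n. f n w) (1 / 2 + u))))} \<subseteq> Z"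
    "emeasure M Z = 0" "Z \<in> sets M"
    using AE_E[OF AE_euler_product] .
  show ?thesis
  proof (rule log_process_converges_weakly[OF _ _ _ _ assms(2)])
    show "space M - Z \<in> sets M" using Z(3) by auto
    show "AE w in M. w \<in> space M - Z"
      using AE_not_in[of Z M] AE_space Z(2,3) by (auto simp: null_sets_def)
    show "regular w" if "w \<in> space M - Z" for w using Z(1) that by blast
    show "dirichlet_sum f w (1 / 2 + u) = exp (euler_log (\<lambda>n. f n w) (1 / 2 + u))" if "w \<in> space M - Z" "u > 0" for w u
      using Z(1) that by blast
  qed
qed

end
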